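(* Let $(S_n(\omega))_{n=0}^\infty$ be a monic Sheffer sequence over $V$ with generating function $$\sum_{n=0}^\infty\frac1{n!}\langle S_n(\omega),v^{\otimes n}\rangle=\exp\big[\langle\omega,B(v)\rangle+\alpha(v)\big],\quad\omega\in V^*,$$ where $B(v)\in\mathcal F_1(V)$ and $\alpha(v)=\sum_{k=1}^\infty\langle\alpha_k,v^{\otimes k}\rangle\in\mathcal F(V,\mathbb F)$, and let $L(v)=B^{\langle-1\rangle}(v)$. Let $Q$ be its lowering differential and $R\in\mathcal L(\mathcal P(V^*,V),\mathcal P(V^* ))$ its raising differential. For $\zeta\in V$ set $$\Psi_\zeta(v):=L'(B(v);\zeta)=\sum_{k=0}^\infty\Psi_{\zeta,k}v^{\otimes k}\in\mathcal F(V,V),\qquad\Delta_\zeta(v):=-\alpha'(v;\Psi_\zeta(v))=\sum_{k=0}^\infty\langle\Delta_{\zeta,k},v^{\otimes k}\rangle\in\mathcal F(V,\mathbb F),$$ and let $M(\zeta)\in\mathcal L(\mathcal P(V^* ))$ be $(M(\zeta)p)(\omega):=\langle\omega,\zeta\rangle p(\omega)$. Then, for each $\zeta\in V$, $$M(\zeta)=R\,\Psi_\zeta(Q)+\Delta_\zeta(Q).$$ Equivalently, for each $n\in\mathbb N_0$, $\omega\in V^*$ and $v\in V$, \begin{align*} &\langle\omega,\zeta\rangle\langle S_n(\omega),v^{\otimes n}\rangle=\langle S_{n+1}(\omega),v^{\otimes n}\odot\zeta\rangle\\ &\quad+\sum_{m=1}^n\Big\langle S_m(\omega),(n)_{n-m+1}\,v^{\otimes(m-1)}\odot\big(\Psi_{\zeta,n-m+1}v^{\otimes(n-m+1)}\big)+(n)_{n-m}\,v^{\otimes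 m}\langle\Delta_{\zeta,n-m},v^{\otimes(n-m)}\rangle\Big\rangle\\ &\quad+n!\,\langle\Delta_{\zeta,n},v^{\otimes n}\rangle. \end{align*}
   Context: $\mathbb F=\mathbb R$ or $\mathbb C$; $V$ is a vector space over $\mathbb F$ (of any dimension); $V^*$ is its algebraic dual; $\langle\cdot,\cdot\rangle$ denotes the dual pairing (also between $(V^{\odot n})^*$ and $V^{\odot n}$). $\mathbb N=\{1,2,\dots\}$, $\mathbb N_0=\mathbb N\cup\{0\}$; $(n)_k=n(n-1)\dotsm(n-k+1)$, $(n)_0=1$. $\mathcal L(U,W)$ is the space of linear operators, $\mathcal L(U)=\mathcal L(U,U)$. $V^{\odot n}$ is the $n$th algebraic symmetric tensor power of $V$, the linear span of the vectors $v_1\odot\dots\odot v_n=\frac1{n!}\sum_{\pi\in S_n}v_{\pi(1)}\otimes\dots\otimes v_{\pi(n)}$ (equivalently, of the vectors $v^{\otimes n}$); $V^{\odot0}=\mathbb F$, $v^{\otimes0}=1$. $\odot$ also denotes the induced symmetric product $V^{\odot m}\times V^{\odot n}\to V^{\odot(m+n)}$. For $\omega\in V^*$, $\langle\omega^{\otimes n},v_1\odot\dots\odot v_n\rangle=\prod_i\langle\omega,v_i\rangle$, $\omega^{\otimes 0}=1$. For linear operators (or functionals) $A_i$ on $V^{\odot l_i}$, $m=l_1+\dots+l_n$, $(A_1\odot\dots\odot A_n)v^{\otimes m}=(A_1v^{\otimes l_1})\odot\dots\odot(A_nv^{\otimes l_n})$. Polynomials: $\mathcal P(V^* )$ is the space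 of functions $p:V^*\to\mathbb F$, $p(\omega)=\sum_{k=0}^n\langle\omega^{\otimes k},f_k\rangle$, $f_k\in V^{\odot k}$. $\mathcal P(V^*,W)$ is the linear span of the functions $\omega\mapsto p(\omega)w$, $p\in\mathcal P(V^* )$, $w\in W$. A polynomial sequence over $V$ is a sequence of maps $\omega\mapsto S_n(\omega)\in(V^{\odot n})^*$, $n\in\mathbb N_0$, with $\langle S_n(\omega),f_n\rangle=\sum_{k=0}^n\langle\omega^{\otimes k},S_{kn}f_n\rangle$, $f_n\in V^{\odot n}$, $S_{kn}\in\mathcal L(V^{\odot n},V^{\odot k})$, each $S_{nn}$ bijective; it is monic if each $S_{nn}$ is the identity operator. It is a Sheffer sequence if its generating function $\sum_n\frac1{n!}\langle S_n(\omega),v^{\otimes n}\rangle$ equals $\exp[\langle\omega,B(v)\rangle]A(v)$ with $B(v)\in\mathcal F_1(V)$, $A(v)\in\mathcal F(V,\mathbb F)$, $A(0)\ne0$; when $A(0)=1$ (as for monic sequences) one sets $\alpha(v)=\log A(v)$, giving the form in the claim. Lowering: for $k\in\mathbb N$, $Q^k\in\mathcal L(\mathcal P(V^* ),\mathcal P(V^*,V^{\odot k}))$ is the linear operator determined by $(Q^k\langle S_n(\cdot),v^{\otimes n}\rangle)(\omega)=(n)_k\langle S_{n-k}(\omega),v^{\otimes(n-k)}\rangle v^{\otimes k}$ (zero if $k>n$); $Q=Q^1$ is the lowering differential. For $G(v)=G_0+\sum_{k\ge1}G_kv^{\otimes k}\in\mathcal F(V,W)$ with $W=V$ or $\mathbb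 F$, $(G(Q)p)(\omega)=p(\omega)G_0+\sum_{k\ge1}G_k((Q^kp)(\omega))$ (a finite sum for each $p$), so $G(Q)\in\mathcal L(\mathcal P(V^* ),\mathcal P(V^*,W))$. Raising: for $\zeta\in V$, $R(\zeta)\in\mathcal L(\mathcal P(V^* ))$ is determined by $(R(\zeta)\langle S_n(\cdot),f_n\rangle)(\omega)=\langle S_{n+1}(\omega),f_n\odot\zeta\rangle$, and the raising differential $R\in\mathcal L(\mathcal P(V^*,V),\mathcal P(V^* ))$ is determined by $R(\zeta p(\cdot))(\omega)=(R(\zeta)p)(\omega)$ for $\zeta\in V$, $p\in\mathcal P(V^* )$. Formal tensor power series: $\mathcal F(V,W)$ is the set of formal series $A(v)=A_0+\sum_{n\ge1}A_nv^{\otimes n}$ with $A_0\in W$, $A_n\in\mathcal L(V^{\odot n},W)$, identified with the coefficient sequence; for $W=\mathbb F$ one writes $\langle A_n,v^{\otimes n}\rangle$. Products in $\mathcal F(V,\mathbb F)$ have $n$th coefficient $\sum_{k=0}^nA^{(1)}_k\odot A^{(2)}_{n-k}$; $\langle\omega,B(v)\rangle=\sum_n\langle\omega,B_nv^{\otimes n}\rangle$; $\exp[C(v)]=\sum_{k\ge0}\frac1{k!}C(v)^k$ when $C(0)=0$. For $A(v)\in\mathcal F(V,W)$ and $B(v)\in\mathcal F(V,V)$ with $B(0)=0$, the composition $A(B(v))$ has zeroth coefficient $A_0$ and $n$th coefficient $\sum_{m=1}^nA_m\sum_{i_1,\dots,i_m\ge1,\,i_1+\dots+i_m=n}B_{i_1}\odot\dots\odot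 B_{i_m}$. $\mathcal F_1(V)$ is the set of $B(v)\in\mathcal F(V,V)$ with $B(0)=0$ and $B_1$ invertible, a group under composition with identity $v$; $B^{\langle-1\rangle}(v)$ is the compositional inverse. The derivative of $A(v)\in\mathcal F(V,W)$ in direction $\zeta\in V$ is $A'(v;\zeta)=\sum_{n\ge1}nA_n(v^{\otimes(n-1)}\odot\zeta)$, and $L'(B(v);\zeta)$ is the composition of the series $L'(v;\zeta)$ with $B(v)$. The derivative in direction $C(v)\in\mathcal F(V,V)$ is $A'(v;C(v))=\sum_{n\ge1}nA_n(v^{\otimes(n-1)}\odot C(v))=A_1C_0+\sum_{n\ge1}\sum_{m=0}^n(m+1)A_{m+1}(\mathbf 1_m\odot C_{n-m})v^{\otimes n}$, with $\mathbf 1_m$ the identity on $V^{\odot m}$. *)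

theory Defs
  imports "HOL-Analysis.Analysis" "HOL-Combinatorics.Permutations" "HOL-Library.Function_Algebras"
begin

text \<open>
  A vector space \<open>V\<close> is a type \<open>'v\<close> with a scalar multiplication \<open>sV\<close> satisfying
  \<^locale>\<open>vector_space\<close>. Spaces without a type of their own (symmetric powers, spaces of
  polynomials) are sets in a type of functions, with pointwise operations.

  The definitions make sense over every field of characteristic \<open>0\<close>. The sort
  \<open>{real_normed_field, euclidean_space}\<close> expresses \<open>\<F> = \<real>\<close> or \<open>\<F> = \<complex>\<close>: both types are instances, and
  up to isomorphism there are no other fields of finite dimension over \<open>\<real>\<close>.
\<close>

definition pointwise :: "('f \<Rightarrow> 'w \<Rightarrow> 'w) \<Rightarrow> 'f \<Rightarrow> ('x \<Rightarrow> 'w) \<Rightarrow> 'x \<Rightarrow> 'w" where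
  "pointwise sW c g = (\<lambda>x. sW c (g x))"

text \<open>
  \<open>\<L>(U, W)\<close> for subspaces \<open>U\<close> and \<open>W\<close> of ambient types. The value outside \<open>U\<close> is fixed to be \<open>0\<close>,
  so that operators are equal as functions iff they agree on \<open>U\<close>.
\<close>

definition lin_maps ::
  "('f \<Rightarrow> 'u::ab_group_add \<Rightarrow> 'u) \<Rightarrow> 'u set \<Rightarrow> ('f \<Rightarrow> 'w::ab_group_add \<Rightarrow> 'w) \<Rightarrow> 'w set
    \<Rightarrow> ('u \<Rightarrow> 'w) set" where
  "lin_maps sU U sW W = {A.
     (\<forall>x\<in>U. A x \<in> W) \<and>
     (\<forall>x\<in>U. \<forall>y\<in>U. A (x + y) = A x + A y) \<and>
     (\<forall>c. \<forall>x\<in>U. A (sU c x) = sW c (A x)) \<and>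
     (\<forall>x. x \<notin> U \<longrightarrow> A x = 0)}"

definition dual_space :: "('f::field \<Rightarrow> 'v::ab_group_add \<Rightarrow> 'v) \<Rightarrow> ('v \<Rightarrow> 'f) set" where
  "dual_space sV = {\<omega>. Vector_Spaces.linear sV (*) \<omega>}"

definition falling :: "nat \<Rightarrow> nat \<Rightarrow> nat" where
  "falling n k = (\<Prod>i<k. n - i)"


section \<open>Symmetric tensor powers\<close>

text \<open>
  The algebraic tensor powers are realised inside the functions of lists of functionals:
  \<open>v\<^sub>1 \<otimes> \<dots> \<otimes> v\<^sub>n\<close> is the function supported on lists of length \<open>n\<close> of elements of \<open>V\<^sup>*\<close> with value
  \<open>\<langle>\<omega>\<^sub>1, v\<^sub>1\<rangle> \<cdots> \<langle>\<omega>\<^sub>n, v\<^sub>n\<rangle>\<close>. Over a field the canonical linear map from the \<open>n\<close>th algebraic tensor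
  power of \<open>V\<close> to the multilinear forms on \<open>(V\<^sup>*)\<^sup>n\<close> is injective, in any dimension, so the linear
  span of these functions is a model of it. All degrees share one type, and the degree of a
  homogeneous tensor is the length of the lists that support it.
\<close>

type_synonym ('f, 'v) tensor = "('v \<Rightarrow> 'f) list \<Rightarrow> 'f"

abbreviation tscale :: "'f::field \<Rightarrow> ('x \<Rightarrow> 'f) \<Rightarrow> 'x \<Rightarrow> 'f" where
  "tscale \<equiv> pointwise (*)"

definition pure_tensor ::
  "('f::field_char_0 \<Rightarrow> 'v::ab_group_add \<Rightarrow> 'v) \<Rightarrow> 'v list \<Rightarrow> ('f, 'v) tensor" where
  "pure_tensor sV vs = (\<lambda>\<omega>s.
     if length \<omega>s = length vs \<and> set \<omega>s \<subseteq> dual_space sV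
     then \<Prod>i<length vs. (\<omega>s ! i) (vs ! i) else 0)"

definition sym_tensor ::
  "('f::field_char_0 \<Rightarrow> 'v::ab_group_add \<Rightarrow> 'v) \<Rightarrow> 'v list \<Rightarrow> ('f, 'v) tensor" where
  "sym_tensor sV vs = tscale (1 / fact (length vs))
     (\<Sum>\<pi> | \<pi> permutes {..<length vs}. pure_tensor sV (permute_list \<pi> vs))"

text \<open>\<open>sym_power sV n\<close> is \<open>V\<^sup>\<odot>\<^sup>n\<close>; \<open>sym_power sV 0\<close> is spanned by \<open>pure_tensor sV []\<close>, which
  plays the role of \<open>1 \<in> \<F>\<close>. \<open>tpow sV n v\<close> is the \<open>n\<close>-fold power of \<open>v\<close>.\<close>

definition sym_power ::
  "('f::field_char_0 \<Rightarrow> 'v::ab_group_add \<Rightarrow> 'v) \<Rightarrow> nat \<Rightarrow> ('f, 'v) tensor set" where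
  "sym_power sV n = module.span tscale {sym_tensor sV vs | vs. length vs = n}"

definition tpow ::
  "('f::field_char_0 \<Rightarrow> 'v::ab_group_add \<Rightarrow> 'v) \<Rightarrow> nat \<Rightarrow> 'v \<Rightarrow> ('f, 'v) tensor" where
  "tpow sV n v = pure_tensor sV (replicate n v)"

text \<open>For \<open>s\<close> of degree \<open>m\<close> and \<open>t\<close> of degree \<open>n\<close>, only the summand \<open>i = m\<close> of the tensor product
  \<open>s \<otimes> t\<close> is nonzero; \<open>s \<odot> t\<close> is its symmetrization.\<close>

definition tensor_prod :: "('f::field_char_0, 'v) tensor \<Rightarrow> ('f, 'v) tensor \<Rightarrow> ('f, 'v) tensor" where
  "tensor_prod s t = (\<lambda>\<omega>s. \<Sum>i\<le>length \<omega>s. s (take i \<omega>s) * t (drop i \<omega>s))"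

definition symmetrize :: "('f::field_char_0, 'v) tensor \<Rightarrow> ('f, 'v) tensor" where
  "symmetrize t = (\<lambda>\<omega>s.
     (\<Sum>\<pi> | \<pi> permutes {..<length \<omega>s}. t (permute_list \<pi> \<omega>s)) / fact (length \<omega>s))"

definition sym_prod :: "('f::field_char_0, 'v) tensor \<Rightarrow> ('f, 'v) tensor \<Rightarrow> ('f, 'v) tensor"
    (infixl "\<odot>" 70) where
  "s \<odot> t = symmetrize (tensor_prod s t)"

text \<open>\<open>\<langle>\<omega>\<^sup>\<otimes>\<^sup>n, f\<rangle>\<close> is evaluation at the list \<open>(\<omega>, \<dots>, \<omega>)\<close>; on \<open>v\<^sub>1 \<odot> \<dots> \<odot> v\<^sub>n\<close> it is
  \<open>\<langle>\<omega>, v\<^sub>1\<rangle> \<cdots> \<langle>\<omega>, v\<^sub>n\<rangle>\<close>, as shown below.\<close>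

definition dual_pow :: "nat \<Rightarrow> ('v \<Rightarrow> 'f) \<Rightarrow> ('f, 'v) tensor \<Rightarrow> 'f" where
  "dual_pow n \<omega> f = f (replicate n \<omega>)"


lemma dual_pow_sym_tensor:
  assumes "\<omega> \<in> dual_space sV"
  shows "dual_pow (length vs) \<omega> (sym_tensor sV vs) = (\<Prod>i<length vs. \<omega> (vs ! i))"
proof -
  let ?n = "length vs"
  have eval: "(\<Sum>\<pi>\<in>P. g \<pi>) x = (\<Sum>\<pi>\<in>P. g \<pi> x)" for g :: "(nat \<Rightarrow> nat) \<Rightarrow> ('b, 'a) tensor" and P x
    by (induction P rule: infinite_finite_induct) auto
  have "pure_tensor sV (permute_list \<pi> vs) (replicate ?n \<omega>) = (\<Prod>i<?n. \<omega> (vs ! i))"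
    if "\<pi> permutes {..<?n}" for \<pi>
  proof -
    have "pure_tensor sV (permute_list \<pi> vs) (replicate ?n \<omega>) = (\<Prod>i<?n. \<omega> (vs ! \<pi> i))"
      using assms that by (auto simp: pure_tensor_def permute_list_nth intro!: prod.cong)
    also have "\<dots> = (\<Prod>i<?n. \<omega> (vs ! i))"
      using prod.permute[OF that, of "\<lambda>i. \<omega> (vs ! i)"] by (simp add: comp_def)
    finally show ?thesis .
  qed
  then show ?thesis
    by (simp add: dual_pow_def sym_tensor_def pointwise_def eval card_permutations)
qed


section \<open>Formal tensor power series\<close>

text \<open>
  A series \<open>A(v) \<in> \<F>(V, W)\<close> is its sequence of coefficients \<open>A n \<in> \<L>(V\<^sup>\<odot>\<^sup>n, W)\<close>; the constant
  term \<open>A\<^sub>0 \<in> W\<close> is \<open>A 0\<close> applied to the unit of \<open>V\<^sup>\<odot>\<^sup>0\<close>. Two series are equal iff they are equal as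
  functions. The space \<open>W\<close> is a whole type, with scalar multiplication \<open>sW\<close>.
\<close>

definition fseries ::
  "('f::field_char_0 \<Rightarrow> 'v::ab_group_add \<Rightarrow> 'v) \<Rightarrow> ('f \<Rightarrow> 'w::ab_group_add \<Rightarrow> 'w)
    \<Rightarrow> (nat \<Rightarrow> ('f, 'v) tensor \<Rightarrow> 'w) set" where
  "fseries sV sW = {A. \<forall>n. A n \<in> lin_maps tscale (sym_power sV n) sW UNIV}"

text \<open>The linear operator on \<open>V\<^sup>\<odot>\<^sup>n\<close> determined by its values \<open>q v\<close> on the powers of vectors \<open>v\<close>, which
  span \<open>V\<^sup>\<odot>\<^sup>n\<close>. Below, \<open>q\<close> is always the restriction of a multilinear map to the diagonal.\<close>

definition op_of_powers ::
  "('f::field_char_0 \<Rightarrow> 'v::ab_group_add \<Rightarrow> 'v) \<Rightarrow> ('f \<Rightarrow> 'w::ab_group_add \<Rightarrow> 'w)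
    \<Rightarrow> nat \<Rightarrow> ('v \<Rightarrow> 'w) \<Rightarrow> ('f, 'v) tensor \<Rightarrow> 'w" where
  "op_of_powers sV sW n q = (THE A.
     A \<in> lin_maps tscale (sym_power sV n) sW UNIV \<and> (\<forall>v. A (tpow sV n v) = q v))"

definition ser_one ::
  "('f::field_char_0 \<Rightarrow> 'v::ab_group_add \<Rightarrow> 'v) \<Rightarrow> nat \<Rightarrow> ('f, 'v) tensor \<Rightarrow> 'f" where
  "ser_one sV n = op_of_powers sV (*) n (\<lambda>v. if n = 0 then 1 else 0)"

definition ser_mult ::
  "('f::field_char_0 \<Rightarrow> 'v::ab_group_add \<Rightarrow> 'v)
    \<Rightarrow> (nat \<Rightarrow> ('f, 'v) tensor \<Rightarrow> 'f) \<Rightarrow> (nat \<Rightarrow> ('f, 'v) tensor \<Rightarrow> 'f)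
    \<Rightarrow> nat \<Rightarrow> ('f, 'v) tensor \<Rightarrow> 'f" where
  "ser_mult sV A C n = op_of_powers sV (*) n
     (\<lambda>v. \<Sum>k\<le>n. A k (tpow sV k v) * C (n - k) (tpow sV (n - k) v))"

primrec ser_power ::
  "('f::field_char_0 \<Rightarrow> 'v::ab_group_add \<Rightarrow> 'v)
    \<Rightarrow> (nat \<Rightarrow> ('f, 'v) tensor \<Rightarrow> 'f) \<Rightarrow> nat \<Rightarrow> nat \<Rightarrow> ('f, 'v) tensor \<Rightarrow> 'f" where
  "ser_power sV C 0 = ser_one sV"
| "ser_power sV C (Suc k) = ser_mult sV C (ser_power sV C k)"

text \<open>Only used for \<open>C(0) = 0\<close>; then the \<open>k\<close>th power of \<open>C\<close> has no terms of degree less than \<open>k\<close>,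
  so the sum over all \<open>k\<close> stops at \<open>k = n\<close> in degree \<open>n\<close>.\<close>

definition ser_exp ::
  "('f::field_char_0 \<Rightarrow> 'v::ab_group_add \<Rightarrow> 'v)
    \<Rightarrow> (nat \<Rightarrow> ('f, 'v) tensor \<Rightarrow> 'f) \<Rightarrow> nat \<Rightarrow> ('f, 'v) tensor \<Rightarrow> 'f" where
  "ser_exp sV C n = (\<lambda>f. \<Sum>k\<le>n. 1 / fact k * ser_power sV C k n f)"

text \<open>The composition \<open>A(B(v))\<close> for \<open>B(0) = 0\<close>. The list \<open>is\<close> is \<open>(i\<^sub>1, \<dots>, i\<^sub>m)\<close>, and
  \<open>(B\<^sub>i\<^sub>1 \<odot> \<dots> \<odot> B\<^sub>i\<^sub>m) v\<^sup>\<otimes>\<^sup>n\<close> is the symmetric product of the vectors \<open>B\<^sub>i v\<^sup>\<otimes>\<^sup>i\<close>.\<close>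

definition ser_comp ::
  "('f::field_char_0 \<Rightarrow> 'v::ab_group_add \<Rightarrow> 'v) \<Rightarrow> ('f \<Rightarrow> 'w::ab_group_add \<Rightarrow> 'w)
    \<Rightarrow> (nat \<Rightarrow> ('f, 'v) tensor \<Rightarrow> 'w) \<Rightarrow> (nat \<Rightarrow> ('f, 'v) tensor \<Rightarrow> 'v)
    \<Rightarrow> nat \<Rightarrow> ('f, 'v) tensor \<Rightarrow> 'w" where
  "ser_comp sV sW A B n =
     (if n = 0 then A 0
      else op_of_powers sV sW n (\<lambda>v.
        \<Sum>m = 1..n. A m (\<Sum>is | length is = m \<and> (\<forall>i\<in>set is. 1 \<le> i) \<and> sum_list is = n.
          sym_tensor sV (map (\<lambda>i. B i (tpow sV i v)) is))))"

definition ser_id ::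
  "('f::field_char_0 \<Rightarrow> 'v::ab_group_add \<Rightarrow> 'v) \<Rightarrow> nat \<Rightarrow> ('f, 'v) tensor \<Rightarrow> 'v" where
  "ser_id sV n = op_of_powers sV sV n (\<lambda>v. if n = 1 then v else 0)"

definition fseries1 ::
  "('f::field_char_0 \<Rightarrow> 'v::ab_group_add \<Rightarrow> 'v) \<Rightarrow> (nat \<Rightarrow> ('f, 'v) tensor \<Rightarrow> 'v) set" where
  "fseries1 sV = {B \<in> fseries sV sV. B 0 = 0 \<and> bij_betw (B 1) (sym_power sV 1) UNIV}"

definition ser_inverse ::
  "('f::field_char_0 \<Rightarrow> 'v::ab_group_add \<Rightarrow> 'v)
    \<Rightarrow> (nat \<Rightarrow> ('f, 'v) tensor \<Rightarrow> 'v) \<Rightarrow> nat \<Rightarrow> ('f, 'v) tensor \<Rightarrow> 'v" where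
  "ser_inverse sV B = (THE L. L \<in> fseries1 sV \<and>
     ser_comp sV sV L B = ser_id sV \<and> ser_comp sV sV B L = ser_id sV)"

definition ser_deriv ::
  "('f::field_char_0 \<Rightarrow> 'v::ab_group_add \<Rightarrow> 'v) \<Rightarrow> ('f \<Rightarrow> 'w::ab_group_add \<Rightarrow> 'w)
    \<Rightarrow> (nat \<Rightarrow> ('f, 'v) tensor \<Rightarrow> 'w) \<Rightarrow> 'v \<Rightarrow> nat \<Rightarrow> ('f, 'v) tensor \<Rightarrow> 'w" where
  "ser_deriv sV sW A \<zeta> n = (\<lambda>f.
     if f \<in> sym_power sV n
     then sW (of_nat (n + 1)) (A (n + 1) (f \<odot> pure_tensor sV [\<zeta>])) else 0)"

definition ser_deriv_dir ::
  "('f::field_char_0 \<Rightarrow> 'v::ab_group_add \<Rightarrow> 'v) \<Rightarrow> ('f \<Rightarrow> 'w::ab_group_add \<Rightarrow> 'w)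
    \<Rightarrow> (nat \<Rightarrow> ('f, 'v) tensor \<Rightarrow> 'w) \<Rightarrow> (nat \<Rightarrow> ('f, 'v) tensor \<Rightarrow> 'v)
    \<Rightarrow> nat \<Rightarrow> ('f, 'v) tensor \<Rightarrow> 'w" where
  "ser_deriv_dir sV sW A C n = op_of_powers sV sW n (\<lambda>v.
     \<Sum>m\<le>n. sW (of_nat (m + 1)) (A (m + 1)
       (tpow sV m v \<odot> pure_tensor sV [C (n - m) (tpow sV (n - m) v)])))"


section \<open>Polynomials and Sheffer sequences\<close>

text \<open>A function on \<open>V\<^sup>*\<close> is extended by \<open>0\<close> to all functions \<open>'v \<Rightarrow> 'f\<close>.\<close>

definition on_dual ::
  "('f::field \<Rightarrow> 'v::ab_group_add \<Rightarrow> 'v) \<Rightarrow> (('v \<Rightarrow> 'f) \<Rightarrow> 'w::zero) \<Rightarrow> ('v \<Rightarrow> 'f) \<Rightarrow> 'w" where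
  "on_dual sV p = (\<lambda>\<omega>. if \<omega> \<in> dual_space sV then p \<omega> else 0)"

definition polys ::
  "('f::field_char_0 \<Rightarrow> 'v::ab_group_add \<Rightarrow> 'v) \<Rightarrow> (('v \<Rightarrow> 'f) \<Rightarrow> 'f) set" where
  "polys sV = {on_dual sV (\<lambda>\<omega>. \<Sum>k\<le>n. dual_pow k \<omega> (f k)) | n f.
     \<forall>k\<le>n. f k \<in> sym_power sV k}"

definition vpolys ::
  "('f::field_char_0 \<Rightarrow> 'v::ab_group_add \<Rightarrow> 'v) \<Rightarrow> ('f \<Rightarrow> 'w::ab_group_add \<Rightarrow> 'w) \<Rightarrow> 'w set
    \<Rightarrow> (('v \<Rightarrow> 'f) \<Rightarrow> 'w) set" where
  "vpolys sV sW W =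
     module.span (pointwise sW) {\<lambda>\<omega>. sW (p \<omega>) w | p w. p \<in> polys sV \<and> w \<in> W}"

text \<open>\<open>S n \<omega>\<close> is the functional \<open>S\<^sub>n(\<omega>)\<close> on \<open>V\<^sup>\<odot>\<^sup>n\<close>, and \<open>T k n\<close> is the operator \<open>S\<^sub>k\<^sub>n\<close>.\<close>

definition poly_seq_coeffs ::
  "('f::field_char_0 \<Rightarrow> 'v::ab_group_add \<Rightarrow> 'v) \<Rightarrow> (nat \<Rightarrow> ('v \<Rightarrow> 'f) \<Rightarrow> ('f, 'v) tensor \<Rightarrow> 'f)
    \<Rightarrow> (nat \<Rightarrow> nat \<Rightarrow> ('f, 'v) tensor \<Rightarrow> ('f, 'v) tensor) \<Rightarrow> bool" where
  "poly_seq_coeffs sV S T \<longleftrightarrow>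
     (\<forall>n. \<forall>\<omega>\<in>dual_space sV. S n \<omega> \<in> lin_maps tscale (sym_power sV n) (*) UNIV) \<and>
     (\<forall>n. \<forall>k\<le>n. T k n \<in> lin_maps tscale (sym_power sV n) tscale (sym_power sV k)) \<and>
     (\<forall>n. \<forall>\<omega>\<in>dual_space sV. \<forall>f\<in>sym_power sV n.
        S n \<omega> f = (\<Sum>k\<le>n. dual_pow k \<omega> (T k n f))) \<and>
     (\<forall>n. bij_betw (T n n) (sym_power sV n) (sym_power sV n))"

definition monic_poly_seq ::
  "('f::field_char_0 \<Rightarrow> 'v::ab_group_add \<Rightarrow> 'v) \<Rightarrow> (nat \<Rightarrow> ('v \<Rightarrow> 'f) \<Rightarrow> ('f, 'v) tensor \<Rightarrow> 'f)
    \<Rightarrow> bool" where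
  "monic_poly_seq sV S \<longleftrightarrow>
     (\<exists>T. poly_seq_coeffs sV S T \<and> (\<forall>n. \<forall>f\<in>sym_power sV n. T n n f = f))"

definition monic_sheffer_seq ::
  "('f::field_char_0 \<Rightarrow> 'v::ab_group_add \<Rightarrow> 'v) \<Rightarrow> (nat \<Rightarrow> ('v \<Rightarrow> 'f) \<Rightarrow> ('f, 'v) tensor \<Rightarrow> 'f)
    \<Rightarrow> (nat \<Rightarrow> ('f, 'v) tensor \<Rightarrow> 'v) \<Rightarrow> (nat \<Rightarrow> ('f, 'v) tensor \<Rightarrow> 'f) \<Rightarrow> bool" where
  "monic_sheffer_seq sV S B \<alpha> \<longleftrightarrow>
     monic_poly_seq sV S \<and> B \<in> fseries1 sV \<and> \<alpha> \<in> fseries sV (*) \<and> \<alpha> 0 = 0 \<and>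
     (\<forall>\<omega>\<in>dual_space sV.
        (\<lambda>n f. 1 / fact n * S n \<omega> f) = ser_exp sV (\<lambda>n f. \<omega> (B n f) + \<alpha> n f))"


section \<open>Lowering and raising operators\<close>

text \<open>\<open>lowering sV S k\<close> is \<open>Q\<^sup>k\<close>. For \<open>k > n\<close> the factor \<open>falling n k\<close> vanishes.\<close>

definition lowering ::
  "('f::field_char_0 \<Rightarrow> 'v::ab_group_add \<Rightarrow> 'v) \<Rightarrow> (nat \<Rightarrow> ('v \<Rightarrow> 'f) \<Rightarrow> ('f, 'v) tensor \<Rightarrow> 'f)
    \<Rightarrow> nat \<Rightarrow> (('v \<Rightarrow> 'f) \<Rightarrow> 'f) \<Rightarrow> ('v \<Rightarrow> 'f) \<Rightarrow> ('f, 'v) tensor" where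
  "lowering sV S k = (THE Qk.
     Qk \<in> lin_maps tscale (polys sV)
            (pointwise tscale) (vpolys sV tscale (sym_power sV k)) \<and>
     (\<forall>n v. \<forall>\<omega>\<in>dual_space sV.
        Qk (on_dual sV (\<lambda>\<omega>. S n \<omega> (tpow sV n v))) \<omega> =
        tscale (of_nat (falling n k) * S (n - k) \<omega> (tpow sV (n - k) v)) (tpow sV k v)))"

text \<open>\<open>ser_of_lowering sV sW S G\<close> is \<open>G(Q)\<close>. For each \<open>p\<close> only finitely many \<open>Q\<^sup>kp\<close> are nonzero.\<close>

definition ser_of_lowering ::
  "('f::field_char_0 \<Rightarrow> 'v::ab_group_add \<Rightarrow> 'v) \<Rightarrow> ('f \<Rightarrow> 'w::ab_group_add \<Rightarrow> 'w)
    \<Rightarrow> (nat \<Rightarrow> ('v \<Rightarrow> 'f) \<Rightarrow> ('f, 'v) tensor \<Rightarrow> 'f) \<Rightarrow> (nat \<Rightarrow> ('f, 'v) tensor \<Rightarrow> 'w)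
    \<Rightarrow> (('v \<Rightarrow> 'f) \<Rightarrow> 'f) \<Rightarrow> ('v \<Rightarrow> 'f) \<Rightarrow> 'w" where
  "ser_of_lowering sV sW S G p = (\<lambda>\<omega>.
     sW (p \<omega>) (G 0 (pure_tensor sV [])) +
     (\<Sum>k | 1 \<le> k \<and> lowering sV S k p \<noteq> 0. G k (lowering sV S k p \<omega>)))"

text \<open>\<open>raising_dir sV S \<zeta>\<close> is \<open>R(\<zeta>)\<close>, and \<open>raising sV S\<close> is \<open>R\<close>.\<close>

definition raising_dir ::
  "('f::field_char_0 \<Rightarrow> 'v::ab_group_add \<Rightarrow> 'v) \<Rightarrow> (nat \<Rightarrow> ('v \<Rightarrow> 'f) \<Rightarrow> ('f, 'v) tensor \<Rightarrow> 'f)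
    \<Rightarrow> 'v \<Rightarrow> (('v \<Rightarrow> 'f) \<Rightarrow> 'f) \<Rightarrow> ('v \<Rightarrow> 'f) \<Rightarrow> 'f" where
  "raising_dir sV S \<zeta> = (THE R\<zeta>.
     R\<zeta> \<in> lin_maps tscale (polys sV) tscale (polys sV) \<and>
     (\<forall>n. \<forall>f\<in>sym_power sV n. \<forall>\<omega>\<in>dual_space sV.
        R\<zeta> (on_dual sV (\<lambda>\<omega>. S n \<omega> f)) \<omega> = S (n + 1) \<omega> (f \<odot> pure_tensor sV [\<zeta>])))"

definition raising ::
  "('f::field_char_0 \<Rightarrow> 'v::ab_group_add \<Rightarrow> 'v) \<Rightarrow> (nat \<Rightarrow> ('v \<Rightarrow> 'f) \<Rightarrow> ('f, 'v) tensor \<Rightarrow> 'f)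
    \<Rightarrow> (('v \<Rightarrow> 'f) \<Rightarrow> 'v) \<Rightarrow> ('v \<Rightarrow> 'f) \<Rightarrow> 'f" where
  "raising sV S = (THE R.
     R \<in> lin_maps (pointwise sV) (vpolys sV sV UNIV) tscale (polys sV) \<and>
     (\<forall>\<zeta>. \<forall>p\<in>polys sV. R (\<lambda>\<omega>. sV (p \<omega>) \<zeta>) = raising_dir sV S \<zeta> p))"

definition mult_op :: "'v \<Rightarrow> (('v \<Rightarrow> 'f::field) \<Rightarrow> 'f) \<Rightarrow> ('v \<Rightarrow> 'f) \<Rightarrow> 'f" where
  "mult_op \<zeta> p = (\<lambda>\<omega>. \<omega> \<zeta> * p \<omega>)"

end

theory Submission
  imports Defs
begin

text \<open>
  The theorem is an identity for the generating function \<open>E(v) = exp[\<langle>\<omega>, B(v)\<rangle> + \<alpha>(v)]\<close>, written in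
  coefficients. The derivative of \<open>E\<close> in a direction \<open>\<xi>\<close> is
  \<open>E'(v; \<xi>) = E(v) (\<langle>\<omega>, B'(v; \<xi>)\<rangle> + \<alpha>'(v; \<xi>))\<close>. The direction \<open>\<Psi>\<^sub>\<zeta>(v) = L'(B(v); \<zeta>)\<close> is chosen such that
  \<open>B'(v; \<Psi>\<^sub>\<zeta>(v)) = \<zeta>\<close>: differentiate \<open>B(L(u)) = u\<close> in direction \<open>\<zeta>\<close> and put \<open>u = B(v)\<close>
  (\<open>deriv_along_inverse\<close>). Therefore \<open>\<langle>\<omega>, \<zeta>\<rangle> E(v) = E'(v; \<Psi>\<^sub>\<zeta>(v)) + \<Delta>\<^sub>\<zeta>(v) E(v)\<close>, and the
  coefficients of degree \<open>n\<close> give the formula for \<open>\<langle>\<omega>, \<zeta>\<rangle> \<langle>S\<^sub>n(\<omega>), v\<^sup>\<otimes>\<^sup>n\<rangle>\<close> (\<open>mult_generating\<close>,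
  \<open>mult_formula\<close>). The top term \<open>\<langle>S\<^sub>n\<^sub>+\<^sub>1(\<omega>), v\<^sup>\<otimes>\<^sup>n \<odot> \<zeta>\<rangle>\<close> appears because the sequence is monic: then \<open>B\<^sub>1\<close>
  is the identity (\<open>unital_B\<close>), and \<open>\<Psi>\<^sub>\<zeta>(0) = \<zeta>\<close>. The identity of operators is the same formula, since the
  polynomials \<open>\<langle>S\<^sub>n(\<cdot>), v\<^sup>\<otimes>\<^sup>n\<rangle>\<close> span \<open>\<P>(V\<^sup>*)\<close> (\<open>mult_op_eq\<close>).

  The larger part of the work is to show that the objects of the statement exist, because they are given by
  definite descriptions, and that formal series obey the usual calculus.

  Operators on \<open>V\<^sup>\<odot>\<^sup>n\<close> are described by their values on the powers \<open>v\<^sup>\<otimes>\<^sup>n\<close>. These values determine the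
  operator by polarization. For existence, a functional on \<open>V\<^sup>\<odot>\<^sup>l\<close> is applied to the last \<open>l\<close> arguments of a
  tensor; this makes products of homogeneous polynomial maps homogeneous polynomial maps (\<open>hpoly\<close>).

  The composition of series, its associativity and the chain rule are obtained from polynomial curves
  \<open>\<F> \<rightarrow> V\<close> and their orders of vanishing at \<open>0\<close>. Truncated series are functions on \<open>V\<close>, and along a curve
  through \<open>0\<close> the composition of series is the composition of functions up to a given order
  (\<open>ev_ser_comp\<close>). The inverse series comes from a recursion for left inverses: a left inverse of the left
  inverse \<open>L\<close> of \<open>B\<close> is equal to \<open>B\<close>, so \<open>L\<close> is a right inverse too.

  The lowering and raising operators exist because every polynomial has unique coordinates with respect to
  the Sheffer sequence, which differs from the powers \<open>\<omega>\<^sup>\<otimes>\<^sup>n\<close> by a triangular change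
  (\<open>polys_extension\<close>). For \<open>R\<close> it must also be shown that its values do not depend on the decomposition of a
  \<open>V\<close>-valued polynomial into products \<open>p(\<omega>) \<zeta>\<close> (\<open>raised\<close>).
\<close>

section \<open>Linear algebra in spaces of functions\<close>

lemma sum_fun_apply: "(\<Sum>i\<in>I. f i) x = (\<Sum>i\<in>I. f i x)"
  for f :: "'i \<Rightarrow> 'x \<Rightarrow> 'w::comm_monoid_add"
  by (induction I rule: infinite_finite_induct) auto

lemma vector_space_pointwise:
  assumes "vector_space sW"
  shows "vector_space (pointwise sW)"
proof -
  interpret vector_space sW by fact
  show ?thesis
    by unfold_locales (auto simp: pointwise_def fun_eq_iff scale_right_distrib scale_left_distrib)
qed

lemmas vector_space_field = vector_space_over_itself.vector_space_axioms

interpretation tensor: vector_space "tscale :: 'f::field \<Rightarrow> ('x \<Rightarrow> 'f) \<Rightarrow> 'x \<Rightarrow> 'f"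
  by (rule vector_space_pointwise[OF vector_space_field])

lemma tscale_apply [simp]: "tscale c t x = c * t x"
  by (simp add: pointwise_def)

lemmas fun_apply = plus_fun_apply zero_fun_apply tscale_apply

lemma lin_maps_0: "A \<in> lin_maps sU U sW W \<Longrightarrow> A 0 = 0"
  unfolding lin_maps_def by (cases "0 \<in> U") (force dest: bspec)+

lemma lin_maps_add: "A \<in> lin_maps sU U sW W \<Longrightarrow> x \<in> U \<Longrightarrow> y \<in> U \<Longrightarrow> A (x + y) = A x + A y"
  by (simp add: lin_maps_def)

lemma lin_maps_scale: "A \<in> lin_maps sU U sW W \<Longrightarrow> x \<in> U \<Longrightarrow> A (sU c x) = sW c (A x)"
  by (simp add: lin_maps_def)

lemma lin_maps_in: "A \<in> lin_maps sU U sW W \<Longrightarrow> x \<in> U \<Longrightarrow> A x \<in> W"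
  by (simp add: lin_maps_def)

lemma lin_maps_outside: "A \<in> lin_maps sU U sW W \<Longrightarrow> x \<notin> U \<Longrightarrow> A x = 0"
  by (simp add: lin_maps_def)

lemma lin_maps_sum:
  assumes "vector_space sU" "module.subspace sU U" "A \<in> lin_maps sU U sW W"
    and "\<And>i. i \<in> I \<Longrightarrow> f i \<in> U"
  shows "A (\<Sum>i\<in>I. f i) = (\<Sum>i\<in>I. A (f i))"
proof -
  interpret vector_space sU by fact
  show ?thesis
    using assms(4)
  proof (induction I rule: infinite_finite_induct)
    case (insert i I)
    then show ?case
      by (simp add: lin_maps_add[OF assms(3)] subspace_sum[OF assms(2)])
  qed (simp_all add: lin_maps_0[OF assms(3)])
qed

lemma lin_maps_eq_on_span:
  assumes "vector_space sU" and "A \<in> lin_maps sU (module.span sU X) sW W"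
    and "A' \<in> lin_maps sU (module.span sU X) sW W'" and "\<And>x. x \<in> X \<Longrightarrow> A x = A' x"
  shows "A = A'"
proof
  fix x
  interpret vector_space sU by fact
  show "A x = A' x"
  proof (cases "x \<in> span X")
    case True
    then have "x \<in> span X \<and> A x = A' x"
    proof (induction rule: span_induct_alt)
      case (step c x y)
      then show ?case
        by (simp add: assms(4) span_base span_add span_scale lin_maps_add[OF assms(2)]
            lin_maps_add[OF assms(3)] lin_maps_scale[OF assms(2)] lin_maps_scale[OF assms(3)])
    qed (simp add: span_zero lin_maps_0[OF assms(2)] lin_maps_0[OF assms(3)])
    then show ?thesis ..
  next
    case False
    then show ?thesis
      by (simp add: lin_maps_outside[OF assms(2)] lin_maps_outside[OF assms(3)])
  qed
qed


section \<open>Symmetric tensors\<close>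

locale tensor_space = vector_space sV
  for sV :: "'f::field_char_0 \<Rightarrow> 'v::ab_group_add \<Rightarrow> 'v"
begin

abbreviation Dual :: "('v \<Rightarrow> 'f) set" where "Dual \<equiv> dual_space sV"
abbreviation Pure :: "'v list \<Rightarrow> ('f, 'v) tensor" where "Pure \<equiv> pure_tensor sV"
abbreviation Symt :: "'v list \<Rightarrow> ('f, 'v) tensor" where "Symt \<equiv> sym_tensor sV"
abbreviation Sym :: "nat \<Rightarrow> ('f, 'v) tensor set" where "Sym \<equiv> sym_power sV"
abbreviation Lin :: "nat \<Rightarrow> ('f \<Rightarrow> 'w::ab_group_add \<Rightarrow> 'w) \<Rightarrow> (('f, 'v) tensor \<Rightarrow> 'w) set" where
  "Lin n sW \<equiv> lin_maps tscale (Sym n) sW UNIV"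
abbreviation Tpow :: "nat \<Rightarrow> 'v \<Rightarrow> ('f, 'v) tensor" where "Tpow \<equiv> tpow sV"

lemma dual_add: "\<omega> \<in> Dual \<Longrightarrow> \<omega> (x + y) = \<omega> x + \<omega> y"
  and dual_scale: "\<omega> \<in> Dual \<Longrightarrow> \<omega> (sV c x) = c * \<omega> x"
  by (auto simp: dual_space_def module_hom.add module_hom.scale linear_iff_module_hom)

lemma DualI: "(\<And>x y. \<omega> (x + y) = \<omega> x + \<omega> y) \<Longrightarrow> (\<And>c x. \<omega> (sV c x) = c * \<omega> x) \<Longrightarrow> \<omega> \<in> Dual"
  by (simp add: dual_space_def linear_iff_module_hom module_hom_iff vector_space_axioms
      vector_space_field module_iff_vector_space)

lemma dual_0: "\<omega> \<in> Dual \<Longrightarrow> \<omega> 0 = 0"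
  by (metis add_cancel_right_right dual_add)

lemma dual_sum: "\<omega> \<in> Dual \<Longrightarrow> \<omega> (\<Sum>i\<in>I. x i) = (\<Sum>i\<in>I. \<omega> (x i))"
  by (induction I rule: infinite_finite_induct) (auto simp: dual_0 dual_add)

lemma dual_sum_mem: "(\<And>i. i \<in> I \<Longrightarrow> \<eta> i \<in> Dual) \<Longrightarrow> (\<Sum>i\<in>I. \<eta> i) \<in> Dual"
  by (intro DualI) (auto simp: sum_fun_apply dual_add dual_scale sum.distrib sum_distrib_left)

lemma dual_tscale_mem: "\<eta> \<in> Dual \<Longrightarrow> tscale c \<eta> \<in> Dual"
  by (intro DualI) (auto simp: dual_add dual_scale algebra_simps)

lemma dual_separates:
  assumes "\<And>\<omega>. \<omega> \<in> Dual \<Longrightarrow> \<omega> x = 0"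
  shows "x = 0"
proof (rule ccontr)
  assume "x \<noteq> 0"
  interpret vp: vector_space_pair sV "(*) :: 'f \<Rightarrow> 'f \<Rightarrow> 'f" ..
  have "independent {x}"
    using \<open>x \<noteq> 0\<close> by simp
  from vp.linear_independent_extend[OF this, of "\<lambda>_. 1"]
  obtain \<omega> where "Vector_Spaces.linear sV (*) \<omega>" "\<omega> x = 1"
    by auto
  then show False
    using assms[of \<omega>] by (simp add: dual_space_def)
qed

lemma pure_Nil: "Pure [] \<omega>s = (if \<omega>s = [] then 1 else 0)"
  by (auto simp: pure_tensor_def)

lemma pure_Cons:
  "Pure (x # xs) \<omega>s =
     (case \<omega>s of [] \<Rightarrow> 0 | \<omega> # \<omega>s' \<Rightarrow> if \<omega> \<in> Dual then \<omega> x * Pure xs \<omega>s' else 0)"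
  by (cases \<omega>s) (auto simp: pure_tensor_def prod.lessThan_Suc_shift simp del: prod.lessThan_Suc)

lemma pure_append:
  "Pure (xs @ ys) \<omega>s = Pure xs (take (length xs) \<omega>s) * Pure ys (drop (length xs) \<omega>s)"
  by (induction xs arbitrary: \<omega>s) (auto simp: pure_Nil pure_Cons split: list.split)

lemma pure_add: "Pure (us @ (x + y) # vs) = Pure (us @ x # vs) + Pure (us @ y # vs)"
  by (induction us)
    (auto simp: fun_eq_iff pure_Cons dual_add algebra_simps split: list.split)

lemma pure_scale: "Pure (us @ sV c x # vs) = tscale c (Pure (us @ x # vs))"
  by (induction us) (auto simp: fun_eq_iff pure_Cons dual_scale split: list.split)

lemma pure_eq_0: "length \<omega>s \<noteq> length vs \<Longrightarrow> Pure vs \<omega>s = 0"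
  by (auto simp: pure_tensor_def)

lemma tensor_prod_pure: "tensor_prod (Pure xs) (Pure ys) = Pure (xs @ ys)"
proof
  fix \<omega>s
  have "tensor_prod (Pure xs) (Pure ys) \<omega>s
      = (\<Sum>i\<le>length \<omega>s. if i = length xs then Pure (xs @ ys) \<omega>s else 0)"
    unfolding tensor_prod_def
    by (intro sum.cong refl) (auto simp: pure_append pure_eq_0)
  also have "\<dots> = Pure (xs @ ys) \<omega>s"
    by (auto simp: pure_eq_0)
  finally show "tensor_prod (Pure xs) (Pure ys) \<omega>s = Pure (xs @ ys) \<omega>s" .
qed

lemma symmetrize_add: "symmetrize (s + t) = symmetrize s + symmetrize t"
  by (simp add: symmetrize_def fun_eq_iff sum.distrib add_divide_distrib)

lemma symmetrize_scale: "symmetrize (tscale c t) = tscale c (symmetrize t)"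
  by (simp add: symmetrize_def fun_eq_iff sum_distrib_left)

lemma symmetrize_sum: "symmetrize (\<Sum>i\<in>I. t i) = (\<Sum>i\<in>I. symmetrize (t i))"
proof (induction I rule: infinite_finite_induct)
  case (insert i I)
  then show ?case by (simp only: sum.insert[OF insert.hyps] symmetrize_add)
qed (simp_all add: symmetrize_def fun_eq_iff)

lemma sym_tensor_apply:
  "Symt vs \<omega>s = (\<Sum>\<pi> | \<pi> permutes {..<length vs}. Pure (permute_list \<pi> vs) \<omega>s) / fact (length vs)"
  by (simp add: sym_tensor_def sum_fun_apply)

text \<open>A permutation of the functionals has the effect of the inverse permutation of the vectors.\<close>

lemma symmetrize_pure: "symmetrize (Pure vs) = Symt vs"
proof
  fix \<omega>s
  show "symmetrize (Pure vs) \<omega>s = Symt vs \<omega>s"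
  proof (cases "length \<omega>s = length vs")
    case True
    let ?n = "length vs"
    have "Pure vs (permute_list (inv \<pi>) \<omega>s) = Pure (permute_list \<pi> vs) \<omega>s"
      if \<pi>: "\<pi> permutes {..<?n}" for \<pi>
    proof -
      have \<pi>': "inv \<pi> permutes {..<?n}"
        using \<pi> by (rule permutes_inv)
      have "(\<Prod>i<?n. (permute_list (inv \<pi>) \<omega>s ! i) (vs ! i)) = (\<Prod>i<?n. (\<omega>s ! inv \<pi> i) (vs ! i))"
        using \<pi>' True by (intro prod.cong refl) (simp add: permute_list_nth)
      also have "\<dots> = (\<Prod>i<?n. (\<omega>s ! inv \<pi> (\<pi> i)) (vs ! \<pi> i))"
        using prod.permute[OF \<pi>, of "\<lambda>i. (\<omega>s ! inv \<pi> i) (vs ! i)"] by (simp add: comp_def)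
      also have "\<dots> = (\<Prod>i<?n. (\<omega>s ! i) (permute_list \<pi> vs ! i))"
        using \<pi> by (intro prod.cong refl) (simp add: permute_list_nth permutes_inverses)
      finally show ?thesis
        using \<pi>' True by (simp add: pure_tensor_def)
    qed
    then show ?thesis
      using True
      by (simp add: symmetrize_def sym_tensor_apply sum_permutations_inverse[of "\<lambda>p. Pure _ (permute_list p _)"])
  next
    case False
    then show ?thesis
      by (simp add: symmetrize_def sym_tensor_apply pure_eq_0)
  qed
qed

lemma sym_tensor_mset:
  assumes "mset us = mset vs"
  shows "Symt us = Symt vs"
proof -
  obtain \<sigma> where \<sigma>: "\<sigma> permutes {..<length vs}" "permute_list \<sigma> vs = us"
    using mset_eq_permutation[OF assms] by blast
  have "length us = length vs"
    using assms by (rule mset_eq_length)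
  have "(\<Sum>\<pi> | \<pi> permutes {..<length vs}. Pure (permute_list \<pi> us))
      = (\<Sum>\<pi> | \<pi> permutes {..<length vs}. Pure (permute_list (\<sigma> \<circ> \<pi>) vs))"
    by (intro sum.cong refl) (auto simp: permute_list_compose simp flip: \<sigma>(2))
  also have "\<dots> = (\<Sum>\<pi> | \<pi> permutes {..<length vs}. Pure (permute_list \<pi> vs))"
    by (rule setum_permutations_compose_left[OF \<sigma>(1), symmetric])
  finally show ?thesis
    by (simp add: sym_tensor_def \<open>length us = length vs\<close>)
qed

lemma sym_tensor_add: "Symt (us @ (x + y) # vs) = Symt (us @ x # vs) + Symt (us @ y # vs)"
  by (simp add: pure_add symmetrize_add flip: symmetrize_pure)

lemma sym_tensor_scale: "Symt (us @ sV c x # vs) = tscale c (Symt (us @ x # vs))"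
  by (simp add: pure_scale symmetrize_scale flip: symmetrize_pure)

lemma tpow_eq_sym_tensor: "Tpow n v = Symt (replicate n v)"
proof
  fix \<omega>s
  have "Pure (permute_list \<pi> (replicate n v)) = Tpow n v" if "\<pi> permutes {..<n}" for \<pi>
  proof -
    have "permute_list \<pi> (replicate n v) = replicate n v"
      using that permutes_in_image[OF that]
      by (intro nth_equalityI) (auto simp: permute_list_def)
    then show ?thesis by (simp add: tpow_def)
  qed
  then show "Tpow n v \<omega>s = Symt (replicate n v) \<omega>s"
    by (simp add: sym_tensor_apply card_permutations)
qed

lemma sym_tensor_mem: "Symt vs \<in> Sym (length vs)"
  by (auto simp: sym_power_def intro!: tensor.span_base)

lemma sym_tensor_mem': "length vs = n \<Longrightarrow> Symt vs \<in> Sym n"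
  using sym_tensor_mem by auto

lemma tpow_mem: "Tpow n v \<in> Sym n"
  using sym_tensor_mem[of "replicate n v"] by (simp add: tpow_eq_sym_tensor)

lemma subspace_sym_power: "tensor.subspace (Sym n)"
  by (simp add: sym_power_def)

lemmas sym_add = tensor.subspace_add[OF subspace_sym_power]
  and sym_scale = tensor.subspace_scale[OF subspace_sym_power]
  and sym_zero = tensor.subspace_0[OF subspace_sym_power]
  and sym_sum = tensor.subspace_sum[OF subspace_sym_power]

lemma pure_sum:
  assumes "finite I"
  shows "Pure (replicate n (\<Sum>i\<in>I. x i)) = (\<Sum>is | set is \<subseteq> I \<and> length is = n. Pure (map x is))"
proof (induction n)
  case (Suc n)
  let ?N = "\<lambda>n. {is. set is \<subseteq> I \<and> length is = n}"
  have "Pure (replicate (Suc n) (\<Sum>i\<in>I. x i)) = (\<Sum>i\<in>I. \<Sum>is\<in>?N n. Pure (x i # map x is))"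
  proof
    fix \<omega>s
    show "Pure (replicate (Suc n) (\<Sum>i\<in>I. x i)) \<omega>s
      = (\<Sum>i\<in>I. \<Sum>is\<in>?N n. Pure (x i # map x is)) \<omega>s"
      by (auto simp: pure_Cons sum_fun_apply dual_sum Suc.IH sum_product split: list.split)
  qed
  also have "\<dots> = (\<Sum>(i, is)\<in>I \<times> ?N n. Pure (map x (i # is)))"
    using assms by (simp add: sum.cartesian_product finite_lists_length_eq)
  also have "\<dots> = (\<Sum>is\<in>?N (Suc n). Pure (map x is))"
    by (rule sum.reindex_bij_witness[of _ "\<lambda>is. (hd is, tl is)" "\<lambda>(i, is). i # is"])
      (auto simp: length_Suc_conv)
  finally show ?case .
qed (simp add: fun_eq_iff cong: conj_cong)

text \<open>The multinomial theorem for powers of vectors.\<close>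

lemma tpow_sum:
  assumes "finite I"
  shows "Tpow n (\<Sum>i\<in>I. x i) = (\<Sum>is | set is \<subseteq> I \<and> length is = n. Symt (map x is))"
proof -
  have "Tpow n (\<Sum>i\<in>I. x i) = symmetrize (Pure (replicate n (\<Sum>i\<in>I. x i)))"
    by (simp add: symmetrize_pure tpow_eq_sym_tensor)
  then show ?thesis
    by (simp add: pure_sum[OF assms] symmetrize_sum symmetrize_pure)
qed

text \<open>Expand each power \<open>(\<Sum>i\<in>J. v\<^sub>i)\<^sup>\<otimes>\<^sup>n\<close> by \<open>tpow_sum\<close>. A list of indices occurs in
  the powers for all \<open>J\<close> that contain its entries, so by inclusion and exclusion only the lists in which
  every index occurs survive; each of these is a permutation of \<open>0, \<dots>, n - 1\<close>.\<close>

lemma polarization: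
  obtains c :: 'f where "c \<noteq> 0" and "\<And>vs. length vs = n \<Longrightarrow>
    tscale c (Symt vs) = (\<Sum>J\<in>Pow {..<n}. tscale ((-1) ^ card J) (Tpow n (\<Sum>i\<in>J. vs ! i)))"
proof -
  let ?N = "{is. set is \<subseteq> {..<n} \<and> length is = n}"
  let ?P = "{is\<in>?N. set is = {..<n}}"
  define c :: 'f where "c = of_nat (card ?P) * (-1) ^ n"
  have fin: "finite ?N"
    by (simp add: finite_lists_length_eq)
  have mem: "[0..<n] \<in> ?P"
    by auto
  have finP: "finite ?P"
    using fin by (rule rev_finite_subset) (rule subsetI, erule CollectE, erule conjunct1)
  have "card ?P \<noteq> 0"
  proof
    assume "card ?P = 0"
    then have "?P = {}"
      by (simp only: card_0_eq[OF finP])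
    with mem show False
      by (metis empty_iff)
  qed
  then have "c \<noteq> 0"
    by (simp add: c_def)
  moreover have "tscale c (Symt vs) = (\<Sum>J\<in>Pow {..<n}. tscale ((-1) ^ card J) (Tpow n (\<Sum>i\<in>J. vs ! i)))"
    if len: "length vs = n" for vs
  proof -
    let ?v = "\<lambda>i. vs ! i"
    let ?c = "\<lambda>is. \<Sum>J | J \<subseteq> {..<n} \<and> set is \<subseteq> J. (-1 :: 'f) ^ card J"
    have "(\<Sum>J\<in>Pow {..<n}. tscale ((-1) ^ card J) (Tpow n (\<Sum>i\<in>J. ?v i)))
        = (\<Sum>J\<in>Pow {..<n}. \<Sum>is\<in>?N. if set is \<subseteq> J then tscale ((-1) ^ card J) (Symt (map ?v is)) else 0)"
    proof (intro sum.cong refl)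
      fix J assume "J \<in> Pow {..<n}"
      then have "finite J" and J: "J \<subseteq> {..<n}"
        by (auto intro: finite_subset)
      have "?N \<inter> {is. set is \<subseteq> J} = {is. set is \<subseteq> J \<and> length is = n}"
        using J by auto
      then show "tscale ((-1) ^ card J) (Tpow n (\<Sum>i\<in>J. ?v i))
        = (\<Sum>is\<in>?N. if set is \<subseteq> J then tscale ((-1) ^ card J) (Symt (map ?v is)) else 0)"
        using fin by (simp add: tpow_sum[OF \<open>finite J\<close>] tensor.scale_sum_right sum.If_cases)
    qed
    also have "\<dots> = (\<Sum>is\<in>?N. \<Sum>J\<in>Pow {..<n}. if set is \<subseteq> J then tscale ((-1) ^ card J) (Symt (map ?v is)) else 0)"
      by (rule sum.swap)
    also have "\<dots> = (\<Sum>is\<in>?N. tscale (?c is) (Symt (map ?v is)))"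
      by (intro sum.cong refl)
        (simp add: sum.If_cases tensor.scale_sum_left Pow_def Collect_conj_eq[symmetric])
    also have "\<dots> = (\<Sum>is\<in>?P. tscale (?c is) (Symt (map ?v is)))"
    proof (rule sum.mono_neutral_right[OF fin], blast, intro ballI)
      fix "is" assume "is": "is \<in> ?N - ?P"
      then have "set is \<subset> {..<n}"
        by auto
      from card_subsupersets_even_odd[OF finite_lessThan this] have "?c is = 0"
        by (intro sum_alternating_cancels) (simp_all add: conj_ac)
      then show "tscale (?c is) (Symt (map ?v is)) = 0"
        by simp
    qed
    also have "\<dots> = (\<Sum>is\<in>?P. tscale ((-1) ^ n) (Symt vs))"
    proof (intro sum.cong refl)
      fix "is" assume "is": "is \<in> ?P"
      then have "{J. J \<subseteq> {..<n} \<and> set is \<subseteq> J} = {{..<n}}"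
        by auto
      moreover have "distinct is"
        using "is" by (simp add: card_distinct)
      then have "mset is = mset [0..<n]"
        using "is" by (intro set_eq_iff_mset_eq_distinct[THEN iffD1]) auto
      then have "mset (map ?v is) = mset (map ?v [0..<n])"
        by (simp only: mset_map)
      then have "Symt (map ?v is) = Symt vs"
        unfolding len[symmetric] map_nth by (rule sym_tensor_mset)
      ultimately show "tscale (?c is) (Symt (map ?v is)) = tscale ((-1) ^ n) (Symt vs)"
        by simp
    qed
    also have "\<dots> = tscale c (Symt vs)"
      by (simp add: c_def fun_eq_iff sum_fun_apply)
    finally show ?thesis ..
  qed
  ultimately show thesis
    by (rule that)
qed

lemma sym_power_eq_span: "Sym n = tensor.span (range (Tpow n))"
proof
  have "Symt vs \<in> tensor.span (range (Tpow n))" if len: "length vs = n" for vs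
  proof -
    obtain c :: 'f where "c \<noteq> 0" and c: "\<And>vs. length vs = n \<Longrightarrow>
        tscale c (Symt vs) = (\<Sum>J\<in>Pow {..<n}. tscale ((-1) ^ card J) (Tpow n (\<Sum>i\<in>J. vs ! i)))"
      by (rule polarization[of n]) blast
    have "Symt vs = tscale (1 / c) (tscale c (Symt vs))"
      using \<open>c \<noteq> 0\<close> by (simp add: fun_eq_iff)
    also have "\<dots> = tscale (1 / c)
        (\<Sum>J\<in>Pow {..<n}. tscale ((-1) ^ card J) (Tpow n (\<Sum>i\<in>J. vs ! i)))"
      by (simp only: c[OF len])
    finally show ?thesis
      by (simp only:) (intro tensor.span_scale tensor.span_sum tensor.span_base rangeI)
  qed
  then show "Sym n \<subseteq> tensor.span (range (Tpow n))"
    unfolding sym_power_def by (intro tensor.span_minimal) auto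
  show "tensor.span (range (Tpow n)) \<subseteq> Sym n"
    by (intro tensor.span_minimal subspace_sym_power) (auto simp: tpow_mem)
qed

lemma sym_power_induct [consumes 1, case_names zero step]:
  assumes "t \<in> Sym n" and "P 0"
    and "\<And>c v s. s \<in> Sym n \<Longrightarrow> P s \<Longrightarrow> P (tscale c (Tpow n v) + s)"
  shows "P t"
proof -
  have "t \<in> Sym n \<and> P t"
    using assms(1)[unfolded sym_power_eq_span]
  proof (induction rule: tensor.span_induct_alt)
    case (step c x y)
    then show ?case
      by (auto simp: assms(3) sym_add sym_scale tpow_mem simp del: fun_apply)
  qed (simp add: sym_zero assms(2) del: fun_apply)
  then show ?thesis ..
qed

lemma lin_maps_eqI:
  assumes "A \<in> lin_maps tscale (Sym n) sW W" "A' \<in> lin_maps tscale (Sym n) sW W'"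
    and "\<And>v. A (Tpow n v) = A' (Tpow n v)"
  shows "A = A'"
  using assms by (intro lin_maps_eq_on_span[OF tensor.vector_space_axioms])
    (auto simp: sym_power_eq_span)

lemma lin_maps_range:
  assumes A: "A \<in> lin_maps tscale (Sym n) sW W" and "vector_space sW" "module.subspace sW W'"
    and "\<And>v. A (Tpow n v) \<in> W'" and "t \<in> Sym n"
  shows "A t \<in> W'"
proof -
  interpret W: vector_space sW by fact
  show ?thesis
    using assms(5)
    by (induction rule: sym_power_induct)
      (auto simp: lin_maps_0[OF A] lin_maps_add[OF A] lin_maps_scale[OF A] sym_scale tpow_mem assms(4)
        W.subspace_0[OF assms(3)] W.subspace_add[OF assms(3)] W.subspace_scale[OF assms(3)]
        simp del: fun_apply)
qed

lemma tpow_apply: "Tpow n v \<omega>s = (if length \<omega>s = n \<and> set \<omega>s \<subseteq> Dual then \<Prod>i<n. (\<omega>s ! i) v else 0)"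
  by (simp add: tpow_def pure_tensor_def)

lemma tpow_replicate: "\<omega> \<in> Dual \<Longrightarrow> Tpow n v (replicate n \<omega>) = \<omega> v ^ n"
  by (auto simp: tpow_apply set_replicate_conv_if)

text \<open>A symmetric tensor is recovered from its values on constant lists: apply polarization to the
  one-dimensional space \<open>\<F>\<close> and the scalars \<open>\<langle>\<omega>\<^sub>1, v\<rangle>, \<dots>, \<langle>\<omega>\<^sub>n, v\<rangle>\<close>.\<close>

lemma sym_power_eq_0:
  assumes t: "t \<in> Sym n" and 0: "\<And>\<omega>. \<omega> \<in> Dual \<Longrightarrow> t (replicate n \<omega>) = 0"
  shows "t = 0"
proof
  fix \<omega>s
  show "t \<omega>s = 0 \<omega>s"
  proof (cases "length \<omega>s = n \<and> set \<omega>s \<subseteq> Dual")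
    case True
    interpret F: tensor_space "(*) :: 'f \<Rightarrow> 'f \<Rightarrow> 'f" ..
    obtain c :: 'f where c: "c \<noteq> 0" "\<And>xs. length xs = n \<Longrightarrow>
        tscale c (F.Symt xs) = (\<Sum>J\<in>Pow {..<n}. tscale ((-1) ^ card J) (F.Tpow n (\<Sum>i\<in>J. xs ! i)))"
      by (rule F.polarization[of n]) blast
    have id: "(\<lambda>x. x) \<in> F.Dual"
      by (intro F.DualI) auto
    have dual: "(\<Sum>i\<in>J. \<omega>s ! i) \<in> Dual" if "J \<in> Pow {..<n}" for J
      using that True by (intro dual_sum_mem) (auto simp: subset_iff)
    have "c * t \<omega>s = (\<Sum>J\<in>Pow {..<n}. (-1) ^ card J * t (replicate n (\<Sum>i\<in>J. \<omega>s ! i)))"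
      using t
    proof (induction rule: sym_power_induct)
      case (step a v s)
      let ?x = "\<lambda>i. (\<omega>s ! i) v"
      have "c * (\<Prod>i<n. map ?x [0..<n] ! i) = tscale c (F.Symt (map ?x [0..<n])) (replicate n (\<lambda>x. x))"
        using dual_pow_sym_tensor[OF id, of "map ?x [0..<n]"] by (simp add: dual_pow_def)
      also have "\<dots> = (\<Sum>J\<in>Pow {..<n}. (-1) ^ card J * (\<Sum>i\<in>J. map ?x [0..<n] ! i) ^ n)"
        by (simp add: c(2) sum_fun_apply F.tpow_replicate[OF id])
      also have "\<dots> = (\<Sum>J\<in>Pow {..<n}. (-1) ^ card J * (\<Sum>i\<in>J. ?x i) ^ n)"
        by (intro sum.cong refl arg_cong2[where f="(*)"] arg_cong[where f="\<lambda>x. x ^ n"]) auto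
      also have "\<dots> = (\<Sum>J\<in>Pow {..<n}. (-1) ^ card J * Tpow n v (replicate n (\<Sum>i\<in>J. \<omega>s ! i)))"
        using dual by (intro sum.cong refl) (simp add: tpow_replicate sum_fun_apply)
      finally have "c * Tpow n v \<omega>s
          = (\<Sum>J\<in>Pow {..<n}. (-1) ^ card J * Tpow n v (replicate n (\<Sum>i\<in>J. \<omega>s ! i)))"
        using True by (simp add: tpow_apply[of n v \<omega>s])
      moreover have "c * (tscale a (Tpow n v) + s) \<omega>s = a * (c * Tpow n v \<omega>s) + c * s \<omega>s"
        by (simp add: algebra_simps)
      ultimately show ?case
        by (simp add: step.IH sum_distrib_left sum.distrib algebra_simps)
    qed simp
    then show ?thesis
      using \<open>c \<noteq> 0\<close> by (simp add: dual 0)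
  next
    case False
    show ?thesis
      using t by (induction rule: sym_power_induct) (use False in \<open>auto simp: tpow_apply\<close>)
  qed
qed


section \<open>Homogeneous polynomial maps\<close>

text \<open>The maps \<open>q\<close> for which \<open>op_of_powers\<close> describes an existing operator. Uniqueness of the operator is
  polarization. The closure properties below give existence for all formulas that define the
  coefficients of products, compositions and derivatives of series.\<close>

definition hpoly :: "('f \<Rightarrow> 'w::ab_group_add \<Rightarrow> 'w) \<Rightarrow> nat \<Rightarrow> ('v \<Rightarrow> 'w) \<Rightarrow> bool" where
  "hpoly sW n q \<longleftrightarrow> (\<exists>A\<in>Lin n sW. \<forall>v. A (Tpow n v) = q v)"

lemma op_of_powers:
  assumes "hpoly sW n q"
  shows "op_of_powers sV sW n q \<in> Lin n sW"
    and "op_of_powers sV sW n q (Tpow n v) = q v"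
proof -
  obtain A where A: "A \<in> Lin n sW" "\<forall>v. A (Tpow n v) = q v"
    using assms by (auto simp: hpoly_def)
  have "op_of_powers sV sW n q = A"
    unfolding op_of_powers_def
    using A by (intro the_equality) (auto intro!: lin_maps_eqI)
  with A show "op_of_powers sV sW n q \<in> Lin n sW"
    "op_of_powers sV sW n q (Tpow n v) = q v"
    by simp_all
qed

lemma hpoly_lin_maps: "A \<in> Lin n sW \<Longrightarrow> hpoly sW n (\<lambda>v. A (Tpow n v))"
  by (auto simp: hpoly_def)

lemma hpolyI:
  assumes "\<And>s t. s \<in> Sym n \<Longrightarrow> t \<in> Sym n \<Longrightarrow> A (s + t) = A s + A t"
    and "\<And>c t. t \<in> Sym n \<Longrightarrow> A (tscale c t) = sW c (A t)" and "\<And>v. A (Tpow n v) = q v"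
  shows "hpoly sW n q"
  unfolding hpoly_def
  using assms
  by (intro bexI[of _ "\<lambda>t. if t \<in> Sym n then A t else 0"])
    (auto simp: lin_maps_def sym_add sym_scale tpow_mem)

lemma hpoly_zero: "vector_space sW \<Longrightarrow> hpoly sW n (\<lambda>_. 0)"
  by (rule hpolyI[of _ "\<lambda>_. 0"]) (simp_all add: module.scale_zero_right module_iff_vector_space)

lemma hpoly_add:
  assumes "vector_space sW" "hpoly sW n p" "hpoly sW n q"
  shows "hpoly sW n (\<lambda>v. p v + q v)"
proof -
  interpret W: vector_space sW by fact
  obtain A C where A: "A \<in> Lin n sW" "\<forall>v. A (Tpow n v) = p v"
    and C: "C \<in> Lin n sW" "\<forall>v. C (Tpow n v) = q v"
    using assms by (auto simp: hpoly_def)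
  show ?thesis
    by (rule hpolyI[of _ "\<lambda>t. A t + C t"])
      (auto simp: A(2) C(2) lin_maps_add[OF A(1)] lin_maps_add[OF C(1)] lin_maps_scale[OF A(1)]
        lin_maps_scale[OF C(1)] W.scale_right_distrib)
qed

lemma hpoly_scale:
  assumes "vector_space sW" "hpoly sW n p"
  shows "hpoly sW n (\<lambda>v. sW c (p v))"
proof -
  interpret W: vector_space sW by fact
  obtain A where A: "A \<in> Lin n sW" "\<forall>v. A (Tpow n v) = p v"
    using assms by (auto simp: hpoly_def)
  show ?thesis
    by (rule hpolyI[of _ "\<lambda>t. sW c (A t)"])
      (auto simp: A(2) lin_maps_add[OF A(1)] lin_maps_scale[OF A(1)] W.scale_right_distrib mult.commute)
qed

lemma hpoly_sum:
  assumes "vector_space sW" "\<And>i. i \<in> I \<Longrightarrow> hpoly sW n (p i)"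
  shows "hpoly sW n (\<lambda>v. \<Sum>i\<in>I. p i v)"
  using assms(2)
  by (induction I rule: infinite_finite_induct) (auto intro: hpoly_zero hpoly_add assms(1))

lemma hpoly_const: "vector_space sW \<Longrightarrow> hpoly sW 0 (\<lambda>_. w)"
  by (rule hpolyI[of _ "\<lambda>t. sW (t []) w"])
    (simp_all add: module.scale_left_distrib module.scale_scale module.scale_one module_iff_vector_space
      tpow_apply)

lemma hpoly_dual:
  assumes "hpoly sV n q" "\<omega> \<in> Dual"
  shows "hpoly (*) n (\<lambda>v. \<omega> (q v))"
proof -
  obtain A where A: "A \<in> Lin n sV" "\<forall>v. A (Tpow n v) = q v"
    using assms by (auto simp: hpoly_def)
  show ?thesis
    by (rule hpolyI[of _ "\<lambda>t. \<omega> (A t)"])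
      (auto simp: A(2) lin_maps_add[OF A(1)] lin_maps_scale[OF A(1)] dual_add dual_scale assms(2))
qed

lemma hpoly_fun:
  assumes "\<And>x. hpoly (*) n (\<lambda>v. q v x)"
  shows "hpoly tscale n q"
proof -
  have "\<exists>A\<in>Lin n (*). \<forall>v. A (Tpow n v) = q v x" for x
    using assms[of x] by (simp add: hpoly_def)
  then obtain A where A: "\<And>x. A x \<in> Lin n (*)" "\<And>x v. A x (Tpow n v) = q v x"
    by metis
  show ?thesis
    by (rule hpolyI[of _ "\<lambda>t x. A x t"])
      (auto simp: fun_eq_iff A(2) lin_maps_add[OF A(1)] lin_maps_scale[OF A(1)])
qed

lemma hpoly_lin:
  assumes q: "hpoly tscale n q" "\<And>v. q v \<in> Sym m"
    and C: "C \<in> Lin m sW"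
  shows "hpoly sW n (\<lambda>v. C (q v))"
proof -
  obtain A where A: "A \<in> Lin n tscale" "\<forall>v. A (Tpow n v) = q v"
    using assms by (auto simp: hpoly_def)
  have "A t \<in> Sym m" if "t \<in> Sym n" for t
    using A(2) q(2) by (intro lin_maps_range[OF A(1) tensor.vector_space_axioms subspace_sym_power _ that]) auto
  then show ?thesis
    by (intro hpolyI[of _ "\<lambda>t. C (A t)"])
      (auto simp: A(2) lin_maps_add[OF A(1)] lin_maps_scale[OF A(1)] lin_maps_add[OF C] lin_maps_scale[OF C])
qed

text \<open>A functional on \<open>V\<^sup>\<odot>\<^sup>l\<close> acts on the last \<open>l\<close> factors of a tensor of degree \<open>k + l\<close>. This turns a
  product of homogeneous polynomials into a composition of linear maps.\<close>

definition contract :: "nat \<Rightarrow> (('f, 'v) tensor \<Rightarrow> 'f) \<Rightarrow> ('f, 'v) tensor \<Rightarrow> ('f, 'v) tensor" where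
  "contract k C t = (\<lambda>\<omega>s. if length \<omega>s = k then C (\<lambda>\<omega>s'. t (\<omega>s @ \<omega>s')) else 0)"

lemma slice_tpow:
  assumes "length \<omega>s = k"
  shows "(\<lambda>\<omega>s'. Tpow (k + l) v (\<omega>s @ \<omega>s')) = tscale (Tpow k v \<omega>s) (Tpow l v)"
  using assms by (auto simp: fun_eq_iff tpow_def replicate_add pure_append)

lemma slice_mem:
  assumes "t \<in> Sym (k + l)" "length \<omega>s = k"
  shows "(\<lambda>\<omega>s'. t (\<omega>s @ \<omega>s')) \<in> Sym l"
  using assms(1)
proof (induction rule: sym_power_induct)
  case zero
  then show ?case
    using sym_zero by (simp add: zero_fun_def)
next
  case (step c v s)
  have "(\<lambda>\<omega>s'. (tscale c (Tpow (k + l) v) + s) (\<omega>s @ \<omega>s'))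
      = tscale c (\<lambda>\<omega>s'. Tpow (k + l) v (\<omega>s @ \<omega>s')) + (\<lambda>\<omega>s'. s (\<omega>s @ \<omega>s'))"
    by (simp add: fun_eq_iff)
  then show ?case
    using step by (simp only: slice_tpow[OF assms(2)] sym_add sym_scale tpow_mem)
qed

lemma contract_add:
  assumes "C \<in> Lin l (*)" "s \<in> Sym (k + l)" "t \<in> Sym (k + l)"
  shows "contract k C (s + t) = contract k C s + contract k C t"
  using assms lin_maps_add[OF assms(1) slice_mem slice_mem]
  by (auto simp: contract_def fun_eq_iff plus_fun_def)

lemma contract_scale:
  assumes "C \<in> Lin l (*)" "t \<in> Sym (k + l)"
  shows "contract k C (tscale c t) = tscale c (contract k C t)"
  using assms lin_maps_scale[OF assms(1) slice_mem]
  by (auto simp: contract_def fun_eq_iff pointwise_def)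

lemma contract_tpow:
  assumes "C \<in> Lin l (*)"
  shows "contract k C (Tpow (k + l) v) = tscale (C (Tpow l v)) (Tpow k v)"
proof
  fix \<omega>s
  show "contract k C (Tpow (k + l) v) \<omega>s = tscale (C (Tpow l v)) (Tpow k v) \<omega>s"
    by (cases "length \<omega>s = k")
      (simp_all only: contract_def slice_tpow lin_maps_scale[OF assms tpow_mem] fun_apply if_True if_False,
        simp_all add: tpow_apply)
qed

lemma contract_mem:
  assumes "C \<in> Lin l (*)" "t \<in> Sym (k + l)"
  shows "contract k C t \<in> Sym k"
  using assms(2)
proof (induction rule: sym_power_induct)
  case zero
  then show ?case
    using lin_maps_0[OF assms(1)] sym_zero by (simp add: contract_def zero_fun_def cong: if_cong)
next
  case (step c v s)
  then show ?case
    by (simp only: contract_add[OF assms(1)] contract_scale[OF assms(1)] contract_tpow[OF assms(1)]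
        sym_add sym_scale tpow_mem)
qed

lemma hpoly_mult:
  assumes "hpoly sW k p" "hpoly (*) l q"
  shows "hpoly sW (k + l) (\<lambda>v. sW (q v) (p v))"
proof -
  obtain A where A: "A \<in> Lin k sW" "\<forall>v. A (Tpow k v) = p v"
    using assms by (auto simp: hpoly_def)
  obtain C where C: "C \<in> Lin l (*)" "\<forall>v. C (Tpow l v) = q v"
    using assms by (auto simp: hpoly_def)
  show ?thesis
    by (rule hpolyI[of _ "\<lambda>t. A (contract k C t)"])
      (simp_all add: A(2) C(2) contract_add[OF C(1)] contract_scale[OF C(1)] contract_tpow[OF C(1)]
        contract_mem[OF C(1)] lin_maps_add[OF A(1)] lin_maps_scale[OF A(1)] tpow_mem)
qed

lemma hpoly_pure:
  assumes "\<And>q n. (q, n) \<in> set qs \<Longrightarrow> hpoly sV n q"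
  shows "hpoly (*) (sum_list (map snd qs)) (\<lambda>v. Pure (map (\<lambda>p. fst p v) qs) \<omega>s)"
  using assms
proof (induction qs arbitrary: \<omega>s)
  case Nil
  then show ?case
    by (simp add: hpoly_const[OF vector_space_field])
next
  case (Cons p qs)
  show ?case
  proof (cases "\<exists>\<omega> \<omega>s'. \<omega>s = \<omega> # \<omega>s' \<and> \<omega> \<in> Dual")
    case True
    then obtain \<omega> \<omega>s' where "\<omega>s = \<omega> # \<omega>s'" "\<omega> \<in> Dual"
      by blast
    moreover have "hpoly sV (snd p) (fst p)"
      using Cons.prems[of "fst p" "snd p"] by simp
    moreover have "hpoly (*) (sum_list (map snd qs)) (\<lambda>v. Pure (map (\<lambda>p. fst p v) qs) \<omega>s')"
      using Cons by auto
    ultimately show ?thesis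
      using hpoly_mult[OF hpoly_dual] by (fastforce simp: pure_Cons mult.commute)
  next
    case False
    then have "(\<lambda>v. Pure (map (\<lambda>p. fst p v) (p # qs)) \<omega>s) = (\<lambda>_. 0)"
      by (cases \<omega>s) (auto simp: pure_Cons)
    then show ?thesis
      by (simp only: hpoly_zero[OF vector_space_field])
  qed
qed

lemma hpoly_sym_tensor:
  assumes "\<And>q n. (q, n) \<in> set qs \<Longrightarrow> hpoly sV n q"
  shows "hpoly tscale (sum_list (map snd qs)) (\<lambda>v. Symt (map (\<lambda>p. fst p v) qs))"
proof (rule hpoly_fun)
  fix \<omega>s
  have "hpoly (*) (sum_list (map snd qs)) (\<lambda>v. 1 / fact (length \<omega>s) *
    (\<Sum>\<pi> | \<pi> permutes {..<length \<omega>s}. Pure (map (\<lambda>p. fst p v) qs) (permute_list \<pi> \<omega>s)))"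
    by (intro hpoly_scale hpoly_sum hpoly_pure assms vector_space_field)
  then show "hpoly (*) (sum_list (map snd qs)) (\<lambda>v. Symt (map (\<lambda>p. fst p v) qs) \<omega>s)"
    by (simp add: symmetrize_def flip: symmetrize_pure)
qed

lemma pure_inject: "Pure [x] = Pure [y] \<longleftrightarrow> x = y"
proof
  assume eq: "Pure [x] = Pure [y]"
  have "\<omega> (x - y) = 0" if "\<omega> \<in> Dual" for \<omega>
    using fun_cong[OF eq, of "[\<omega>]"] that dual_add[OF that, of "x - y" y] by (simp add: pure_Cons pure_Nil)
  then show "x = y"
    using dual_separates[of "x - y"] by simp
qed simp

lemma tpow_1: "Tpow (Suc 0) v = Pure [v]"
  by (simp add: tpow_def)

lemma sym_power_1: "t \<in> Sym (Suc 0) \<Longrightarrow> \<exists>v. t = Pure [v]"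
proof (induction rule: sym_power_induct)
  case zero
  have "0 = Pure [0]"
    by (auto simp: fun_eq_iff pure_Cons dual_0 split: list.split)
  then show ?case ..
next
  case (step c v s)
  then obtain u where "s = Pure [u]" by blast
  then have "tscale c (Tpow (Suc 0) v) + s = Pure [sV c v + u]"
    using pure_add[of "[]" "sV c v" u "[]"] pure_scale[of "[]" c v "[]"] by (simp add: tpow_1)
  then show ?case ..
qed

text \<open>Every element of \<open>V\<^sup>\<odot>\<^sup>1\<close> is \<open>Pure [v]\<close> for exactly one \<open>v\<close>, since functionals separate vectors. So
  the vector can be recovered from the tensor.\<close>

lemma hpoly_id: "hpoly sV (Suc 0) (\<lambda>v. v)"
proof (rule hpolyI[of _ "\<lambda>t. THE v. t = Pure [v]"])
  fix s t assume "s \<in> Sym (Suc 0)" "t \<in> Sym (Suc 0)"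
  then obtain x y where xy: "s = Pure [x]" "t = Pure [y]"
    using sym_power_1 by meson
  then have "s + t = Pure [x + y]"
    using pure_add[of "[]"] by simp
  then show "(THE v. s + t = Pure [v]) = (THE v. s = Pure [v]) + (THE v. t = Pure [v])"
    by (simp add: xy pure_inject)
next
  fix c t assume "t \<in> Sym (Suc 0)"
  then obtain x where x: "t = Pure [x]"
    using sym_power_1 by meson
  then have "tscale c t = Pure [sV c x]"
    using pure_scale[of "[]"] by simp
  then show "(THE v. tscale c t = Pure [v]) = sV c (THE v. t = Pure [v])"
    by (simp add: x pure_inject)
qed (simp add: tpow_1 pure_inject)

end

section \<open>Polynomial curves and their order of vanishing\<close>

text \<open>Polynomial curves that vanish to order at least \<open>N\<close> at \<open>0\<close>. The induction rule treats one monomial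
  \<open>t\<^sup>n w\<close> at a time. The value at \<open>t = 0\<close> is left open, so that powers of \<open>t\<close> can be cancelled.\<close>

inductive_set curves :: "('f::field \<Rightarrow> 'w::ab_group_add \<Rightarrow> 'w) \<Rightarrow> nat \<Rightarrow> ('f \<Rightarrow> 'w) set"
  for sW N where
  zero: "(\<And>t. t \<noteq> 0 \<Longrightarrow> f t = 0) \<Longrightarrow> f \<in> curves sW N"
| step: "g \<in> curves sW N \<Longrightarrow> N \<le> n \<Longrightarrow> (\<And>t. t \<noteq> 0 \<Longrightarrow> f t = sW (t ^ n) w + g t) \<Longrightarrow> f \<in> curves sW N"

lemma curves_mono: "f \<in> curves sW M \<Longrightarrow> N \<le> M \<Longrightarrow> f \<in> curves sW N"
  by (induction rule: curves.induct) (blast intro: curves.zero curves.step order.trans)+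

lemma curves_cong:
  assumes "f \<in> curves sW N" "\<And>t. t \<noteq> 0 \<Longrightarrow> f t = g t"
  shows "g \<in> curves sW N"
  using assms
proof (cases rule: curves.cases)
  case zero
  show ?thesis
    by (rule curves.zero) (metis zero assms(2))
next
  case (step h n w)
  show ?thesis
    by (rule curves.step[OF step(1,2), of _ w]) (metis step(3) assms(2))
qed

lemma (in vector_space) curves_add:
  assumes "f \<in> curves scale N" "g \<in> curves scale N"
  shows "(\<lambda>t. f t + g t) \<in> curves scale N"
  using assms(1)
proof (induction rule: curves.induct)
  case (zero f)
  then show ?case
    by (intro curves_cong[OF assms(2)]) simp
next
  case (step h n f w)
  show ?case
    by (rule curves.step[of "\<lambda>t. h t + g t" _ _ n _ w]) (use step in \<open>simp_all add: add.assoc\<close>)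
qed

lemma (in vector_space) curves_shift:
  assumes "f \<in> curves scale N"
  shows "(\<lambda>t. scale (c * t ^ k) (f t)) \<in> curves scale (k + N)"
  using assms
proof (induction rule: curves.induct)
  case (zero f)
  show ?case
    by (rule curves.zero) (use zero in simp)
next
  case (step h n f w)
  show ?case
    by (rule curves.step[of "\<lambda>t. scale (c * t ^ k) (h t)" _ _ "k + n" _ "scale c w"])
      (use step in \<open>simp_all add: scale_right_distrib power_add mult_ac\<close>)
qed

lemma (in vector_space) curves_cancel:
  assumes "(\<lambda>t. scale (t ^ k) (f t)) \<in> curves scale (k + N)"
  shows "f \<in> curves scale N"
proof -
  have "(\<lambda>t. scale (inverse (t ^ k)) (g t)) \<in> curves scale N" if "g \<in> curves scale (k + N)" for g
    using that
  proof (induction rule: curves.induct)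
    case (zero g)
    show ?case
      by (rule curves.zero) (use zero in simp)
  next
    case (step h n g w)
    show ?case
      by (rule curves.step[of "\<lambda>t. scale (inverse (t ^ k)) (h t)" _ _ "n - k" _ w])
        (use step in \<open>simp_all add: scale_right_distrib power_diff divide_inverse mult.commute\<close>)
  qed
  from this[OF assms] show ?thesis
    by (rule curves_cong) simp
qed

lemma (in vector_space) curves_scale: "f \<in> curves scale N \<Longrightarrow> (\<lambda>t. scale c (f t)) \<in> curves scale N"
  using curves_shift[of f N c 0] by simp

lemma (in vector_space) curves_uminus: "f \<in> curves scale N \<Longrightarrow> (\<lambda>t. - f t) \<in> curves scale N"
  using curves_scale[of f N "-1"] by simp

lemma (in vector_space) curves_diff:
  "f \<in> curves scale N \<Longrightarrow> g \<in> curves scale N \<Longrightarrow> (\<lambda>t. f t - g t) \<in> curves scale N"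
  using curves_add[OF _ curves_uminus, of f N] by fastforce

lemma (in vector_space) curves_diff_trans:
  "(\<lambda>t. f t - g t) \<in> curves scale N \<Longrightarrow> (\<lambda>t. g t - h t) \<in> curves scale N
    \<Longrightarrow> (\<lambda>t. f t - h t) \<in> curves scale N"
  using curves_add[of "\<lambda>t. f t - g t" N "\<lambda>t. g t - h t"] by simp

lemma (in vector_space) curves_diff_sym:
  "(\<lambda>t. f t - g t) \<in> curves scale N \<Longrightarrow> (\<lambda>t. g t - f t) \<in> curves scale N"
  using curves_uminus[of "\<lambda>t. f t - g t" N] by simp

lemma curves_zero: "(\<lambda>_. 0) \<in> curves sW N"
  by (rule curves.zero) simp

lemma (in vector_space) curves_sum:
  "(\<And>i. i \<in> I \<Longrightarrow> f i \<in> curves scale N) \<Longrightarrow> (\<lambda>t. \<Sum>i\<in>I. f i t) \<in> curves scale N"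
  by (induction I rule: infinite_finite_induct) (auto intro: curves_zero curves_add)

lemma (in vector_space) curves_monom: "(\<lambda>t. scale (t ^ n) w) \<in> curves scale n"
  by (rule curves.step[OF curves_zero order.refl]) simp

lemma (in vector_space) curves_const: "(\<lambda>_. w) \<in> curves scale 0"
  using curves_monom[of 0 w] by simp

text \<open>Two curves that agree up to order \<open>N\<close> have the same coefficients below \<open>N\<close>: apply functionals, and
  use that a polynomial over an infinite field is determined by its values at \<open>t \<noteq> 0\<close>.\<close>

lemma (in tensor_space) curves_coeffs_0:
  assumes "(\<lambda>t. \<Sum>i<N. sV (t ^ i) (c i)) \<in> curves sV N" and "i < N"
  shows "c i = 0"
proof (rule dual_separates)
  fix \<omega> assume \<omega>: "\<omega> \<in> Dual"
  have "\<exists>p. \<forall>t. t \<noteq> 0 \<longrightarrow> \<omega> (f t) = poly (monom 1 N * p) t" if "f \<in> curves sV N" for f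
    using that
  proof (induction rule: curves.induct)
    case (zero f)
    then show ?case
      by (intro exI[of _ 0]) (simp add: dual_0[OF \<omega>])
  next
    case (step g n f w)
    then obtain p where "\<forall>t. t \<noteq> 0 \<longrightarrow> \<omega> (g t) = poly (monom 1 N * p) t"
      by blast
    then show ?case
      using step by (intro exI[of _ "monom (\<omega> w) (n - N) + p"])
        (auto simp: dual_add[OF \<omega>] dual_scale[OF \<omega>] poly_monom algebra_simps simp flip: power_add)
  qed
  from this[OF assms(1)] obtain p
    where p: "\<And>t. t \<noteq> 0 \<Longrightarrow> \<omega> (\<Sum>i<N. sV (t ^ i) (c i)) = poly (monom 1 N * p) t"
    by blast
  let ?q = "(\<Sum>i<N. monom (\<omega> (c i)) i) - monom 1 N * p"
  have "poly ?q t = 0" if "t \<noteq> 0" for t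
    using p[OF that] by (simp add: poly_sum poly_monom dual_sum[OF \<omega>] dual_scale[OF \<omega>] mult.commute)
  then have "- {0} \<subseteq> {t. poly ?q t = 0}"
    by auto
  moreover have "infinite (- {0 :: 'f})"
    by (simp add: Compl_eq_Diff_UNIV infinite_UNIV_char_0)
  ultimately have "?q = 0"
    using poly_roots_finite[of ?q] finite_subset by blast
  then have "coeff (\<Sum>i<N. monom (\<omega> (c i)) i) i = coeff (monom 1 N * p) i"
    by simp
  then show "\<omega> (c i) = 0"
    using \<open>i < N\<close> by (simp add: coeff_sum coeff_monom_mult)
qed

lemma (in tensor_space) curves_const_0: "(\<lambda>_. w) \<in> curves sV 1 \<Longrightarrow> w = 0"
  using curves_coeffs_0[of "\<lambda>_. w" 1 0] by simp

context tensor_space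
begin

lemma lin_sym_tensor_add:
  assumes A: "A \<in> Lin m sW" and "length us + Suc (length vs) = m"
  shows "A (Symt (us @ (x + y) # vs)) = A (Symt (us @ x # vs)) + A (Symt (us @ y # vs))"
  unfolding sym_tensor_add using assms(2)
  by (intro lin_maps_add[OF A] sym_tensor_mem') simp_all

lemma lin_sym_tensor_scale:
  assumes A: "A \<in> Lin m sW" and "length us + Suc (length vs) = m"
  shows "A (Symt (us @ sV c x # vs)) = sW c (A (Symt (us @ x # vs)))"
  unfolding sym_tensor_scale using assms(2)
  by (intro lin_maps_scale[OF A] sym_tensor_mem') simp_all

lemma curves_sym_tensor_aux:
  assumes "vector_space sW" and A: "A \<in> Lin m sW"
    and "list_all2 (\<lambda>f n. f \<in> curves sV n) fs ns" and "length us + length fs = m"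
  shows "(\<lambda>t. A (Symt (us @ map (\<lambda>f. f t) fs))) \<in> curves sW (sum_list ns)"
  using assms(3,4)
proof (induction arbitrary: us rule: list_all2_induct)
  case Nil
  interpret W: vector_space sW by fact
  show ?case
    by (simp add: W.curves_const)
next
  case (Cons f fs n ns)
  interpret W: vector_space sW by fact
  show ?case
    using Cons.hyps(1)
  proof (induction rule: curves.induct)
    case (zero f)
    have 0: "A (Symt (us @ 0 # map (\<lambda>f. f t) fs)) = 0" for t
      using lin_sym_tensor_scale[OF A, of us "map (\<lambda>f. f t) fs" 0 0] Cons.prems by simp
    show ?case
      by (rule curves.zero) (simp add: zero 0)
  next
    case (step g k f w)
    have "(\<lambda>t. A (Symt ((us @ [w]) @ map (\<lambda>f. f t) fs))) \<in> curves sW (sum_list ns)"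
      using Cons.prems by (intro Cons.IH) simp
    then have "(\<lambda>t. sW (1 * t ^ k) (A (Symt ((us @ [w]) @ map (\<lambda>f. f t) fs))))
        \<in> curves sW (k + sum_list ns)"
      by (rule W.curves_shift)
    then have "(\<lambda>t. sW (1 * t ^ k) (A (Symt ((us @ [w]) @ map (\<lambda>f. f t) fs))))
        \<in> curves sW (sum_list (n # ns))"
      by (rule curves_mono) (use step in simp)
    from W.curves_add[OF this step.IH] show ?case
    proof (rule curves_cong)
      fix t :: 'f assume "t \<noteq> 0"
      then show "sW (1 * t ^ k) (A (Symt ((us @ [w]) @ map (\<lambda>f. f t) fs)))
          + A (Symt (us @ map (\<lambda>f. f t) (g # fs))) = A (Symt (us @ map (\<lambda>f. f t) (f # fs)))"
        using Cons.prems step(3)[of t] by (simp add: lin_sym_tensor_add[OF A] lin_sym_tensor_scale[OF A])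
    qed
  qed
qed

text \<open>Orders of vanishing add up: by multilinearity it is enough to consider monomials \<open>t\<^sup>n w\<close> in each
  factor, and their powers of \<open>t\<close> can be moved out.\<close>

lemma curves_sym_tensor:
  assumes "vector_space sW" and "A \<in> Lin (length fs) sW"
    and "list_all2 (\<lambda>f n. f \<in> curves sV n) fs ns"
  shows "(\<lambda>t. A (Symt (map (\<lambda>f. f t) fs))) \<in> curves sW (sum_list ns)"
  using curves_sym_tensor_aux[OF assms(1,2,3), of "[]"] by simp

text \<open>The factors are exchanged one at a time; \<open>hs\<close> holds those that have been exchanged.\<close>

lemma curves_sym_tensor_diff:
  assumes "vector_space sW" and A: "A \<in> Lin m sW"
    and "list_all2 (\<lambda>f g. f \<in> curves sV 0 \<and> g \<in> curves sV 0 \<and> (\<lambda>t. f t - g t) \<in> curves sV N) fs gs"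
    and "length hs + length fs = m" and "set hs \<subseteq> curves sV 0"
  shows "(\<lambda>t. A (Symt (map (\<lambda>f. f t) (hs @ fs))) - A (Symt (map (\<lambda>f. f t) (hs @ gs)))) \<in> curves sW N"
  using assms(3-5)
proof (induction arbitrary: hs rule: list_all2_induct)
  case Nil
  then show ?case
    by (simp add: curves_zero)
next
  case (Cons f fs g gs)
  interpret W: vector_space sW by fact
  let ?d = "\<lambda>t. f t - g t"
  have fs: "set fs \<subseteq> curves sV 0"
    using Cons.hyps(2) by (auto simp: list_all2_conv_all_nth set_conv_nth)
  have "list_all2 (\<lambda>f n. f \<in> curves sV n) (hs @ ?d # fs)
      (replicate (length hs) 0 @ N # replicate (length fs) 0)"
    using Cons.hyps(1) Cons.prems fs
    by (intro list_all2_appendI list_all2_Cons[THEN iffD2]) (auto simp: list_all2_conv_all_nth subset_iff)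
  from curves_sym_tensor[OF W.vector_space_axioms _ this, of A]
  have "(\<lambda>t. A (Symt (map (\<lambda>f. f t) (hs @ ?d # fs)))) \<in> curves sW N"
    using A Cons.prems by (simp add: sum_list_replicate)
  moreover have "(\<lambda>t. A (Symt (map (\<lambda>f. f t) ((hs @ [g]) @ fs))) - A (Symt (map (\<lambda>f. f t) ((hs @ [g]) @ gs))))
      \<in> curves sW N"
    using Cons.prems Cons.hyps by (intro Cons.IH) auto
  ultimately have "(\<lambda>t. A (Symt (map (\<lambda>f. f t) (hs @ ?d # fs))) +
      (A (Symt (map (\<lambda>f. f t) ((hs @ [g]) @ fs))) - A (Symt (map (\<lambda>f. f t) ((hs @ [g]) @ gs)))))
      \<in> curves sW N"
    by (rule W.curves_add)
  then show ?case
  proof (rule curves_cong)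
    fix t
    have "A (Symt (map (\<lambda>f. f t) hs @ (?d t + g t) # map (\<lambda>f. f t) fs))
        = A (Symt (map (\<lambda>f. f t) (hs @ ?d # fs))) + A (Symt (map (\<lambda>f. f t) (hs @ g # fs)))"
      using Cons.prems by (subst lin_sym_tensor_add[OF A]) auto
    then show "A (Symt (map (\<lambda>f. f t) (hs @ ?d # fs))) +
        (A (Symt (map (\<lambda>f. f t) ((hs @ [g]) @ fs))) - A (Symt (map (\<lambda>f. f t) ((hs @ [g]) @ gs))))
        = A (Symt (map (\<lambda>f. f t) (hs @ f # fs))) - A (Symt (map (\<lambda>f. f t) (hs @ g # gs)))"
      by simp
  qed
qed

text \<open>The first-order Taylor formula with increment \<open>t\<^sup>K y(t)\<close>. It is proved for a part of
  the factors, because the induction moves the factors that have been expanded into \<open>hs\<close>.\<close>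

lemma taylor_aux:
  assumes "vector_space sW" and A: "A \<in> Lin m sW"
    and x: "x \<in> curves sV 0" and y: "y \<in> curves sV 0"
    and "length hs + j = m" and "set hs \<subseteq> curves sV 0"
  shows "(\<lambda>t. A (Symt (map (\<lambda>f. f t) hs @ replicate j (x t + sV (t ^ K) (y t))))
    - (A (Symt (map (\<lambda>f. f t) hs @ replicate j (x t)))
       + sW (of_nat j * t ^ K) (A (Symt (map (\<lambda>f. f t) hs @ y t # replicate (j - 1) (x t))))))
    \<in> curves sW (2 * K)"
  using assms(5,6)
proof (induction j arbitrary: hs)
  case 0
  interpret W: vector_space sW by fact
  show ?case
    by (simp add: curves_zero)
next
  case (Suc j)
  interpret W: vector_space sW by fact
  define z where "z = (\<lambda>t. x t + sV (t ^ K) (y t))"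
  let ?h = "\<lambda>t. map (\<lambda>f. f t) hs"
  let ?D1 = "\<lambda>t. A (Symt (map (\<lambda>f. f t) (hs @ [x]) @ replicate j (z t)))
    - (A (Symt (map (\<lambda>f. f t) (hs @ [x]) @ replicate j (x t)))
       + sW (of_nat j * t ^ K) (A (Symt (map (\<lambda>f. f t) (hs @ [x]) @ y t # replicate (j - 1) (x t)))))"
  let ?D2 = "\<lambda>t. sW (1 * t ^ K) (A (Symt (map (\<lambda>f. f t) ((hs @ [y]) @ replicate j z)))
      - A (Symt (map (\<lambda>f. f t) ((hs @ [y]) @ replicate j x))))"
  have yK: "(\<lambda>t. sV (t ^ K) (y t)) \<in> curves sV K"
    using curves_shift[OF y, of 1 K] by simp
  then have z: "z \<in> curves sV 0"
    unfolding z_def by (intro curves_add x) (auto elim: curves_mono)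
  have "?D1
    \<in> curves sW (2 * K)"
    unfolding z_def using Suc.prems x by (intro Suc.IH) auto
  moreover have "?D2 \<in> curves sW (K + K)"
  proof (intro W.curves_shift curves_sym_tensor_diff[OF assms(1) A])
    show "list_all2 (\<lambda>f g. f \<in> curves sV 0 \<and> g \<in> curves sV 0 \<and> (\<lambda>t. f t - g t) \<in> curves sV K)
       (replicate j z) (replicate j x)"
      using x z yK by (auto simp: list_all2_conv_all_nth z_def)
  qed (use Suc.prems y in auto)
  ultimately have "(\<lambda>t. ?D1 t
    + ?D2 t) \<in> curves sW (2 * K)"
    by (intro W.curves_add) (simp_all add: mult_2)
  then show ?case
  proof (rule curves_cong)
    fix t
    have "A (Symt (?h t @ replicate (Suc j) (z t))) = A (Symt (?h t @ x t # replicate j (z t)))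
        + sW (t ^ K) (A (Symt (?h t @ y t # replicate j (z t))))"
      using Suc.prems by (simp add: z_def lin_sym_tensor_add[OF A] lin_sym_tensor_scale[OF A])
    moreover have "sW (of_nat j * t ^ K) (A (Symt (?h t @ x t # y t # replicate (j - 1) (x t))))
        = sW (of_nat j * t ^ K) (A (Symt (?h t @ y t # replicate j (x t))))"
    proof (cases j)
      case (Suc i)
      have "Symt (?h t @ x t # y t # replicate (j - 1) (x t)) = Symt (?h t @ y t # replicate j (x t))"
        by (rule sym_tensor_mset) (simp add: Suc)
      then show ?thesis by simp
    qed simp
    ultimately show "?D1 t
      + ?D2 t
      = A (Symt (?h t @ replicate (Suc j) (x t + sV (t ^ K) (y t))))
      - (A (Symt (?h t @ replicate (Suc j) (x t)))
       + sW (of_nat (Suc j) * t ^ K) (A (Symt (?h t @ y t # replicate (Suc j - 1) (x t)))))"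
      unfolding z_def[symmetric, THEN fun_cong]
      by (auto simp add: W.scale_right_diff_distrib algebra_simps W.scale_left_distrib)
  qed
qed

lemma taylor:
  assumes "vector_space sW" and A: "A \<in> Lin m sW"
    and x: "x \<in> curves sV 0" and y: "y \<in> curves sV 0"
  shows "(\<lambda>t. A (Tpow m (x t + sV (t ^ K) (y t))) - (A (Tpow m (x t))
       + sW (of_nat m * t ^ K) (A (Symt (y t # replicate (m - 1) (x t)))))) \<in> curves sW (2 * K)"
  using taylor_aux[OF assms, of "[]" m K] by (simp add: tpow_eq_sym_tensor)

lemma curves_tpow:
  assumes "vector_space sW" "A \<in> Lin m sW" "x \<in> curves sV n"
  shows "(\<lambda>t. A (Tpow m (x t))) \<in> curves sW (m * n)"
proof -
  have "list_all2 (\<lambda>f n. f \<in> curves sV n) (replicate m x) (replicate m n)"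
    using assms(3) by (simp add: list_all2_conv_all_nth)
  from curves_sym_tensor[OF assms(1) _ this, of A] show ?thesis
    using assms(2) by (simp add: tpow_eq_sym_tensor sum_list_replicate)
qed

lemma curves_tpow_diff:
  assumes "vector_space sW" "A \<in> Lin m sW"
    and "x \<in> curves sV 0" "y \<in> curves sV 0" "(\<lambda>t. x t - y t) \<in> curves sV N"
  shows "(\<lambda>t. A (Tpow m (x t)) - A (Tpow m (y t))) \<in> curves sW N"
proof -
  have "list_all2 (\<lambda>f g. f \<in> curves sV 0 \<and> g \<in> curves sV 0 \<and> (\<lambda>t. f t - g t) \<in> curves sV N)
      (replicate m x) (replicate m y)"
    using assms(3-5) by (simp add: list_all2_conv_all_nth)
  from curves_sym_tensor_diff[OF assms(1,2) this, of "[]"] show ?thesis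
    by (simp add: tpow_eq_sym_tensor)
qed

end

section \<open>Composition of formal tensor power series\<close>

lemma length_le_sum_list: "(\<forall>i\<in>set is. Suc 0 \<le> i) \<Longrightarrow> length is \<le> sum_list is" for "is" :: "nat list"
  by (induction "is") auto

lemma finite_compositions: "finite {is. (\<forall>i\<in>set is. 1 \<le> i) \<and> sum_list is < N}" for N :: nat
proof (rule finite_subset)
  show "{is. (\<forall>i\<in>set is. 1 \<le> i) \<and> sum_list is < N} \<subseteq> {is. set is \<subseteq> {..<N} \<and> length is \<le> N}"
    by (auto dest!: length_le_sum_list dest: member_le_sum_list)
qed (simp add: finite_lists_length_le)

context tensor_space
begin

lemma fseries_coeff: "A \<in> fseries sV sW \<Longrightarrow> A n \<in> Lin n sW"
  by (simp add: fseries_def)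

lemma fseriesI: "(\<And>n. A n \<in> Lin n sW) \<Longrightarrow> A \<in> fseries sV sW"
  by (simp add: fseries_def)

lemma fseries_eqI:
  assumes "A \<in> fseries sV sW" "A' \<in> fseries sV sW" "\<And>n v. A n (Tpow n v) = A' n (Tpow n v)"
  shows "A = A'"
  using assms by (intro ext[of A A'] lin_maps_eqI[of _ _ sW UNIV _ UNIV]) (auto simp: fseries_coeff)

lemma tpow_scale: "Tpow n (sV c v) = tscale (c ^ n) (Tpow n v)"
  by (auto simp: fun_eq_iff tpow_apply dual_scale subset_iff prod.distrib intro!: prod.cong)

lemma sym_tensor_scale_replicate:
  "Symt (us @ replicate m (sV c v)) = tscale (c ^ m) (Symt (us @ replicate m v))"
proof (induction m arbitrary: us)
  case (Suc m)
  have "Symt (us @ replicate (Suc m) (sV c v)) = tscale c (Symt ((us @ [v]) @ replicate m (sV c v)))"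
    by (simp add: sym_tensor_scale)
  also have "\<dots> = tscale (c ^ Suc m) (Symt (us @ replicate (Suc m) v))"
    by (simp only: Suc.IH tensor.scale_scale) simp
  finally show ?case .
qed simp

text \<open>A formal series has no values, but its truncations below degree \<open>N\<close> are functions. Composition of
  series corresponds to composition of these functions, up to terms of degree at least \<open>N\<close>.\<close>

definition ev :: "nat \<Rightarrow> (nat \<Rightarrow> ('f, 'v) tensor \<Rightarrow> 'w::comm_monoid_add) \<Rightarrow> 'v \<Rightarrow> 'w" where
  "ev N A v = (\<Sum>n<N. A n (Tpow n v))"

lemma ev_scale:
  assumes "A \<in> fseries sV sW"
  shows "ev N A (sV t w) = (\<Sum>n<N. sW (t ^ n) (A n (Tpow n w)))"
  unfolding ev_def tpow_scale by (intro sum.cong refl lin_maps_scale[OF fseries_coeff[OF assms]] tpow_mem)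

lemma ev_curves:
  assumes "vector_space sW" "A \<in> fseries sV sW" "x \<in> curves sV 0"
  shows "(\<lambda>t. ev N A (x t)) \<in> curves sW 0"
proof -
  interpret W: vector_space sW by fact
  show ?thesis
    unfolding ev_def using curves_tpow[OF assms(1) fseries_coeff[OF assms(2)] assms(3)]
    by (intro W.curves_sum) simp
qed

lemma ev_curves_1:
  assumes "vector_space sW" "A \<in> fseries sV sW" "A 0 = 0" "x \<in> curves sV 1"
  shows "(\<lambda>t. ev N A (x t)) \<in> curves sW 1"
proof -
  interpret W: vector_space sW by fact
  have "(\<lambda>t. A n (Tpow n (x t))) \<in> curves sW 1" for n
    using curves_tpow[OF assms(1) fseries_coeff[OF assms(2)] assms(4), of n]
    by (cases "n = 0") (auto simp: assms(3) curves_zero intro: curves_mono)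
  then show ?thesis
    unfolding ev_def by (intro W.curves_sum)
qed

lemma ev_diff:
  assumes "vector_space sW" "A \<in> fseries sV sW"
    and "x \<in> curves sV 0" "y \<in> curves sV 0" "(\<lambda>t. x t - y t) \<in> curves sV M"
  shows "(\<lambda>t. ev N A (x t) - ev N A (y t)) \<in> curves sW M"
proof -
  interpret W: vector_space sW by fact
  show ?thesis
    unfolding ev_def sum_subtractf[symmetric]
    by (intro W.curves_sum curves_tpow_diff[OF assms(1) fseries_coeff[OF assms(2)] assms(3-5)])
qed

lemma ev_coeffs_eq:
  assumes "tensor_space sW" "A \<in> fseries sV sW" "A' \<in> fseries sV sW"
    and "(\<lambda>t. ev N A (sV t w) - ev N A' (sV t w)) \<in> curves sW N" "n < N"
  shows "A n (Tpow n w) = A' n (Tpow n w)"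
proof -
  interpret W: tensor_space sW by fact
  have "(\<lambda>t. \<Sum>n<N. sW (t ^ n) (A n (Tpow n w) - A' n (Tpow n w))) \<in> curves sW N"
    using assms(4)
    by (simp add: ev_scale[OF assms(2)] ev_scale[OF assms(3)] W.scale_right_diff_distrib sum_subtractf)
  from W.curves_coeffs_0[OF this \<open>n < N\<close>] show ?thesis
    by simp
qed

lemma hpoly_sym_tensor_series:
  assumes "B \<in> fseries sV sV"
  shows "hpoly tscale (sum_list is) (\<lambda>v. Symt (map (\<lambda>i. B i (Tpow i v)) is))"
  using hpoly_sym_tensor[of "map (\<lambda>i. (\<lambda>v. B i (Tpow i v), i)) is"] hpoly_lin_maps[OF fseries_coeff[OF assms]]
  by (auto simp: comp_def)

abbreviation compositions :: "(nat \<Rightarrow> ('f, 'v) tensor \<Rightarrow> 'v) \<Rightarrow> 'v \<Rightarrow> nat \<Rightarrow> nat \<Rightarrow> ('f, 'v) tensor" where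
  "compositions B v m n \<equiv> \<Sum>is | length is = m \<and> (\<forall>i\<in>set is. 1 \<le> i) \<and> sum_list is = n.
     Symt (map (\<lambda>i. B i (Tpow i v)) is)"

lemma hpoly_ser_comp_summand:
  assumes "vector_space sW" "C \<in> Lin m sW" "B \<in> fseries sV sV"
  shows "hpoly sW n (\<lambda>v. C (compositions B v m n))"
  using hpoly_sym_tensor_series[OF assms(3)]
  by (intro hpoly_lin[OF _ _ assms(2)] hpoly_sum sym_sum sym_tensor_mem' tensor.vector_space_axioms) auto

lemma ser_comp_fseries:
  assumes "vector_space sW" "A \<in> fseries sV sW" "B \<in> fseries sV sV"
  shows "ser_comp sV sW A B \<in> fseries sV sW"
proof (rule fseriesI)
  fix n
  show "ser_comp sV sW A B n \<in> Lin n sW"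
  proof (cases "n = 0")
    case False
    then show ?thesis
      unfolding ser_comp_def if_not_P[OF False]
      by (intro op_of_powers(1) hpoly_sum hpoly_ser_comp_summand assms fseries_coeff)
  qed (simp add: ser_comp_def fseries_coeff[OF assms(2)])
qed

lemma ser_comp_tpow':
  assumes "vector_space sW" "A \<in> fseries sV sW" "B \<in> fseries sV sV" "n \<noteq> 0"
  shows "ser_comp sV sW A B n (Tpow n v) =
    (\<Sum>m = 1..n. A m (compositions B v m n))"
  unfolding ser_comp_def if_not_P[OF assms(4)]
  by (intro op_of_powers(2) hpoly_sum hpoly_ser_comp_summand assms fseries_coeff)

lemma ser_comp_tpow:
  assumes "vector_space sW" "A \<in> fseries sV sW" "B \<in> fseries sV sV"
  shows "ser_comp sV sW A B n (Tpow n v) =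
    (\<Sum>is | (\<forall>i\<in>set is. 1 \<le> i) \<and> sum_list is = n. A (length is) (Symt (map (\<lambda>i. B i (Tpow i v)) is)))"
proof (cases "n = 0")
  case True
  have "is = []" if "\<forall>i\<in>set is. 1 \<le> i" "sum_list is = 0" for "is" :: "nat list"
    using length_le_sum_list[of "is"] that by (metis One_nat_def le_zero_eq length_0_conv)
  then have "{is. (\<forall>i\<in>set is. 1 \<le> i) \<and> sum_list is = (0::nat)} = {[]}"
    by (intro equalityI subsetI) (simp_all del: sum_list_eq_0_iff)
  then show ?thesis
    by (simp add: True ser_comp_def tpow_eq_sym_tensor)
next
  case False
  let ?b = "\<lambda>is. Symt (map (\<lambda>i. B i (Tpow i v)) is)"
  let ?I = "\<lambda>m. {is. length is = m \<and> (\<forall>i\<in>set is. 1 \<le> i) \<and> sum_list is = n}"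
  have fin: "finite (?I m)" for m
    by (rule finite_subset[OF _ finite_compositions[of "Suc n"]]) auto
  have "ser_comp sV sW A B n (Tpow n v) = (\<Sum>m = 1..n. \<Sum>is\<in>?I m. A m (?b is))"
    unfolding ser_comp_tpow'[OF assms False]
    by (intro sum.cong refl lin_maps_sum[OF tensor.vector_space_axioms subspace_sym_power
          fseries_coeff[OF assms(2)]] sym_tensor_mem') auto
  also have "\<dots> = (\<Sum>(m, is)\<in>(SIGMA m:{1..n}. ?I m). A m (?b is))"
    using fin by (intro sum.Sigma) auto
  also have "\<dots> = (\<Sum>is | (\<forall>i\<in>set is. 1 \<le> i) \<and> sum_list is = n. A (length is) (?b is))"
  proof (rule sum.reindex_bij_witness[of _ "\<lambda>is. (length is, is)" snd])
    fix "is" assume "is": "is \<in> {is. (\<forall>i\<in>set is. 1 \<le> i) \<and> sum_list is = n}"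
    with False have "is \<noteq> []"
      by auto
    then have "Suc 0 \<le> length is"
      by (simp add: Suc_le_eq)
    then show "(length is, is) \<in> (SIGMA m:{1..n}. ?I m)"
      using "is" length_le_sum_list[of "is"] by auto
  qed auto
  finally show ?thesis .
qed

text \<open>Both terms are sums over lists \<open>(i\<^sub>1, \<dots>, i\<^sub>m)\<close> of the value of \<open>A\<^sub>m\<close> at the symmetric product of
  the vectors \<open>B\<^sub>i v\<^sup>\<otimes>\<^sup>i\<close>. On a curve that vanishes at \<open>0\<close> such a value has order
  \<open>i\<^sub>1 + \<dots> + i\<^sub>m\<close>. The lists that occur only in \<open>A(B(v))\<close>, computed from the truncations, contain an
  entry \<open>0\<close> and give \<open>0\<close>, or they give order at least \<open>N\<close>.\<close>

lemma ev_ser_comp: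
  assumes "vector_space sW" "A \<in> fseries sV sW" "B \<in> fseries sV sV" "B 0 = 0" and x: "x \<in> curves sV 1"
  shows "(\<lambda>t. ev N (ser_comp sV sW A B) (x t) - ev N A (ev N B (x t))) \<in> curves sW N"
proof -
  interpret W: vector_space sW by fact
  let ?T = "\<lambda>is v. A (length is) (Symt (map (\<lambda>i. B i (Tpow i v)) is))"
  let ?I = "\<lambda>n. {is. (\<forall>i\<in>set is. 1 \<le> i) \<and> sum_list is = n}"
  let ?S = "{is. (\<forall>i\<in>set is. 1 \<le> i) \<and> sum_list is < N}"
  let ?J = "\<lambda>m. {is. set is \<subseteq> {..<N} \<and> length is = m}"
  let ?S' = "{is. set is \<subseteq> {..<N} \<and> length is < N}"
  have "finite {is. set is \<subseteq> {..<N} \<and> length is \<le> N}"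
    by (simp add: finite_lists_length_le)
  then have fin': "finite ?S'"
    by (rule rev_finite_subset) auto
  have sub: "?S \<subseteq> ?S'"
    by (auto dest!: length_le_sum_list dest: member_le_sum_list)
  have l: "ev N (ser_comp sV sW A B) v = (\<Sum>is\<in>?S. ?T is v)" for v
  proof -
    have "ev N (ser_comp sV sW A B) v = (\<Sum>(n, is)\<in>(SIGMA n:{..<N}. ?I n). ?T is v)"
      unfolding ev_def ser_comp_tpow[OF assms(1-3)]
      by (rule sum.Sigma) (auto intro: finite_subset[OF _ finite_compositions[of N]])
    also have "\<dots> = (\<Sum>is\<in>?S. ?T is v)"
      by (rule sum.reindex_bij_witness[of _ "\<lambda>is. (sum_list is, is)" snd]) auto
    finally show ?thesis .
  qed
  have r: "ev N A (ev N B v) = (\<Sum>is\<in>?S'. ?T is v)" for v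
  proof -
    have "ev N A (ev N B v) = (\<Sum>m<N. \<Sum>is\<in>?J m. A m (Symt (map (\<lambda>i. B i (Tpow i v)) is)))"
      unfolding ev_def tpow_sum[OF finite_lessThan]
      by (intro sum.cong refl lin_maps_sum[OF tensor.vector_space_axioms subspace_sym_power
          fseries_coeff[OF assms(2)]] sym_tensor_mem') auto
    also have "\<dots> = (\<Sum>(m, is)\<in>(SIGMA m:{..<N}. ?J m). A m (Symt (map (\<lambda>i. B i (Tpow i v)) is)))"
      by (intro sum.Sigma) (auto simp: finite_lists_length_eq)
    also have "\<dots> = (\<Sum>is\<in>?S'. ?T is v)"
      by (rule sum.reindex_bij_witness[of _ "\<lambda>is. (length is, is)" snd]) auto
    finally show ?thesis .
  qed
  have "(\<lambda>t. \<Sum>is\<in>?S' - ?S. ?T is (x t)) \<in> curves sW N"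
  proof (rule W.curves_sum)
    fix "is" assume "is": "is \<in> ?S' - ?S"
    have b: "(\<lambda>t. B i (Tpow i (x t))) \<in> curves sV i" for i
      using curves_tpow[OF vector_space_axioms fseries_coeff[OF assms(3)] x, of i] by simp
    show "(\<lambda>t. ?T is (x t)) \<in> curves sW N"
    proof (cases "\<forall>i\<in>set is. 1 \<le> i")
      case True
      have "list_all2 (\<lambda>f n. f \<in> curves sV n) (map (\<lambda>i t. B i (Tpow i (x t))) is) is"
        using b by (simp add: list_all2_conv_all_nth)
      from curves_sym_tensor[OF assms(1) _ this] fseries_coeff[OF assms(2)]
      have "(\<lambda>t. ?T is (x t)) \<in> curves sW (sum_list is)"
        by (simp add: comp_def)
      then show ?thesis
        using True "is" by (auto elim!: curves_mono)
    next
      case False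
      then have "0 \<in> set is"
        by (auto simp: not_le)
      then obtain us vs where split: "is = us @ 0 # vs"
        by (meson split_list)
      let ?b = "\<lambda>v. map (\<lambda>i. B i (Tpow i v))"
      have "?T is v = 0" for v
        using lin_sym_tensor_scale[OF fseries_coeff[OF assms(2)], of "?b v us" "?b v vs" "length is" 0 0]
        by (simp add: split \<open>B 0 = 0\<close>)
      then show ?thesis
        by (simp add: curves_zero)
    qed
  qed
  then have "(\<lambda>t. - (\<Sum>is\<in>?S' - ?S. ?T is (x t))) \<in> curves sW N"
    by (rule W.curves_uminus)
  then show ?thesis
    by (rule curves_cong) (simp only: l r sum_diff[OF fin' sub] minus_diff_eq)
qed

lemma ser_id_fseries: "ser_id sV \<in> fseries sV sV"
  and ser_id_tpow: "ser_id sV n (Tpow n v) = (if n = 1 then v else 0)"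
proof -
  have h: "hpoly sV n (\<lambda>v. if n = 1 then v else 0)" for n
    by (cases "n = 1") (simp_all add: hpoly_id hpoly_zero vector_space_axioms)
  show "ser_id sV \<in> fseries sV sV" "ser_id sV n (Tpow n v) = (if n = 1 then v else 0)"
    unfolding ser_id_def by (intro fseriesI op_of_powers h)+
qed

lemma ev_ser_id: "2 \<le> N \<Longrightarrow> ev N (ser_id sV) v = v"
  by (simp add: ev_def ser_id_tpow sum.delta)

lemma line_curve: "(\<lambda>t. sV t w) \<in> curves sV 1"
  using curves_monom[of 1 w] by simp

lemma ev_ser_comp_id:
  assumes "X \<in> fseries sV sV" "Y \<in> fseries sV sV" "Y 0 = 0" "ser_comp sV sV X Y = ser_id sV"
    and "x \<in> curves sV 1" "2 \<le> N"
  shows "(\<lambda>t. x t - ev N X (ev N Y (x t))) \<in> curves sV N"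
  using ev_ser_comp[OF vector_space_axioms assms(1-3,5), of N] by (simp add: assms(4,6) ev_ser_id)

text \<open>The argument \<open>X = X(Y(Z)) = Z\<close>, carried out for truncated series along lines. There composition is
  composition of functions up to any given order, so it is associative.\<close>

lemma ser_inverses_eq:
  assumes X: "X \<in> fseries sV sV" and Y: "Y \<in> fseries sV sV" "Y 0 = 0" and Z: "Z \<in> fseries sV sV" "Z 0 = 0"
    and XY: "ser_comp sV sV X Y = ser_id sV" and YZ: "ser_comp sV sV Y Z = ser_id sV"
  shows "X = Z"
proof (rule fseries_eqI[OF X Z(1)])
  fix n w
  define N :: nat where "N = n + 2"
  define x where "x = (\<lambda>t. sV t w)"
  define z where "z = (\<lambda>t. ev N Z (x t))"
  note vs = vector_space_axioms
  have x: "x \<in> curves sV 1"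
    unfolding x_def by (rule line_curve)
  have z: "z \<in> curves sV 1"
    unfolding z_def by (intro ev_curves_1 vs Z x)
  have "(\<lambda>t. x t - ev N Y (z t)) \<in> curves sV N"
    unfolding z_def by (intro ev_ser_comp_id Y Z YZ x) (simp add: N_def)
  then have "(\<lambda>t. ev N X (x t) - ev N X (ev N Y (z t))) \<in> curves sV N"
    by (intro ev_diff X ev_curves vs Y) (auto intro: curves_mono[OF x] curves_mono[OF z])
  moreover have "(\<lambda>t. z t - ev N X (ev N Y (z t))) \<in> curves sV N"
    by (intro ev_ser_comp_id X Y XY z) (simp add: N_def)
  ultimately have "(\<lambda>t. ev N X (x t) - z t) \<in> curves sV N"
    by (rule curves_diff_trans[OF _ curves_diff_sym])
  then show "X n (Tpow n w) = Z n (Tpow n w)"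
    unfolding z_def x_def
    by (rule ev_coeffs_eq[OF tensor_space_axioms X Z(1)]) (simp add: N_def)
qed


section \<open>The compositional inverse\<close>

text \<open>A monic sequence has \<open>B\<^sub>1 v = v\<close>. In this case the recursion for the inverse series does not have to
  invert \<open>B\<^sub>1\<close>.\<close>

definition unital :: "(nat \<Rightarrow> ('f, 'v) tensor \<Rightarrow> 'v) \<Rightarrow> bool" where
  "unital B \<longleftrightarrow> B \<in> fseries sV sV \<and> B 0 = 0 \<and> (\<forall>v. B 1 (Tpow 1 v) = v)"

lemma unital_fseries1:
  assumes "unital B"
  shows "B \<in> fseries1 sV"
proof -
  have B: "B (Suc 0) (Pure [v]) = v" for v
    using assms by (simp add: unital_def tpow_1)
  have "bij_betw (B 1) (Sym 1) UNIV"
  proof (rule bij_betwI')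
    fix s t assume "s \<in> Sym 1" "t \<in> Sym 1"
    then obtain x y where "s = Pure [x]" "t = Pure [y]"
      using sym_power_1 by (metis One_nat_def)
    then show "(B 1 s = B 1 t) = (s = t)"
      by (simp add: B pure_inject)
  next
    fix v show "\<exists>t\<in>Sym 1. v = B 1 t"
      using tpow_mem[of 1 v] by (auto simp: tpow_1 B intro!: bexI[of _ "Pure [v]"])
  qed simp
  then show ?thesis
    using assms by (simp add: unital_def fseries1_def)
qed

text \<open>In \<open>L(B(v)) = v\<close> the coefficient of degree \<open>n\<close> contains \<open>L\<^sub>n\<close> only in the term
  \<open>L\<^sub>n (B\<^sub>1 v)\<^sup>\<otimes>\<^sup>n = L\<^sub>n v\<^sup>\<otimes>\<^sup>n\<close>, which determines \<open>L\<^sub>n\<close> from the coefficients of lower degree.\<close>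

fun left_inverse :: "(nat \<Rightarrow> ('f, 'v) tensor \<Rightarrow> 'v) \<Rightarrow> nat \<Rightarrow> ('f, 'v) tensor \<Rightarrow> 'v" where
  "left_inverse B n = op_of_powers sV sV n (\<lambda>v. (if n = 1 then v else 0) +
     sV (- 1) (\<Sum>m = 1..<n. left_inverse B m (compositions B v m n)))"

declare left_inverse.simps [simp del]

lemma hpoly_left_inverse:
  assumes "B \<in> fseries sV sV" "\<And>m. m < n \<Longrightarrow> left_inverse B m \<in> Lin m sV"
  shows "hpoly sV n (\<lambda>v. (if n = 1 then v else 0) +
     sV (- 1) (\<Sum>m = 1..<n. left_inverse B m (compositions B v m n)))"
proof (intro hpoly_add hpoly_scale hpoly_sum vector_space_axioms)
  show "hpoly sV n (\<lambda>v. if n = 1 then v else 0)"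
    by (cases "n = 1") (simp_all add: hpoly_id hpoly_zero vector_space_axioms)
next
  fix m assume "m \<in> {1..<n}"
  then show "hpoly sV n (\<lambda>v. left_inverse B m (compositions B v m n))"
    by (intro hpoly_ser_comp_summand vector_space_axioms assms) simp
qed

lemma left_inverse_lin_maps:
  assumes "B \<in> fseries sV sV"
  shows "left_inverse B n \<in> Lin n sV"
proof (induction n rule: less_induct)
  case (less n)
  show ?case
    unfolding left_inverse.simps[of B n]
    by (intro op_of_powers(1) hpoly_left_inverse assms less.IH)
qed

lemma left_inverse_tpow:
  assumes "B \<in> fseries sV sV"
  shows "left_inverse B n (Tpow n v) = (if n = 1 then v else 0) +
     sV (- 1) (\<Sum>m = 1..<n. left_inverse B m (compositions B v m n))"
  using op_of_powers(2)[OF hpoly_left_inverse[OF assms left_inverse_lin_maps[OF assms]], of n v]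
  unfolding left_inverse.simps[of B n, symmetric] .

lemma sum_list_eq_length: "(\<forall>i\<in>set is. 1 \<le> i) \<and> length is = n \<and> sum_list is = n \<longleftrightarrow> is = replicate n 1"
  for "is" :: "nat list"
proof (induction "is" arbitrary: n)
  case (Cons i "is")
  show ?case
    using Cons.IH[of "n - 1"] length_le_sum_list[of "is"] by (cases n) auto
qed auto

lemma left_inverse:
  assumes B: "unital B"
  shows "unital (left_inverse B)" and "ser_comp sV sV (left_inverse B) B = ser_id sV"
proof -
  have fB: "B \<in> fseries sV sV"
    using B by (simp add: unital_def)
  have L: "left_inverse B \<in> fseries sV sV"
    by (intro fseriesI left_inverse_lin_maps fB)
  have "left_inverse B 0 = (\<lambda>_. 0)"
    by (rule lin_maps_eqI[OF left_inverse_lin_maps[OF fB], of _ _ UNIV])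
      (auto simp: left_inverse_tpow[OF fB] lin_maps_def)
  then show "unital (left_inverse B)"
    using L left_inverse_tpow[OF fB, of 1] by (simp add: unital_def fun_eq_iff)
  show "ser_comp sV sV (left_inverse B) B = ser_id sV"
  proof (rule fseries_eqI[OF ser_comp_fseries[OF vector_space_axioms L fB] ser_id_fseries])
    fix n v
    let ?c = "\<lambda>m. compositions B v m n"
    show "ser_comp sV sV (left_inverse B) B n (Tpow n v) = ser_id sV n (Tpow n v)"
    proof (cases "n = 0")
      case True
      then show ?thesis
        by (simp add: ser_comp_def ser_id_tpow left_inverse_tpow[OF fB, of 0, simplified])
    next
      case False
      then have "{1..n} = insert n {1..<n}"
        by auto
      then have "ser_comp sV sV (left_inverse B) B n (Tpow n v)
          = left_inverse B n (?c n) + (\<Sum>m = 1..<n. left_inverse B m (?c m))"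
        by (simp add: ser_comp_tpow'[OF vector_space_axioms L fB False])
      moreover have "{is. length is = n \<and> (\<forall>i\<in>set is. 1 \<le> i) \<and> sum_list is = n} = {replicate n 1}"
        using sum_list_eq_length[of _ n] by blast
      then have "?c n = Tpow n v"
        using B by (simp add: unital_def tpow_eq_sym_tensor)
      ultimately show ?thesis
        by (simp add: left_inverse_tpow[OF fB, of n] ser_id_tpow)
    qed
  qed
qed

lemma ser_inverse:
  assumes B: "unital B"
  defines "L \<equiv> ser_inverse sV B"
  shows "unital L" "ser_comp sV sV L B = ser_id sV" "ser_comp sV sV B L = ser_id sV"
proof -
  define L' where "L' = left_inverse B"
  have L': "unital L'" "ser_comp sV sV L' B = ser_id sV"
    unfolding L'_def by (rule left_inverse[OF B])+
  note M = left_inverse[OF L'(1)]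
  \<comment> \<open>\<open>B\<close> is a right inverse of \<open>L'\<close>, so it is equal to the left inverse of \<open>L'\<close>.\<close>
  have "left_inverse L' = B"
    by (rule ser_inverses_eq[of _ L'])
      (use B L' M in \<open>simp_all add: unital_def\<close>)
  then have inv: "ser_comp sV sV B L' = ser_id sV"
    using M by simp
  have "L = L'"
    unfolding L_def ser_inverse_def
  proof (rule the_equality)
    show "L' \<in> fseries1 sV \<and> ser_comp sV sV L' B = ser_id sV \<and> ser_comp sV sV B L' = ser_id sV"
      using L' inv unital_fseries1 by blast
    fix X assume "X \<in> fseries1 sV \<and> ser_comp sV sV X B = ser_id sV \<and> ser_comp sV sV B X = ser_id sV"
    then show "X = L'"
      using B L'(1) inv by (intro ser_inverses_eq[of X B]) (auto simp: unital_def fseries1_def)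
  qed
  then show "unital L" "ser_comp sV sV L B = ser_id sV" "ser_comp sV sV B L = ser_id sV"
    using L' inv by simp_all
qed

end

section \<open>Derivatives of series\<close>

context tensor_space
begin

lemma sym_prod_pure: "Pure us \<odot> Pure vs = Symt (us @ vs)"
  by (simp add: sym_prod_def tensor_prod_pure symmetrize_pure)

lemma tpow_sym_prod: "Tpow n v \<odot> Pure [x] = Symt (x # replicate n v)"
  unfolding tpow_def sym_prod_pure by (rule sym_tensor_mset) simp

lemma sym_prod_add_left: "(s + t) \<odot> u = s \<odot> u + t \<odot> u" for s t u :: "('f, 'v) tensor"
proof -
  have "tensor_prod (s + t) u = tensor_prod s u + tensor_prod t u"
    by (simp add: tensor_prod_def fun_eq_iff algebra_simps sum.distrib)
  then show ?thesis
    by (simp only: sym_prod_def symmetrize_add)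
qed

lemma sym_prod_scale_left: "tscale c t \<odot> u = tscale c (t \<odot> u)" for t u :: "('f, 'v) tensor"
proof -
  have "tensor_prod (tscale c t) u = tscale c (tensor_prod t u)"
    by (simp add: tensor_prod_def fun_eq_iff algebra_simps sum_distrib_left)
  then show ?thesis
    by (simp only: sym_prod_def symmetrize_scale)
qed

lemma sym_prod_zero_left: "0 \<odot> u = 0" for u :: "('f, 'v) tensor"
  by (simp add: sym_prod_def tensor_prod_def symmetrize_def fun_eq_iff)

lemma sym_prod_mem:
  assumes "t \<in> Sym n"
  shows "t \<odot> Pure [x] \<in> Sym (Suc n)"
  using assms
proof (induction rule: sym_power_induct)
  case zero
  then show ?case
    by (simp only: sym_prod_zero_left sym_zero)
next
  case (step c v s)
  have "Tpow n v \<odot> Pure [x] \<in> Sym (Suc n)"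
    by (simp add: tpow_sym_prod sym_tensor_mem')
  with step show ?case
    by (simp only: sym_prod_add_left sym_prod_scale_left sym_add sym_scale)
qed

lemma ser_deriv_fseries:
  assumes "vector_space sW" "A \<in> fseries sV sW"
  shows "ser_deriv sV sW A \<zeta> \<in> fseries sV sW"
proof -
  interpret W: vector_space sW by fact
  note A = fseries_coeff[OF assms(2)]
  show ?thesis
    by (auto intro!: fseriesI simp: lin_maps_def ser_deriv_def sym_add sym_scale sym_prod_add_left
        sym_prod_scale_left lin_maps_add[OF A] lin_maps_scale[OF A] sym_prod_mem W.scale_right_distrib
        mult.commute simp del: fun_apply of_nat_Suc)
qed

lemma ser_deriv_tpow:
  "ser_deriv sV sW A \<zeta> n (Tpow n v) = sW (of_nat (Suc n)) (A (Suc n) (Symt (\<zeta> # replicate n v)))"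
  by (simp add: ser_deriv_def tpow_mem tpow_sym_prod del: of_nat_Suc)

text \<open>The derivative of \<open>ev (Suc N) A\<close> at \<open>x\<close> in direction \<open>y\<close>.\<close>

definition evd ::
  "('f \<Rightarrow> 'w::ab_group_add \<Rightarrow> 'w) \<Rightarrow> nat \<Rightarrow> (nat \<Rightarrow> ('f, 'v) tensor \<Rightarrow> 'w) \<Rightarrow> 'v \<Rightarrow> 'v \<Rightarrow> 'w" where
  "evd sW N A x y = (\<Sum>m<N. sW (of_nat (Suc m)) (A (Suc m) (Symt (y # replicate m x))))"

lemma evd_eq_ev: "evd sW N A x \<zeta> = ev N (ser_deriv sV sW A \<zeta>) x"
  by (simp add: evd_def ev_def ser_deriv_tpow del: of_nat_Suc)

lemma ev_taylor:
  assumes "vector_space sW" "A \<in> fseries sV sW" "x \<in> curves sV 0" "y \<in> curves sV 0"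
  shows "(\<lambda>t. ev (Suc N) A (x t + sV (t ^ K) (y t)) - (ev (Suc N) A (x t) + sW (t ^ K) (evd sW N A (x t) (y t))))
    \<in> curves sW (2 * K)"
proof -
  interpret W: vector_space sW by fact
  have "(\<lambda>t. \<Sum>n<Suc N. A n (Tpow n (x t + sV (t ^ K) (y t))) - (A n (Tpow n (x t))
       + sW (of_nat n * t ^ K) (A n (Symt (y t # replicate (n - 1) (x t)))))) \<in> curves sW (2 * K)"
    by (intro W.curves_sum taylor[OF assms(1) fseries_coeff[OF assms(2)] assms(3,4)])
  moreover have "sW (t ^ K) (evd sW N A (x t) (y t))
      = (\<Sum>n<Suc N. sW (of_nat n * t ^ K) (A n (Symt (y t # replicate (n - 1) (x t)))))" for t
    by (simp only: sum.lessThan_Suc_shift evd_def W.scale_sum_right W.scale_scale of_nat_0 mult_zero_left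
        W.scale_zero_left add_0 comp_def diff_Suc_1 mult.commute)
  ultimately show ?thesis
    by (simp only: ev_def sum_subtractf sum.distrib)
qed

lemma evd_diff:
  assumes "vector_space sW" "A \<in> fseries sV sW"
    and "x \<in> curves sV 0" "x' \<in> curves sV 0" "(\<lambda>t. x t - x' t) \<in> curves sV K"
    and "y \<in> curves sV 0" "y' \<in> curves sV 0" "(\<lambda>t. y t - y' t) \<in> curves sV K"
  shows "(\<lambda>t. evd sW N A (x t) (y t) - evd sW N A (x' t) (y' t)) \<in> curves sW K"
proof -
  interpret W: vector_space sW by fact
  have "(\<lambda>t. A (Suc m) (Symt (y t # replicate m (x t))) - A (Suc m) (Symt (y' t # replicate m (x' t))))
      \<in> curves sW K" for m
  proof -
    have "list_all2 (\<lambda>f g. f \<in> curves sV 0 \<and> g \<in> curves sV 0 \<and> (\<lambda>t. f t - g t) \<in> curves sV K)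
        (y # replicate m x) (y' # replicate m x')"
      using assms(3-8) by (simp add: list_all2_conv_all_nth[of _ "replicate m x"])
    from curves_sym_tensor_diff[OF assms(1) fseries_coeff[OF assms(2)] this, of "[]"] show ?thesis
      by simp
  qed
  then show ?thesis
    unfolding evd_def sum_subtractf[symmetric] W.scale_right_diff_distrib[symmetric]
    by (intro W.curves_sum W.curves_scale)
qed

lemma evd_curves:
  assumes "vector_space sW" "A \<in> fseries sV sW" "x \<in> curves sV 0"
  shows "(\<lambda>t. evd sW N A (x t) \<zeta>) \<in> curves sW 0"
  unfolding evd_eq_ev by (intro ev_curves ser_deriv_fseries assms)

text \<open>The coefficients of \<open>A'(v; C(v))\<close> are read off along the line \<open>v = t w\<close>: the terms of
  \<open>evd sV N A (t w) (ev N C (t w))\<close> that the sum over \<open>i < K\<close> omits contain a power of \<open>t\<close> of exponent at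
  least \<open>K\<close>.\<close>

lemma evd_line:
  assumes "A \<in> fseries sV sV" "C \<in> fseries sV sV" "K \<le> N"
  shows "(\<lambda>t. (\<Sum>i<K. sV (t ^ i) (\<Sum>m\<le>i. sV (of_nat (Suc m)) (A (Suc m)
            (Symt (C (i - m) (Tpow (i - m) w) # replicate m w)))))
          - evd sV N A (sV t w) (ev N C (sV t w))) \<in> curves sV K"
proof -
  let ?g = "\<lambda>m j. sV (of_nat (Suc m)) (A (Suc m) (Symt (C j (Tpow j w) # replicate m w)))"
  note A = fseries_coeff[OF assms(1)]
  have summand: "A (Suc m) (Symt (ev N C (sV t w) # replicate m (sV t w)))
      = (\<Sum>j<N. sV (t ^ (m + j)) (A (Suc m) (Symt (C j (Tpow j w) # replicate m w))))" for m t
  proof -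
    have *: "A (Suc m) (Symt ((\<Sum>j\<in>J. sV (t ^ j) (C j (Tpow j w))) # replicate m (sV t w)))
      = (\<Sum>j\<in>J. sV (t ^ (m + j)) (A (Suc m) (Symt (C j (Tpow j w) # replicate m w))))" if "finite J" for J
      using that
    proof (induction J)
      case empty
      show ?case
        using lin_sym_tensor_scale[OF A, of "[]" "replicate m (sV t w)" "Suc m" 0 0] by simp
    next
      case (insert j J)
      have "Symt (x # replicate m (sV t w)) = tscale (t ^ m) (Symt (x # replicate m w))" for x
        using sym_tensor_scale_replicate[of "[x]"] by simp
      then have "A (Suc m) (Symt (x # replicate m (sV t w))) = sV (t ^ m) (A (Suc m) (Symt (x # replicate m w)))" for x
        by (simp only: lin_maps_scale[OF A] sym_tensor_mem' length_Cons length_replicate)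
      then have "A (Suc m) (Symt (sV (t ^ j) (C j (Tpow j w)) # replicate m (sV t w)))
          = sV (t ^ (m + j)) (A (Suc m) (Symt (C j (Tpow j w) # replicate m w)))"
        using lin_sym_tensor_scale[OF A, of "[]" "replicate m (sV t w)" "Suc m"]
        by (simp add: power_add mult.commute)
      then show ?case
        using insert lin_sym_tensor_add[OF A, of "[]" "replicate m (sV t w)" "Suc m"] by simp
    qed
    show ?thesis
      using *[of "{..<N}"] by (simp add: ev_scale[OF assms(2)])
  qed
  let ?S = "{..<N} \<times> {..<N}" and ?T = "{(m, j). m + j < K}"
  have evd: "evd sV N A (sV t w) (ev N C (sV t w)) = (\<Sum>(m, j)\<in>?S. sV (t ^ (m + j)) (?g m j))" for t
    unfolding evd_def summand
    by (simp add: sum.cartesian_product[symmetric] scale_sum_right mult.commute del: of_nat_Suc)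
  have sub: "?T \<subseteq> ?S"
    using assms(3) by auto
  have low: "(\<Sum>i<K. sV (t ^ i) (\<Sum>m\<le>i. ?g m (i - m))) = (\<Sum>(m, j)\<in>?T. sV (t ^ (m + j)) (?g m j))" for t
  proof -
    have "(\<Sum>i<K. sV (t ^ i) (\<Sum>m\<le>i. ?g m (i - m)))
        = (\<Sum>(i, m)\<in>(SIGMA i:{..<K}. {..i}). sV (t ^ i) (?g m (i - m)))"
      by (simp add: scale_sum_right sum.Sigma del: of_nat_Suc)
    also have "\<dots> = (\<Sum>(m, j)\<in>?T. sV (t ^ (m + j)) (?g m j))"
      by (rule sum.reindex_bij_witness[of _ "\<lambda>(m, j). (m + j, m)" "\<lambda>(i, m). (m, i - m)"]) auto
    finally show ?thesis .
  qed
  have "(\<lambda>t. - (\<Sum>(m, j)\<in>?S - ?T. sV (t ^ (m + j)) (?g m j))) \<in> curves sV K"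
  proof (intro curves_uminus curves_sum)
    fix p assume p: "p \<in> ?S - ?T"
    obtain m j where "p = (m, j)"
      by (cases p)
    then show "(\<lambda>t. case p of (m, j) \<Rightarrow> sV (t ^ (m + j)) (?g m j)) \<in> curves sV K"
      using p curves_mono[OF curves_monom[of "m + j" "?g m j"], of K] by simp
  qed
  then show ?thesis
    by (rule curves_cong)
      (simp only: low evd sum_diff[OF finite_cartesian_product[OF finite_lessThan finite_lessThan] sub] minus_diff_eq)
qed

text \<open>The derivative of the identity \<open>B(L(v)) = v\<close> in direction \<open>\<zeta>\<close>, at \<open>B(v)\<close>. A derivative is the
  coefficient of a small parameter. Along the curve \<open>t \<mapsto> t w\<close> the parameter can be \<open>t\<^sup>K\<close> for a large
  \<open>K\<close>: the Taylor formula then holds up to order \<open>2 K\<close>, and after division by \<open>t\<^sup>K\<close> the derivatives agree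
  up to order \<open>K\<close>. So one variable is enough.\<close>

lemma deriv_along_inverse:
  fixes \<zeta> w :: 'v
  assumes B: "B \<in> fseries sV sV" "B 0 = 0" and L: "L \<in> fseries sV sV" "L 0 = 0"
    and LB: "ser_comp sV sV L B = ser_id sV" and BL: "ser_comp sV sV B L = ser_id sV"
  defines "\<Psi> \<equiv> ser_comp sV sV (ser_deriv sV sV L \<zeta>) B"
  shows "(\<Sum>m\<le>n. sV (of_nat (Suc m)) (B (Suc m) (Symt (\<Psi> (n - m) (Tpow (n - m) w) # replicate m w))))
    = (if n = 0 then \<zeta> else 0)"
proof -
  define K N where "K = Suc n" and "N = 2 * K"
  let ?c = "\<lambda>i. \<Sum>m\<le>i. sV (of_nat (Suc m)) (B (Suc m) (Symt (\<Psi> (i - m) (Tpow (i - m) w) # replicate m w)))"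
  have KN: "K \<le> N" "2 * K \<le> Suc N" "2 \<le> Suc N" "1 \<le> K"
    by (simp_all add: K_def N_def)
  note vs = vector_space_axioms
  note D = ser_deriv_fseries[OF vs L(1), of \<zeta>]
  have \<Psi>: "\<Psi> \<in> fseries sV sV"
    unfolding \<Psi>_def by (intro ser_comp_fseries vs D B)
  define x where "x = (\<lambda>t. sV t w)"
  define b where "b = (\<lambda>t. ev (Suc N) B (x t))"
  define u where "u = (\<lambda>t. b t + sV (t ^ K) \<zeta>)"
  define l where "l = (\<lambda>t. ev (Suc N) L (b t))"
  define y where "y = (\<lambda>t. evd sV N L (b t) \<zeta>)"
  have x: "x \<in> curves sV 1"
    unfolding x_def by (rule line_curve)
  have b: "b \<in> curves sV 1"
    unfolding b_def by (intro ev_curves_1 vs B x)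
  have u: "u \<in> curves sV 1"
    unfolding u_def using KN by (intro curves_add b) (auto intro: curves_mono[OF curves_monom])
  have l: "l \<in> curves sV 1"
    unfolding l_def by (intro ev_curves_1 vs L b)
  have b0: "b \<in> curves sV 0" and x0: "x \<in> curves sV 0" and u0: "u \<in> curves sV 0" and l0: "l \<in> curves sV 0"
    using b x u l by (auto elim: curves_mono)
  have y0: "y \<in> curves sV 0"
    unfolding y_def by (intro evd_curves vs L b0)
  have ly: "(\<lambda>t. l t + sV (t ^ K) (y t)) \<in> curves sV 0"
    using curves_shift[OF y0, of 1 K] by (intro curves_add l0) (auto elim: curves_mono)
  \<comment> \<open>The two sides of \<open>B(L(u)) = u\<close> for \<open>u = b + t\<^sup>K \<zeta>\<close>, expanded to first order in \<open>t\<^sup>K\<close>.\<close>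
  have e1: "(\<lambda>t. u t - ev (Suc N) B (ev (Suc N) L (u t))) \<in> curves sV (2 * K)"
    by (rule curves_mono[OF ev_ser_comp_id KN(2)]) (use B L BL u KN in auto)
  have "(\<lambda>t. ev (Suc N) L (u t) - (l t + sV (t ^ K) (y t))) \<in> curves sV (2 * K)"
    unfolding u_def l_def y_def by (intro ev_taylor vs L b0 curves_const)
  then have e2: "(\<lambda>t. ev (Suc N) B (ev (Suc N) L (u t)) - ev (Suc N) B (l t + sV (t ^ K) (y t))) \<in> curves sV (2 * K)"
    by (intro ev_diff vs B ev_curves L u0 ly)
  have e3: "(\<lambda>t. ev (Suc N) B (l t + sV (t ^ K) (y t))
      - (ev (Suc N) B (l t) + sV (t ^ K) (evd sV N B (l t) (y t)))) \<in> curves sV (2 * K)"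
    by (intro ev_taylor vs B l0 y0)
  have e4: "(\<lambda>t. b t - ev (Suc N) B (l t)) \<in> curves sV (2 * K)"
    unfolding l_def by (rule curves_mono[OF ev_ser_comp_id KN(2)]) (use B L BL b KN in auto)
  have "(\<lambda>t. (u t - (ev (Suc N) B (l t) + sV (t ^ K) (evd sV N B (l t) (y t))))
      - (b t - ev (Suc N) B (l t))) \<in> curves sV (2 * K)"
    by (rule curves_diff[OF curves_diff_trans[OF curves_diff_trans[OF e1 e2] e3] e4])
  then have "(\<lambda>t. sV (t ^ K) (\<zeta> - evd sV N B (l t) (y t))) \<in> curves sV (K + K)"
    by (simp add: u_def algebra_simps mult_2_right)
  then have 1: "(\<lambda>t. \<zeta> - evd sV N B (l t) (y t)) \<in> curves sV K"
    by (rule curves_cancel)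
  have lx: "(\<lambda>t. l t - x t) \<in> curves sV K"
    unfolding l_def b_def
    by (rule curves_diff_sym, rule curves_mono[OF ev_ser_comp_id]) (use B L LB x KN in auto)
  have "(\<lambda>t. ev N \<Psi> (x t) - ev N (ser_deriv sV sV L \<zeta>) (ev N B (x t))) \<in> curves sV K"
    unfolding \<Psi>_def by (rule curves_mono[OF ev_ser_comp KN(1)]) (use vs D B x in auto)
  moreover have "(\<lambda>t. ev N B (x t) - b t) \<in> curves sV K"
  proof -
    have "(\<lambda>t. - B N (Tpow N (x t))) \<in> curves sV (N * 1)"
      by (intro curves_uminus curves_tpow vs fseries_coeff[OF B(1)] x)
    then have "(\<lambda>t. - B N (Tpow N (x t))) \<in> curves sV K"
      by (rule curves_mono) (simp add: KN)
    then show ?thesis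
      by (simp add: b_def ev_def)
  qed
  then have "(\<lambda>t. ev N (ser_deriv sV sV L \<zeta>) (ev N B (x t)) - y t) \<in> curves sV K"
    unfolding y_def evd_eq_ev by (intro ev_diff vs D ev_curves B x0 b0)
  ultimately have "(\<lambda>t. ev N \<Psi> (x t) - y t) \<in> curves sV K"
    by (rule curves_diff_trans)
  then have "(\<lambda>t. evd sV N B (l t) (y t) - evd sV N B (x t) (ev N \<Psi> (x t))) \<in> curves sV K"
    by (intro evd_diff[OF vs B(1) l0 x0 lx y0] ev_curves vs \<Psi> x0 curves_diff_sym[of "\<lambda>t. ev N \<Psi> (x t)" y])
  with 1 have 2: "(\<lambda>t. \<zeta> - evd sV N B (x t) (ev N \<Psi> (x t))) \<in> curves sV K"
    by (rule curves_diff_trans)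
  have 3: "(\<lambda>t. (\<Sum>i<K. sV (t ^ i) (?c i))
          - evd sV N B (x t) (ev N \<Psi> (x t))) \<in> curves sV K"
    unfolding x_def by (intro evd_line B \<Psi> KN)
  have 4: "(\<lambda>t. (\<Sum>i<K. sV (t ^ i) (?c i)) - \<zeta>) \<in> curves sV K"
    by (rule curves_diff_trans[OF 3 curves_diff_sym[OF 2]])
  have "(\<Sum>i<K. sV (t ^ i) (if i = 0 then \<zeta> else 0)) = \<zeta>" for t
    by (simp add: K_def sum.lessThan_Suc_shift del: sum.lessThan_Suc)
  with 4 have "(\<lambda>t. \<Sum>i<K. sV (t ^ i) ((?c i) - (if i = 0 then \<zeta> else 0)))
      \<in> curves sV K"
    by (simp only: scale_right_diff_distrib sum_subtractf)
  from curves_coeffs_0[OF this, of n] show ?thesis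
    by (simp add: K_def)
qed

end

section \<open>The exponential of a scalar series\<close>

lemma curves_mult:
  fixes f g :: "'f::field \<Rightarrow> 'f"
  assumes "f \<in> curves (*) M" "g \<in> curves (*) N"
  shows "(\<lambda>t. f t * g t) \<in> curves (*) (M + N)"
  using assms(1)
proof (induction rule: curves.induct)
  case (zero f)
  show ?case
    by (rule curves.zero) (simp add: zero)
next
  case (step h n f w)
  have "(\<lambda>t. w * t ^ n * g t) \<in> curves (*) (M + N)"
    using vector_space_over_itself.curves_shift[OF assms(2), of w n] by (rule curves_mono) (use step in simp)
  from vector_space_over_itself.curves_add[OF this step.IH] show ?case
    by (rule curves_cong) (simp add: step(3) algebra_simps)
qed

text \<open>The product rule for first-order expansions.\<close>

lemma first_order_mult:
  fixes f g :: "'f::field \<Rightarrow> 'f"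
  assumes "(\<lambda>t. f t - (a + t * b)) \<in> curves (*) 2" "(\<lambda>t. g t - (c + t * d)) \<in> curves (*) 2"
  shows "(\<lambda>t. f t * g t - (a * c + t * (b * c + a * d))) \<in> curves (*) 2"
proof -
  have lin: "(\<lambda>t. a + t * b) \<in> curves (*) 0" for a b :: 'f
    using vector_space_over_itself.curves_monom[of 1 b] by (intro vector_space_over_itself.curves_add vector_space_over_itself.curves_const) (auto elim: curves_mono)
  have "(\<lambda>t. (g t - (c + t * d)) + (c + t * d)) \<in> curves (*) 0"
    using assms(2) by (intro vector_space_over_itself.curves_add lin) (auto elim: curves_mono)
  then have "g \<in> curves (*) 0"
    by simp
  from curves_mult[OF assms(1) this]
  have "(\<lambda>t. (f t - (a + t * b)) * g t + (a + t * b) * (g t - (c + t * d)) + t ^ 2 * (b * d)) \<in> curves (*) 2"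
    using curves_mult[OF lin assms(2)] by (intro vector_space_over_itself.curves_add vector_space_over_itself.curves_monom)
      (simp_all add: numeral_2_eq_2)
  then show ?thesis
    by (rule curves_cong) (simp add: algebra_simps power2_eq_square)
qed

context tensor_space
begin

lemma ser_mult:
  assumes "A \<in> fseries sV (*)" "C \<in> fseries sV (*)"
  shows "ser_mult sV A C \<in> fseries sV (*)"
    and "ser_mult sV A C n (Tpow n v) = (\<Sum>k\<le>n. A k (Tpow k v) * C (n - k) (Tpow (n - k) v))"
proof -
  have h: "hpoly (*) n (\<lambda>v. \<Sum>k\<le>n. A k (Tpow k v) * C (n - k) (Tpow (n - k) v))" for n
  proof (rule hpoly_sum[OF vector_space_field])
    fix k assume "k \<in> {..n}"
    then show "hpoly (*) n (\<lambda>v. A k (Tpow k v) * C (n - k) (Tpow (n - k) v))"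
      using hpoly_mult[OF hpoly_lin_maps[OF fseries_coeff[OF assms(2)]]
          hpoly_lin_maps[OF fseries_coeff[OF assms(1)]], of "n - k" k]
      by simp
  qed
  show "ser_mult sV A C \<in> fseries sV (*)"
    "ser_mult sV A C n (Tpow n v) = (\<Sum>k\<le>n. A k (Tpow k v) * C (n - k) (Tpow (n - k) v))"
    unfolding ser_mult_def by (intro fseriesI op_of_powers h)+
qed

lemma ser_one: "ser_one sV \<in> fseries sV (*)"
    "ser_one sV n (Tpow n v) = (if n = 0 then 1 else 0)"
    "ser_one sV (Suc n) = (\<lambda>_. 0)"
proof -
  have h: "hpoly (*) n (\<lambda>v. if n = 0 then 1 else 0)" for n
    by (cases "n = 0") (simp_all add: hpoly_const hpoly_zero vector_space_field)
  show 1: "ser_one sV \<in> fseries sV (*)" and 2: "ser_one sV n (Tpow n v) = (if n = 0 then 1 else 0)" for n v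
    unfolding ser_one_def by (intro fseriesI op_of_powers h)+
  show "ser_one sV (Suc n) = (\<lambda>_. 0)"
    by (rule lin_maps_eqI[OF fseries_coeff[OF 1], of _ _ UNIV]) (auto simp: 2 lin_maps_def)
qed

lemma ser_power_fseries: "C \<in> fseries sV (*) \<Longrightarrow> ser_power sV C k \<in> fseries sV (*)"
  by (induction k) (simp_all add: ser_one ser_mult)

text \<open>For fixed \<open>v\<close> and \<open>\<xi>\<close>, a scalar series gives the ordinary power series of \<open>A(t v)\<close>, and of its
  derivative in direction \<open>\<xi>\<close>.\<close>

definition fps_at :: "'v \<Rightarrow> (nat \<Rightarrow> ('f, 'v) tensor \<Rightarrow> 'f) \<Rightarrow> 'f fps" where
  "fps_at v A = Abs_fps (\<lambda>n. A n (Tpow n v))"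

definition fps_deriv_at :: "'v \<Rightarrow> 'v \<Rightarrow> (nat \<Rightarrow> ('f, 'v) tensor \<Rightarrow> 'f) \<Rightarrow> 'f fps" where
  "fps_deriv_at v \<xi> A = Abs_fps (\<lambda>m. of_nat (Suc m) * A (Suc m) (Symt (\<xi> # replicate m v)))"

lemma fps_at_mult:
  "A \<in> fseries sV (*) \<Longrightarrow> C \<in> fseries sV (*) \<Longrightarrow> fps_at v (ser_mult sV A C) = fps_at v A * fps_at v C"
  by (simp add: fps_eq_iff fps_at_def ser_mult fps_mult_nth atMost_atLeast0)

lemma fps_at_power: "C \<in> fseries sV (*) \<Longrightarrow> fps_at v (ser_power sV C k) = fps_at v C ^ k"
proof (induction k)
  case 0
  show ?case
    by (simp add: fps_eq_iff fps_at_def ser_one)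
qed (simp add: fps_at_mult ser_power_fseries)

text \<open>The Leibniz rule is read off from the coefficient of \<open>t\<close> along the curve \<open>t \<mapsto> v + t \<xi>\<close>.\<close>

lemma fps_deriv_at_mult:
  assumes A: "A \<in> fseries sV (*)" and C: "C \<in> fseries sV (*)"
  shows "fps_deriv_at v \<xi> (ser_mult sV A C) = fps_deriv_at v \<xi> A * fps_at v C + fps_at v A * fps_deriv_at v \<xi> C"
proof (rule fps_ext)
  fix m
  interpret F: tensor_space "(*) :: 'f \<Rightarrow> 'f \<Rightarrow> 'f"
    by (simp add: tensor_space_def vector_space_field)
  let ?d = "\<lambda>A n. of_nat n * A n (Symt (\<xi> # replicate (n - 1) v))"
  let ?p = "\<lambda>A n. A n (Tpow n v)"
  let ?n = "Suc m"
  have first: "(\<lambda>t. A n (Tpow n (v + sV t \<xi>)) - (?p A n + t * ?d A n)) \<in> curves (*) 2"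
    if "A \<in> fseries sV (*)" for A n
    using taylor[OF vector_space_field fseries_coeff[OF that] curves_const curves_const, of n v 1 \<xi>]
    by (simp add: mult_ac)
  have "(\<lambda>t. \<Sum>k\<le>?n. A k (Tpow k (v + sV t \<xi>)) * C (?n - k) (Tpow (?n - k) (v + sV t \<xi>))
      - (?p A k * ?p C (?n - k) + t * (?d A k * ?p C (?n - k) + ?p A k * ?d C (?n - k)))) \<in> curves (*) 2"
    by (intro vector_space_over_itself.curves_sum first_order_mult first A C)
  then have "(\<lambda>t. ser_mult sV A C ?n (Tpow ?n (v + sV t \<xi>)) - (?p (ser_mult sV A C) ?n
      + t * (\<Sum>k\<le>?n. ?d A k * ?p C (?n - k) + ?p A k * ?d C (?n - k)))) \<in> curves (*) 2"
    by (simp only: ser_mult[OF A C] sum_subtractf sum.distrib[of "\<lambda>k. ?p A k * _ k"] sum_distrib_left)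
  from vector_space_over_itself.curves_diff[OF this first[OF ser_mult(1)[OF A C], of ?n]]
  have "(\<lambda>t. t ^ 1 * (?d (ser_mult sV A C) ?n
      - (\<Sum>k\<le>?n. ?d A k * ?p C (?n - k) + ?p A k * ?d C (?n - k)))) \<in> curves (*) (1 + 1)"
    by (simp add: algebra_simps numeral_2_eq_2)
  from F.curves_const_0[OF vector_space_over_itself.curves_cancel[OF this]]
  have "?d (ser_mult sV A C) ?n = (\<Sum>k\<le>?n. ?d A k * ?p C (?n - k)) + (\<Sum>k\<le>?n. ?p A k * ?d C (?n - k))"
    by (simp only: right_minus_eq sum.distrib)
  moreover have "(\<Sum>k\<le>?n. ?d A k * ?p C (?n - k)) = (\<Sum>k\<le>m. ?d A (Suc k) * ?p C (m - k))"
    by (subst sum.atMost_Suc_shift) simp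
  moreover have "(\<Sum>k\<le>?n. ?p A k * ?d C (?n - k)) = (\<Sum>k\<le>m. ?p A k * ?d C (Suc (m - k)))"
    by (simp add: Suc_diff_le algebra_simps)
  ultimately show "fps_nth (fps_deriv_at v \<xi> (ser_mult sV A C)) m
      = fps_nth (fps_deriv_at v \<xi> A * fps_at v C + fps_at v A * fps_deriv_at v \<xi> C) m"
    by (simp add: fps_deriv_at_def fps_at_def fps_mult_nth atMost_atLeast0)
qed

lemma fps_deriv_at_power:
  assumes C: "C \<in> fseries sV (*)"
  shows "fps_deriv_at v \<xi> (ser_power sV C k) = of_nat k * fps_at v C ^ (k - 1) * fps_deriv_at v \<xi> C"
proof (induction k)
  case 0
  show ?case
    by (simp add: fps_eq_iff fps_deriv_at_def ser_one)
next
  case (Suc k)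
  have "fps_deriv_at v \<xi> (ser_power sV C (Suc k)) = fps_deriv_at v \<xi> C * fps_at v C ^ k
      + fps_at v C * (of_nat k * fps_at v C ^ (k - 1) * fps_deriv_at v \<xi> C)"
    by (simp only: ser_power.simps fps_deriv_at_mult[OF C ser_power_fseries[OF C]] fps_at_power[OF C] Suc.IH)
  then show ?case
    by (cases k) (simp_all add: algebra_simps)
qed

text \<open>The derivative of \<open>C\<^sup>k / k!\<close> is \<open>C\<^sup>k\<^sup>-\<^sup>1 / (k - 1)!\<close> times that of \<open>C\<close>. Each coefficient of the
  exponential is a sum over finitely many \<open>k\<close>, whose range depends on the degree. As \<open>C\<^sup>k\<close> starts in
  degree \<open>k\<close>, these ranges can be extended to a common one.\<close>

lemma fps_deriv_at_exp:
  assumes C: "C \<in> fseries sV (*)" and "C 0 = (\<lambda>_. 0)"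
  shows "fps_deriv_at v \<xi> (ser_exp sV C) = fps_at v (ser_exp sV C) * fps_deriv_at v \<xi> C"
proof (rule fps_ext)
  fix m
  let ?c = "fps_at v C" and ?d = "fps_deriv_at v \<xi> C"
  have "fps_nth ?c 0 = 0"
    by (simp add: fps_at_def assms(2))
  note c = startsby_zero_power_prefix[OF this]
  have "fps_nth (fps_deriv_at v \<xi> (ser_exp sV C)) m
      = (\<Sum>k\<le>Suc m. 1 / fact k * fps_nth (fps_deriv_at v \<xi> (ser_power sV C k)) m)"
    by (simp add: fps_deriv_at_def ser_exp_def sum_distrib_left mult_ac del: sum.atMost_Suc of_nat_Suc)
  also have "\<dots> = (\<Sum>k\<le>Suc m. 1 / fact k * fps_nth (of_nat k * ?c ^ (k - 1) * ?d) m)"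
    by (simp only: fps_deriv_at_power[OF C])
  also have "\<dots> = (\<Sum>k\<le>m. 1 / fact (Suc k) * fps_nth (of_nat (Suc k) * ?c ^ k * ?d) m)"
    by (subst sum.atMost_Suc_shift) (simp del: of_nat_Suc)
  also have "\<dots> = (\<Sum>k\<le>m. 1 / fact k * fps_nth (?c ^ k * ?d) m)"
  proof (rule sum.cong[OF refl])
    fix k
    have "fps_nth (of_nat (Suc k) * ?c ^ k * ?d) m = of_nat (Suc k) * fps_nth (?c ^ k * ?d) m"
      unfolding fps_of_nat[symmetric] mult.assoc by (rule fps_mult_left_const_nth)
    then show "1 / fact (Suc k) * fps_nth (of_nat (Suc k) * ?c ^ k * ?d) m = 1 / fact k * fps_nth (?c ^ k * ?d) m"
      by (simp del: of_nat_Suc)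
  qed
  also have "\<dots> = (\<Sum>i\<le>m. (\<Sum>k\<le>m. 1 / fact k * fps_nth (?c ^ k) i) * fps_nth ?d (m - i))"
    by (subst sum_distrib_right, subst sum.swap)
      (simp add: fps_mult_nth atMost_atLeast0 sum_distrib_left mult.assoc)
  also have "\<dots> = (\<Sum>i\<le>m. fps_nth (fps_at v (ser_exp sV C)) i * fps_nth ?d (m - i))"
  proof (rule sum.cong[OF refl])
    fix i assume "i \<in> {..m}"
    have p: "ser_power sV C k i (Tpow i v) = fps_nth (?c ^ k) i" for k
      by (simp add: fps_at_power[OF C, symmetric]) (simp add: fps_at_def)
    have "(\<Sum>k\<le>m. 1 / fact k * fps_nth (?c ^ k) i) = (\<Sum>k\<le>i. 1 / fact k * fps_nth (?c ^ k) i)"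
      using \<open>i \<in> {..m}\<close> c by (intro sum.mono_neutral_right) auto
    then show "(\<Sum>k\<le>m. 1 / fact k * fps_nth (?c ^ k) i) * fps_nth ?d (m - i)
        = fps_nth (fps_at v (ser_exp sV C)) i * fps_nth ?d (m - i)"
      by (simp add: fps_at_def[of v "ser_exp sV C"] ser_exp_def p)
  qed
  finally show "fps_nth (fps_deriv_at v \<xi> (ser_exp sV C)) m = fps_nth (fps_at v (ser_exp sV C) * ?d) m"
    by (simp add: fps_mult_nth atMost_atLeast0)
qed

lemma ser_deriv_dir:
  assumes A: "A \<in> fseries sV (*)" and C: "C \<in> fseries sV sV"
  shows "ser_deriv_dir sV (*) A C \<in> fseries sV (*)"
    and "ser_deriv_dir sV (*) A C n (Tpow n v)
      = (\<Sum>m\<le>n. of_nat (Suc m) * A (Suc m) (Symt (C (n - m) (Tpow (n - m) v) # replicate m v)))"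
proof -
  have h: "hpoly (*) n (\<lambda>v. \<Sum>m\<le>n. of_nat (Suc m) *
      A (Suc m) (Symt (C (n - m) (Tpow (n - m) v) # replicate m v)))" for n
  proof (intro hpoly_sum hpoly_scale vector_space_field)
    fix m assume "m \<in> {..n}"
    then have "hpoly tscale n (\<lambda>v. Symt (C (n - m) (Tpow (n - m) v) # replicate m v))"
      using hpoly_sym_tensor[of "(\<lambda>v. C (n - m) (Tpow (n - m) v), n - m) # replicate m (\<lambda>v. v, Suc 0)"]
        hpoly_lin_maps[OF fseries_coeff[OF C]] hpoly_id
      by (auto simp: sum_list_replicate)
    then show "hpoly (*) n (\<lambda>v. A (Suc m) (Symt (C (n - m) (Tpow (n - m) v) # replicate m v)))"
      by (rule hpoly_lin[where m = "Suc m"]) (simp_all add: sym_tensor_mem' fseries_coeff[OF A])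
  qed
  have eq: "ser_deriv_dir sV (*) A C n = op_of_powers sV (*) n (\<lambda>v. \<Sum>m\<le>n. of_nat (Suc m) *
      A (Suc m) (Symt (C (n - m) (Tpow (n - m) v) # replicate m v)))" for n
    by (simp add: ser_deriv_dir_def tpow_sym_prod del: of_nat_Suc)
  show "ser_deriv_dir sV (*) A C \<in> fseries sV (*)"
    by (rule fseriesI) (simp only: eq op_of_powers(1)[OF h])
  show "ser_deriv_dir sV (*) A C n (Tpow n v)
      = (\<Sum>m\<le>n. of_nat (Suc m) * A (Suc m) (Symt (C (n - m) (Tpow (n - m) v) # replicate m v)))"
    by (simp only: eq op_of_powers(2)[OF h])
qed

end


section \<open>Multiplication by \<open>\<langle>\<omega>, \<zeta>\<rangle>\<close> on the generating function\<close>

lemma falling_fact: "m \<le> n \<Longrightarrow> of_nat (falling n (n - m)) = (fact n / fact m :: 'f::field_char_0)"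
proof (induction "n - m" arbitrary: m)
  case 0
  then show ?case
    by (simp add: falling_def)
next
  case (Suc d)
  then have "of_nat (falling n (n - Suc m)) = (fact n / fact (Suc m) :: 'f)"
    by (intro Suc.hyps(1)) auto
  moreover have "n - m = Suc (n - Suc m)" and "n - (n - Suc m) = Suc m"
    using Suc.hyps(2) Suc.prems by auto
  then have "falling n (n - m) = falling n (n - Suc m) * Suc m"
    by (simp add: falling_def)
  ultimately show ?case
    by (simp only: of_nat_mult) (simp del: of_nat_Suc)
qed

locale sheffer = tensor_space sV
  for sV :: "'f::field_char_0 \<Rightarrow> 'v::ab_group_add \<Rightarrow> 'v" +
  fixes S :: "nat \<Rightarrow> ('v \<Rightarrow> 'f) \<Rightarrow> ('f, 'v) tensor \<Rightarrow> 'f"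
    and B :: "nat \<Rightarrow> ('f, 'v) tensor \<Rightarrow> 'v" and \<alpha> :: "nat \<Rightarrow> ('f, 'v) tensor \<Rightarrow> 'f"
  assumes sheffer: "monic_sheffer_seq sV S B \<alpha>"
begin

definition L :: "nat \<Rightarrow> ('f, 'v) tensor \<Rightarrow> 'v" where
  "L = ser_inverse sV B"
definition \<Psi> :: "'v \<Rightarrow> nat \<Rightarrow> ('f, 'v) tensor \<Rightarrow> 'v" where
  "\<Psi> \<zeta> = ser_comp sV sV (ser_deriv sV sV L \<zeta>) B"
definition \<Delta> :: "'v \<Rightarrow> nat \<Rightarrow> ('f, 'v) tensor \<Rightarrow> 'f" where
  "\<Delta> \<zeta> = - ser_deriv_dir sV (*) \<alpha> (\<Psi> \<zeta>)"
definition exponent :: "('v \<Rightarrow> 'f) \<Rightarrow> nat \<Rightarrow> ('f, 'v) tensor \<Rightarrow> 'f" where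
  "exponent \<omega> = (\<lambda>n f. \<omega> (B n f) + \<alpha> n f)"

lemma B: "B \<in> fseries sV sV" "B 0 = 0" and \<alpha>: "\<alpha> \<in> fseries sV (*)" "\<alpha> 0 = 0"
  using sheffer by (auto simp: monic_sheffer_seq_def fseries1_def)

lemma generating: "\<omega> \<in> Dual \<Longrightarrow> (\<lambda>n f. 1 / fact n * S n \<omega> f) = ser_exp sV (exponent \<omega>)"
  using sheffer by (auto simp: monic_sheffer_seq_def exponent_def)

lemma exponent:
  assumes "\<omega> \<in> Dual"
  shows "exponent \<omega> \<in> fseries sV (*)" "exponent \<omega> 0 = (\<lambda>_. 0)"
proof -
  show "exponent \<omega> \<in> fseries sV (*)"
  proof (rule fseriesI)
    fix n
    note B = fseries_coeff[OF B(1), of n] and \<alpha> = fseries_coeff[OF \<alpha>(1), of n]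
    show "exponent \<omega> n \<in> Lin n (*)"
      using lin_maps_outside[OF B] lin_maps_outside[OF \<alpha>]
      by (auto simp: lin_maps_def exponent_def lin_maps_add[OF B] lin_maps_scale[OF B] lin_maps_add[OF \<alpha>]
          lin_maps_scale[OF \<alpha>] dual_add[OF assms] dual_scale[OF assms] dual_0[OF assms] algebra_simps
          simp del: fun_apply)
  qed
  show "exponent \<omega> 0 = (\<lambda>_. 0)"
    by (simp add: exponent_def B(2) \<alpha>(2) dual_0[OF assms])
qed

lemma S_lin_maps: "\<omega> \<in> Dual \<Longrightarrow> S n \<omega> \<in> Lin n (*)"
  using sheffer by (auto simp: monic_sheffer_seq_def monic_poly_seq_def poly_seq_coeffs_def)

lemma S_0: "\<omega> \<in> Dual \<Longrightarrow> S 0 \<omega> (Tpow 0 v) = 1"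
  using fun_cong[OF fun_cong[OF generating, of _ 0], of \<omega> "Tpow 0 v"] ser_one(2)[of 0 v]
  by (simp add: ser_exp_def)

lemma S_1: "\<omega> \<in> Dual \<Longrightarrow> S 1 \<omega> (Tpow 1 v) = \<omega> (B 1 (Tpow 1 v)) + \<alpha> 1 (Tpow 1 v)"
  using fun_cong[OF fun_cong[OF generating, of _ 1], of \<omega> "Tpow 1 v"] ser_one(2)[of _ v]
    ser_mult(2)[OF exponent(1) ser_one(1), of \<omega> 1 v] fun_cong[OF exponent(2)]
  by (simp add: ser_exp_def) (simp add: exponent_def)

text \<open>A monic sequence has leading term \<open>\<langle>\<omega>, v\<rangle>\<close> in degree \<open>1\<close>, and the generating function gives
  \<open>\<langle>\<omega>, B\<^sub>1 v\<rangle>\<close>. So \<open>B\<^sub>1\<close> is the identity.\<close>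

lemma unital_B: "unital B"
proof -
  obtain T where T: "poly_seq_coeffs sV S T" "\<And>n f. f \<in> Sym n \<Longrightarrow> T n n f = f"
    using sheffer unfolding monic_sheffer_seq_def monic_poly_seq_def by blast
  have S1: "S 1 \<omega> (Tpow 1 v) = T 0 1 (Tpow 1 v) [] + \<omega> v" if "\<omega> \<in> Dual" for \<omega> v
    using T(1) that tpow_mem[of 1 v] T(2)[OF tpow_mem[of 1 v]] tpow_replicate[OF that, of 1 v]
    by (simp add: poly_seq_coeffs_def dual_pow_def)
  have "B 1 (Tpow 1 v) - v = 0" for v
  proof (rule dual_separates)
    fix \<omega> assume \<omega>: "\<omega> \<in> Dual"
    have 0: "(\<lambda>_. 0) \<in> Dual"
      by (rule DualI) simp_all
    have "\<alpha> 1 (Tpow 1 v) = T 0 1 (Tpow 1 v) []"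
      using S1[OF 0, of v] S_1[OF 0, of v] by simp
    then have "\<omega> (B 1 (Tpow 1 v)) = \<omega> v"
      using S1[OF \<omega>, of v] S_1[OF \<omega>, of v] by simp
    then show "\<omega> (B 1 (Tpow 1 v) - v) = 0"
      using dual_add[OF \<omega>, of "B 1 (Tpow 1 v) - v" v] by simp
  qed
  then show ?thesis
    using B by (simp add: unital_def)
qed

lemmas L = ser_inverse[OF unital_B, folded L_def]

lemma \<Psi>_fseries: "\<Psi> \<zeta> \<in> fseries sV sV"
  unfolding \<Psi>_def
  by (intro ser_comp_fseries ser_deriv_fseries vector_space_axioms B) (use L in \<open>simp add: unital_def\<close>)

lemma \<Delta>_fseries: "\<Delta> \<zeta> \<in> fseries sV (*)"
proof (rule fseriesI)
  fix n
  note D = fseries_coeff[OF ser_deriv_dir(1)[OF \<alpha>(1) \<Psi>_fseries], of \<zeta> n]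
  show "\<Delta> \<zeta> n \<in> Lin n (*)"
    by (simp add: lin_maps_def \<Delta>_def lin_maps_add[OF D] lin_maps_scale[OF D] lin_maps_outside[OF D] del: fun_apply)
qed

lemma \<Psi>_0: "\<Psi> \<zeta> 0 (Tpow 0 v) = \<zeta>"
  using L(1) ser_deriv_tpow[of sV L \<zeta> 0 v] by (simp add: \<Psi>_def ser_comp_def unital_def tpow_eq_sym_tensor)

text \<open>The coefficients of \<open>\<langle>\<omega>, \<zeta>\<rangle> E(v) = E'(v; \<Psi>\<^sub>\<zeta>(v)) + \<Delta>\<^sub>\<zeta>(v) E(v)\<close> for the generating function
  \<open>E(v) = exp[\<langle>\<omega>, B(v)\<rangle> + \<alpha>(v)]\<close>: differentiating the exponential in direction \<open>\<Psi>\<^sub>\<zeta>(v)\<close> gives the factor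
  \<open>\<langle>\<omega>, B'(v; \<Psi>\<^sub>\<zeta>(v))\<rangle> + \<alpha>'(v; \<Psi>\<^sub>\<zeta>(v)) = \<langle>\<omega>, \<zeta>\<rangle> - \<Delta>\<^sub>\<zeta>(v)\<close>.\<close>

lemma mult_generating:
  assumes \<omega>: "\<omega> \<in> Dual"
  shows "\<omega> \<zeta> * S n \<omega> (Tpow n v) =
      (\<Sum>m\<le>n. of_nat (falling n (n - m)) * S (Suc m) \<omega> (Symt (\<Psi> \<zeta> (n - m) (Tpow (n - m) v) # replicate m v)))
    + (\<Sum>m\<le>n. of_nat (falling n (n - m)) * (S m \<omega> (Tpow m v) * \<Delta> \<zeta> (n - m) (Tpow (n - m) v)))"
proof -
  \<comment> \<open>The direction \<open>\<Psi>\<^sub>\<zeta>(v)\<close> is itself a series. The rule for the derivative of an exponential is applied in the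
    direction of each of its terms \<open>\<psi> j\<close>, and the results are summed over \<open>j\<close>.\<close>
  define \<psi> where "\<psi> k = \<Psi> \<zeta> k (Tpow k v)" for k
  define d where "d k j = of_nat (Suc k) * exponent \<omega> (Suc k) (Symt (\<psi> j # replicate k v))" for k j
  define E where "E m = S m \<omega> (Tpow m v) / fact m" for m
  have E: "ser_exp sV (exponent \<omega>) m (Tpow m v) = E m" for m
    by (simp add: E_def generating[OF \<omega>, symmetric])
  have deriv: "S (Suc m) \<omega> (Symt (\<psi> j # replicate m v)) / fact m = (\<Sum>l\<le>m. E l * d (m - l) j)" for m j
  proof -
    have "fps_nth (fps_deriv_at v (\<psi> j) (ser_exp sV (exponent \<omega>))) m
        = (\<Sum>l\<le>m. E l * d (m - l) j)"
      unfolding fps_deriv_at_exp[OF exponent[OF \<omega>]]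
      by (simp add: fps_mult_nth fps_at_def E fps_deriv_at_def d_def atMost_atLeast0)
    then show ?thesis
      by (simp add: fps_deriv_at_def generating[OF \<omega>, symmetric] field_simps del: of_nat_Suc)
  qed
  have d: "(\<Sum>k\<le>p. d k (p - k)) = (if p = 0 then \<omega> \<zeta> else 0) - \<Delta> \<zeta> p (Tpow p v)" for p
  proof -
    have "(\<Sum>k\<le>p. d k (p - k))
        = \<omega> (\<Sum>k\<le>p. sV (of_nat (Suc k)) (B (Suc k) (Symt (\<psi> (p - k) # replicate k v))))
        + (\<Sum>k\<le>p. of_nat (Suc k) * \<alpha> (Suc k) (Symt (\<psi> (p - k) # replicate k v)))"
      by (simp add: d_def exponent_def dual_sum[OF \<omega>] dual_scale[OF \<omega>] distrib_left sum.distrib del: of_nat_Suc)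
    moreover have "(\<Sum>k\<le>p. sV (of_nat (Suc k)) (B (Suc k) (Symt (\<psi> (p - k) # replicate k v))))
        = (if p = 0 then \<zeta> else 0)"
      unfolding \<psi>_def \<Psi>_def
      by (rule deriv_along_inverse[OF B]) (use L in \<open>simp_all add: unital_def\<close>)
    moreover have "(\<Sum>k\<le>p. of_nat (Suc k) * \<alpha> (Suc k) (Symt (\<psi> (p - k) # replicate k v))) = - \<Delta> \<zeta> p (Tpow p v)"
      unfolding \<psi>_def by (simp add: \<Delta>_def ser_deriv_dir(2)[OF \<alpha>(1) \<Psi>_fseries] del: of_nat_Suc)
    ultimately show ?thesis
      by (simp add: dual_0[OF \<omega>])
  qed
  have "(\<Sum>m\<le>n. S (Suc m) \<omega> (Symt (\<psi> (n - m) # replicate m v)) / fact m)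
      = (\<Sum>(m, l)\<in>(SIGMA m:{..n}. {..m}). E l * d (m - l) (n - m))"
    by (simp add: deriv sum.Sigma)
  also have "\<dots> = (\<Sum>(l, k)\<in>(SIGMA l:{..n}. {..n - l}). E l * d k (n - l - k))"
    by (rule sum.reindex_bij_witness[of _ "\<lambda>(l, k). (l + k, l)" "\<lambda>(m, l). (l, m - l)"]) auto
  also have "\<dots> = (\<Sum>l\<le>n. E l * (\<Sum>k\<le>n - l. d k (n - l - k)))"
    by (simp add: sum.Sigma sum_distrib_left)
  also have "\<dots> = (\<Sum>l\<le>n. (if l = n then E n * \<omega> \<zeta> else 0) - E l * \<Delta> \<zeta> (n - l) (Tpow (n - l) v))"
    by (intro sum.cong refl) (unfold d, auto simp: algebra_simps)
  also have "\<dots> = E n * \<omega> \<zeta> - (\<Sum>l\<le>n. E l * \<Delta> \<zeta> (n - l) (Tpow (n - l) v))"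
    by (simp add: sum_subtractf)
  finally have "\<omega> \<zeta> * (fact n * E n) = fact n * ((\<Sum>m\<le>n. S (Suc m) \<omega> (Symt (\<psi> (n - m) # replicate m v)) / fact m)
      + (\<Sum>l\<le>n. E l * \<Delta> \<zeta> (n - l) (Tpow (n - l) v)))"
    by (simp add: algebra_simps)
  moreover have "fact n * E n = S n \<omega> (Tpow n v)"
    by (simp add: E_def)
  ultimately show ?thesis
    by (simp add: \<psi>_def E_def falling_fact distrib_left sum_distrib_left mult_ac cong: sum.cong_simp)
qed

lemma mult_formula:
  assumes \<omega>: "\<omega> \<in> Dual"
  shows "\<omega> \<zeta> * S n \<omega> (Tpow n v) =
         S (n + 1) \<omega> (Tpow n v \<odot> Pure [\<zeta>])
         + (\<Sum>m = 1..n. S m \<omega>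
              (tscale (of_nat (falling n (n - m + 1)))
                 (Tpow (m - 1) v \<odot> Pure [\<Psi> \<zeta> (n - m + 1) (Tpow (n - m + 1) v)])
               + tscale (of_nat (falling n (n - m)) * \<Delta> \<zeta> (n - m) (Tpow (n - m) v)) (Tpow m v)))
         + fact n * \<Delta> \<zeta> n (Tpow n v)"
proof -
  let ?g = "\<lambda>m. of_nat (falling n (n - m)) * S (Suc m) \<omega> (Symt (\<Psi> \<zeta> (n - m) (Tpow (n - m) v) # replicate m v))"
  let ?h = "\<lambda>m. of_nat (falling n (n - m)) * (S m \<omega> (Tpow m v) * \<Delta> \<zeta> (n - m) (Tpow (n - m) v))"
  have split: "{..n} = insert n {..<n}" "{..n} = insert 0 {1..n}"
    by auto
  have "(\<Sum>m\<le>n. ?g m) = S (n + 1) \<omega> (Tpow n v \<odot> Pure [\<zeta>]) + (\<Sum>m<n. ?g m)"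
    by (simp add: split(1) falling_def \<Psi>_0 tpow_sym_prod)
  moreover have "(\<Sum>m<n. ?g m) = (\<Sum>m = 1..n. ?g (m - 1))"
    by (rule sum.reindex_bij_witness[of _ "\<lambda>m. m - 1" Suc]) auto
  moreover have "(\<Sum>m\<le>n. ?h m) = fact n * \<Delta> \<zeta> n (Tpow n v) + (\<Sum>m = 1..n. ?h m)"
    using falling_fact[of 0 n, where 'f='f] by (simp add: split(2) S_0[OF \<omega>])
  moreover have "(\<Sum>m = 1..n. ?g (m - 1)) + (\<Sum>m = 1..n. ?h m)
      = (\<Sum>m = 1..n. S m \<omega>
              (tscale (of_nat (falling n (n - m + 1)))
                 (Tpow (m - 1) v \<odot> Pure [\<Psi> \<zeta> (n - m + 1) (Tpow (n - m + 1) v)])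
               + tscale (of_nat (falling n (n - m)) * \<Delta> \<zeta> (n - m) (Tpow (n - m) v)) (Tpow m v)))"
    unfolding sum.distrib[symmetric]
  proof (rule sum.cong[OF refl])
    fix m assume "m \<in> {1..n}"
    then have m: "n - (m - 1) = n - m + 1" "Suc (m - 1) = m"
      by auto
    show "?g (m - 1) + ?h m = S m \<omega>
              (tscale (of_nat (falling n (n - m + 1)))
                 (Tpow (m - 1) v \<odot> Pure [\<Psi> \<zeta> (n - m + 1) (Tpow (n - m + 1) v)])
               + tscale (of_nat (falling n (n - m)) * \<Delta> \<zeta> (n - m) (Tpow (n - m) v)) (Tpow m v))"
      unfolding m tpow_sym_prod using m(2)
      by (simp only: lin_maps_add[OF S_lin_maps[OF \<omega>]] lin_maps_scale[OF S_lin_maps[OF \<omega>]] sym_scale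
          sym_tensor_mem' tpow_mem length_Cons length_replicate mult_ac)
  qed
  ultimately show ?thesis
    unfolding mult_generating[OF \<omega>, of \<zeta> n v] by simp
qed

end

section \<open>Polynomials as combinations of the Sheffer sequence\<close>

context tensor_space
begin

text \<open>Only the values on \<open>V\<^sup>*\<close> count, so that this applies to \<open>\<omega> \<mapsto> \<langle>S\<^sub>n(\<omega>), f\<rangle>\<close> before its extension
  by \<open>0\<close>. The bound on the degree is strict to make the zero polynomial the case \<open>N = 0\<close>.\<close>

definition poly_below :: "nat \<Rightarrow> (('v \<Rightarrow> 'f) \<Rightarrow> 'f) \<Rightarrow> bool" where
  "poly_below N p \<longleftrightarrow> (\<exists>f. (\<forall>k. f k \<in> Sym k) \<and> (\<forall>\<omega>\<in>Dual. p \<omega> = (\<Sum>k<N. dual_pow k \<omega> (f k))))"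

lemma polys_iff: "p \<in> polys sV \<longleftrightarrow> (\<forall>\<omega>. \<omega> \<notin> Dual \<longrightarrow> p \<omega> = 0) \<and> (\<exists>N. poly_below N p)"
proof
  assume "p \<in> polys sV"
  then obtain n f where p: "p = on_dual sV (\<lambda>\<omega>. \<Sum>k\<le>n. dual_pow k \<omega> (f k))" "\<forall>k\<le>n. f k \<in> Sym k"
    unfolding polys_def by blast
  then have "poly_below (Suc n) p"
    unfolding poly_below_def
    by (intro exI[of _ "\<lambda>k. if k \<le> n then f k else 0"])
      (auto simp: on_dual_def sym_zero lessThan_Suc_atMost)
  with p show "(\<forall>\<omega>. \<omega> \<notin> Dual \<longrightarrow> p \<omega> = 0) \<and> (\<exists>N. poly_below N p)"
    by (auto simp: on_dual_def)
next
  assume p: "(\<forall>\<omega>. \<omega> \<notin> Dual \<longrightarrow> p \<omega> = 0) \<and> (\<exists>N. poly_below N p)"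
  then obtain N f where f: "\<forall>k. f k \<in> Sym k" "\<forall>\<omega>\<in>Dual. p \<omega> = (\<Sum>k<N. dual_pow k \<omega> (f k))"
    unfolding poly_below_def by blast
  have "p = on_dual sV (\<lambda>\<omega>. \<Sum>k\<le>N. dual_pow k \<omega> (if k < N then f k else 0))"
  proof
    fix \<omega>
    show "p \<omega> = on_dual sV (\<lambda>\<omega>. \<Sum>k\<le>N. dual_pow k \<omega> (if k < N then f k else 0)) \<omega>"
      using p f(2) by (auto simp: on_dual_def lessThan_Suc_atMost[symmetric] dual_pow_def)
  qed
  then show "p \<in> polys sV"
    unfolding polys_def using f(1) by (auto intro!: exI[of _ N] exI simp: sym_zero)
qed

lemma poly_below_mono:
  assumes "poly_below M p" "M \<le> N"
  shows "poly_below N p"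
proof -
  obtain f where f: "\<forall>k. f k \<in> Sym k" "\<forall>\<omega>\<in>Dual. p \<omega> = (\<Sum>k<M. dual_pow k \<omega> (f k))"
    using assms(1) unfolding poly_below_def by blast
  have "(\<Sum>k<M. dual_pow k \<omega> (f k)) = (\<Sum>k<N. dual_pow k \<omega> (if k < M then f k else 0))" for \<omega>
    using assms(2) by (intro sum.mono_neutral_cong_left) (auto simp: dual_pow_def)
  then show ?thesis
    unfolding poly_below_def using f
    by (intro exI[of _ "\<lambda>k. if k < M then f k else 0"]) (auto simp: sym_zero)
qed

lemma poly_below_add:
  assumes "poly_below N p" "poly_below N q"
  shows "poly_below N (\<lambda>\<omega>. p \<omega> + q \<omega>)"
proof -
  obtain f where f: "\<forall>k. f k \<in> Sym k" "\<forall>\<omega>\<in>Dual. p \<omega> = (\<Sum>k<N. dual_pow k \<omega> (f k))"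
    using assms(1) unfolding poly_below_def by blast
  moreover obtain g where g: "\<forall>k. g k \<in> Sym k" "\<forall>\<omega>\<in>Dual. q \<omega> = (\<Sum>k<N. dual_pow k \<omega> (g k))"
    using assms(2) unfolding poly_below_def by blast
  ultimately show ?thesis
    unfolding poly_below_def
    by (intro exI[of _ "\<lambda>k. f k + g k"]) (auto simp: sym_add dual_pow_def sum.distrib)
qed

lemma poly_below_scale:
  assumes "poly_below N p"
  shows "poly_below N (\<lambda>\<omega>. c * p \<omega>)"
proof -
  obtain f where f: "\<forall>k. f k \<in> Sym k" "\<forall>\<omega>\<in>Dual. p \<omega> = (\<Sum>k<N. dual_pow k \<omega> (f k))"
    using assms unfolding poly_below_def by blast
  then show ?thesis
    unfolding poly_below_def
    by (intro exI[of _ "\<lambda>k. tscale c (f k)"]) (auto simp: sym_scale dual_pow_def sum_distrib_left)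
qed

lemma poly_below_dual_pow:
  assumes "t \<in> Sym n"
  shows "poly_below (Suc n) (\<lambda>\<omega>. dual_pow n \<omega> t)"
  unfolding poly_below_def
  using assms by (intro exI[of _ "\<lambda>k. if k = n then t else 0"]) (auto simp: sym_zero dual_pow_def)

lemma subspace_polys: "tensor.subspace (polys sV)"
proof (rule tensor.subspaceI)
  show "0 \<in> polys sV"
    unfolding polys_iff poly_below_def
    by (intro conjI exI[of _ "0::nat"] exI[of _ "\<lambda>_. 0"]) (auto simp: sym_zero)
next
  fix p q assume "p \<in> polys sV" "q \<in> polys sV"
  then obtain M N where "poly_below M p" "poly_below N q" and 0: "\<forall>\<omega>. \<omega> \<notin> Dual \<longrightarrow> p \<omega> = 0 \<and> q \<omega> = 0"
    unfolding polys_iff by blast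
  then have "poly_below (max M N) (\<lambda>\<omega>. p \<omega> + q \<omega>)"
    by (intro poly_below_add) (auto intro: poly_below_mono)
  with 0 show "p + q \<in> polys sV"
    unfolding polys_iff by (auto simp: plus_fun_def)
next
  fix c p assume "p \<in> polys sV"
  then show "tscale c p \<in> polys sV"
    unfolding polys_iff pointwise_def by (auto intro: poly_below_scale)
qed

lemma dual_pow_scale:
  assumes "t \<in> Sym n" "\<omega> \<in> Dual"
  shows "dual_pow n (tscale c \<omega>) t = c ^ n * dual_pow n \<omega> t"
proof -
  define \<eta> where "\<eta> = tscale c \<omega>"
  have pow: "Tpow n v (replicate n \<eta>) = c ^ n * Tpow n v (replicate n \<omega>)" for v
    using tpow_replicate[OF dual_tscale_mem[OF assms(2)]] tpow_replicate[OF assms(2)]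
    by (simp add: \<eta>_def power_mult_distrib)
  have "dual_pow n \<eta> t = c ^ n * dual_pow n \<omega> t"
    using assms(1) by (induction rule: sym_power_induct) (simp_all add: dual_pow_def pow algebra_simps)
  then show ?thesis
    by (simp only: \<eta>_def)
qed

text \<open>A polynomial on \<open>V\<^sup>*\<close> determines its coefficients: along the lines \<open>t \<mapsto> t \<omega>\<close> it determines
  \<open>\<langle>\<omega>\<^sup>\<otimes>\<^sup>k, f\<^sub>k\<rangle>\<close>, and these values determine the symmetric tensor \<open>f\<^sub>k\<close>.\<close>

lemma dual_pow_independent:
  assumes f: "\<And>k. f k \<in> Sym k" and 0: "\<And>\<omega>. \<omega> \<in> Dual \<Longrightarrow> (\<Sum>k<N. dual_pow k \<omega> (f k)) = 0" and "k < N"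
  shows "f k = 0"
proof (rule sym_power_eq_0[OF f])
  fix \<omega> assume \<omega>: "\<omega> \<in> Dual"
  interpret F: tensor_space "(*) :: 'f \<Rightarrow> 'f \<Rightarrow> 'f"
    by (simp add: tensor_space_def vector_space_field)
  have "(\<lambda>t. \<Sum>k<N. t ^ k * dual_pow k \<omega> (f k)) = (\<lambda>_. 0)"
  proof
    fix t
    show "(\<Sum>k<N. t ^ k * dual_pow k \<omega> (f k)) = 0"
      using 0[OF dual_tscale_mem[OF \<omega>, of t]] by (simp add: dual_pow_scale[OF f \<omega>])
  qed
  then have "(\<lambda>t. \<Sum>k<N. t ^ k * dual_pow k \<omega> (f k)) \<in> curves (*) N"
    by (simp add: curves_zero)
  from F.curves_coeffs_0[OF this \<open>k < N\<close>] show "f k (replicate k \<omega>) = 0"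
    by (simp add: dual_pow_def)
qed

end

context sheffer
begin

lemma S_leading:
  assumes "t \<in> Sym n"
  obtains q where "poly_below n q" "\<And>\<omega>. \<omega> \<in> Dual \<Longrightarrow> S n \<omega> t = dual_pow n \<omega> t + q \<omega>"
proof -
  obtain T where T: "poly_seq_coeffs sV S T" "\<And>n f. f \<in> Sym n \<Longrightarrow> T n n f = f"
    using sheffer unfolding monic_sheffer_seq_def monic_poly_seq_def by blast
  have "poly_below n (\<lambda>\<omega>. \<Sum>k<n. dual_pow k \<omega> (T k n t))"
    unfolding poly_below_def
  proof (intro exI[of _ "\<lambda>k. if k < n then T k n t else 0"] conjI allI ballI)
    fix k
    show "(if k < n then T k n t else 0) \<in> Sym k"
      using T(1) lin_maps_in[OF _ assms, of "T k n" tscale tscale "Sym k"]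
      by (simp add: poly_seq_coeffs_def sym_zero)
  qed simp
  moreover have "S n \<omega> t = dual_pow n \<omega> t + (\<Sum>k<n. dual_pow k \<omega> (T k n t))" if "\<omega> \<in> Dual" for \<omega>
    using T(1) that assms by (simp add: poly_seq_coeffs_def lessThan_Suc_atMost[symmetric] T(2))
  ultimately show thesis
    by (rule that)
qed

lemma poly_below_S: "t \<in> Sym n \<Longrightarrow> poly_below (Suc n) (\<lambda>\<omega>. S n \<omega> t)"
proof -
  assume t: "t \<in> Sym n"
  then obtain q where q: "poly_below n q" "\<And>\<omega>. \<omega> \<in> Dual \<Longrightarrow> S n \<omega> t = dual_pow n \<omega> t + q \<omega>"
    by (rule S_leading) blast
  have "poly_below (Suc n) (\<lambda>\<omega>. dual_pow n \<omega> t + q \<omega>)"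
    using q(1) by (intro poly_below_add poly_below_dual_pow t) (auto intro: poly_below_mono)
  then show ?thesis
    unfolding poly_below_def using q(2) by auto
qed

lemma poly_below_sum_S: "(\<And>k. g k \<in> Sym k) \<Longrightarrow> poly_below N (\<lambda>\<omega>. \<Sum>k<N. S k \<omega> (g k))"
proof (induction N)
  case 0
  show ?case
    unfolding poly_below_def by (intro exI[of _ g]) (use 0 in simp)
next
  case (Suc N)
  then show ?case
    using poly_below_mono[OF Suc.IH, of "Suc N"] poly_below_S[of "g N" N]
    by (simp add: poly_below_add)
qed

text \<open>Since the leading term of \<open>S\<^sub>n\<close> is \<open>\<omega>\<^sup>\<otimes>\<^sup>n\<close>, the change from powers to the Sheffer sequence is
  triangular with identity operators on the diagonal.\<close>

lemma S_independent:
  assumes "\<And>k. g k \<in> Sym k" "\<And>\<omega>. \<omega> \<in> Dual \<Longrightarrow> (\<Sum>k<N. S k \<omega> (g k)) = 0" "k < N"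
  shows "g k = 0"
  using assms(2,3)
proof (induction N)
  case (Suc N)
  obtain q where q: "poly_below N q" "\<And>\<omega>. \<omega> \<in> Dual \<Longrightarrow> S N \<omega> (g N) = dual_pow N \<omega> (g N) + q \<omega>"
    using S_leading[OF assms(1)] by metis
  have "poly_below N (\<lambda>\<omega>. q \<omega> + (\<Sum>k<N. S k \<omega> (g k)))"
    by (intro poly_below_add q poly_below_sum_S assms)
  then obtain f where f: "\<And>k. f k \<in> Sym k"
    "\<And>\<omega>. \<omega> \<in> Dual \<Longrightarrow> q \<omega> + (\<Sum>k<N. S k \<omega> (g k)) = (\<Sum>k<N. dual_pow k \<omega> (f k))"
    unfolding poly_below_def by blast
  have "(if N = N then g N else f N) = 0"
  proof (rule dual_pow_independent[of "\<lambda>k. if k = N then g N else f k" "Suc N"])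
    fix \<omega> assume \<omega>: "\<omega> \<in> Dual"
    show "(\<Sum>k<Suc N. dual_pow k \<omega> (if k = N then g N else f k)) = 0"
      using q(2)[OF \<omega>] Suc.prems(1)[OF \<omega>] by (simp add: f(2)[OF \<omega>, symmetric] algebra_simps)
  qed (use f assms in auto)
  then have N: "g N = 0"
    by simp
  show ?case
  proof (cases "k = N")
    case False
    have "(\<Sum>k<N. S k \<omega> (g k)) = 0" if "\<omega> \<in> Dual" for \<omega>
      using Suc.prems(1)[OF that] lin_maps_0[OF S_lin_maps[OF that]] by (simp add: N)
    with False Suc show ?thesis
      by simp
  qed (simp add: N)
qed simp

lemma S_expansion:
  assumes "poly_below N p"
  shows "\<exists>g. (\<forall>k. g k \<in> Sym k) \<and> (\<forall>k\<ge>N. g k = 0) \<and> (\<forall>\<omega>\<in>Dual. p \<omega> = (\<Sum>k<N. S k \<omega> (g k)))"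
  using assms
proof (induction N arbitrary: p)
  case 0
  then show ?case
    by (intro exI[of _ "\<lambda>_. 0"]) (auto simp: poly_below_def sym_zero simp del: fun_apply)
next
  case (Suc N)
  from Suc.prems obtain f where f: "\<And>k. f k \<in> Sym k" "\<And>\<omega>. \<omega> \<in> Dual \<Longrightarrow> p \<omega> = (\<Sum>k<Suc N. dual_pow k \<omega> (f k))"
    unfolding poly_below_def by blast
  obtain q where q: "poly_below N q" "\<And>\<omega>. \<omega> \<in> Dual \<Longrightarrow> S N \<omega> (f N) = dual_pow N \<omega> (f N) + q \<omega>"
    using S_leading[OF f(1)] by metis
  have "poly_below N (\<lambda>\<omega>. (\<Sum>k<N. dual_pow k \<omega> (f k)) + (- 1) * q \<omega>)"
    by (intro poly_below_add poly_below_scale q) (use f(1) in \<open>auto simp: poly_below_def\<close>)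
  from Suc.IH[OF this] obtain g where g: "\<And>k. g k \<in> Sym k" "\<And>k. k \<ge> N \<Longrightarrow> g k = 0"
    "\<And>\<omega>. \<omega> \<in> Dual \<Longrightarrow> (\<Sum>k<N. dual_pow k \<omega> (f k)) + (- 1) * q \<omega> = (\<Sum>k<N. S k \<omega> (g k))"
    by blast
  show ?case
  proof (intro exI[of _ "\<lambda>k. if k = N then f N else g k"] conjI ballI allI impI)
    fix \<omega> assume \<omega>: "\<omega> \<in> Dual"
    show "p \<omega> = (\<Sum>k<Suc N. S k \<omega> (if k = N then f N else g k))"
      using f(2)[OF \<omega>] q(2)[OF \<omega>] g(3)[OF \<omega>] by (simp add: algebra_simps)
  qed (use f(1) g(1,2) in simp_all)
qed

definition Spoly :: "nat \<Rightarrow> ('f, 'v) tensor \<Rightarrow> ('v \<Rightarrow> 'f) \<Rightarrow> 'f" where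
  "Spoly n t = on_dual sV (\<lambda>\<omega>. S n \<omega> t)"

lemma Spoly_apply: "\<omega> \<in> Dual \<Longrightarrow> Spoly n t \<omega> = S n \<omega> t" "\<omega> \<notin> Dual \<Longrightarrow> Spoly n t \<omega> = 0"
  by (simp_all add: Spoly_def on_dual_def)

lemma Spoly_mem:
  assumes "t \<in> Sym n"
  shows "Spoly n t \<in> polys sV"
proof -
  have "poly_below (Suc n) (Spoly n t)"
    using poly_below_S[OF assms] by (simp add: poly_below_def Spoly_apply)
  then show ?thesis
    unfolding polys_iff using Spoly_apply(2) by blast
qed

lemma Spoly_add: "s \<in> Sym n \<Longrightarrow> t \<in> Sym n \<Longrightarrow> Spoly n (s + t) = Spoly n s + Spoly n t"
  by (auto simp: fun_eq_iff Spoly_def on_dual_def lin_maps_add[OF S_lin_maps] simp del: fun_apply) simp_all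

lemma Spoly_scale: "t \<in> Sym n \<Longrightarrow> Spoly n (tscale c t) = tscale c (Spoly n t)"
  by (rule ext) (simp add: Spoly_def on_dual_def lin_maps_scale[OF S_lin_maps] pointwise_def[of "(*)" c "\<lambda>_. _ _"])

lemma Spoly_0: "Spoly n 0 = 0"
  by (auto simp: fun_eq_iff Spoly_def on_dual_def lin_maps_0[OF S_lin_maps])

lemma polys_eq_span: "polys sV = tensor.span {Spoly n (Tpow n v) | n v. True}"
proof
  show "tensor.span {Spoly n (Tpow n v) | n v. True} \<subseteq> polys sV"
    by (intro tensor.span_minimal subspace_polys) (auto simp: Spoly_mem tpow_mem)
  have S: "Spoly n t \<in> tensor.span {Spoly n (Tpow n v) | n v. True}" if "t \<in> Sym n" for n t
    using that
  proof (induction rule: sym_power_induct)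
    case zero
    show ?case
      by (simp only: Spoly_0 tensor.span_zero)
  next
    case (step c v s)
    have "Spoly n (tscale c (Tpow n v) + s) = tscale c (Spoly n (Tpow n v)) + Spoly n s"
      using step by (simp only: Spoly_add Spoly_scale sym_scale tpow_mem)
    moreover have "Spoly n (Tpow n v) \<in> tensor.span {Spoly n (Tpow n v) | n v. True}"
      by (rule tensor.span_base) blast
    ultimately show ?case
      using tensor.span_add[OF tensor.span_scale step.IH] by (simp only:)
  qed
  show "polys sV \<subseteq> tensor.span {Spoly n (Tpow n v) | n v. True}"
  proof
    fix p assume "p \<in> polys sV"
    then obtain N where p: "poly_below N p" "\<And>\<omega>. \<omega> \<notin> Dual \<Longrightarrow> p \<omega> = 0"
      unfolding polys_iff by blast
    obtain g where g: "\<And>k. g k \<in> Sym k" "\<And>\<omega>. \<omega> \<in> Dual \<Longrightarrow> p \<omega> = (\<Sum>k<N. S k \<omega> (g k))"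
      using S_expansion[OF p(1)] by blast
    have "p = (\<Sum>k<N. Spoly k (g k))"
    proof
      fix \<omega>
      show "p \<omega> = (\<Sum>k<N. Spoly k (g k)) \<omega>"
        by (cases "\<omega> \<in> Dual") (simp_all add: sum_fun_apply Spoly_apply g(2) p(2))
    qed
    then show "p \<in> tensor.span {Spoly n (Tpow n v) | n v. True}"
      using S g(1) by (simp add: tensor.span_sum)
  qed
qed

lemma polys_induct [consumes 1, case_names zero step]:
  assumes "p \<in> polys sV" "P 0"
    and "\<And>c n v q. q \<in> polys sV \<Longrightarrow> P q \<Longrightarrow> P (tscale c (Spoly n (Tpow n v)) + q)"
  shows "P p"
proof -
  have "p \<in> polys sV \<and> P p"
    using assms(1)[unfolded polys_eq_span]
  proof (induction rule: tensor.span_induct_alt)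
    case (step c x y)
    then show ?case
      using assms(3) subspace_polys tpow_mem Spoly_mem
      by (auto simp del: fun_apply intro!: tensor.subspace_add tensor.subspace_scale)
  qed (simp add: assms(2) tensor.subspace_0[OF subspace_polys] del: fun_apply)
  then show ?thesis ..
qed

definition S_coords :: "(('v \<Rightarrow> 'f) \<Rightarrow> 'f) \<Rightarrow> (nat \<Rightarrow> ('f, 'v) tensor) \<Rightarrow> bool" where
  "S_coords p g \<longleftrightarrow> (\<forall>k. g k \<in> Sym k) \<and> (\<exists>N. (\<forall>k\<ge>N. g k = 0) \<and> (\<forall>\<omega>\<in>Dual. p \<omega> = (\<Sum>k<N. S k \<omega> (g k))))"

definition coord :: "(('v \<Rightarrow> 'f) \<Rightarrow> 'f) \<Rightarrow> nat \<Rightarrow> ('f, 'v) tensor" where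
  "coord p = (THE g. S_coords p g)"

lemma sum_S_extend:
  assumes "\<omega> \<in> Dual" "\<forall>k\<ge>N. g k = 0" "N \<le> M"
  shows "(\<Sum>k<N. S k \<omega> (g k)) = (\<Sum>k<M. S k \<omega> (g k))"
  using assms by (intro sum.mono_neutral_left) (auto simp: lin_maps_0[OF S_lin_maps])

lemma S_coordsE:
  assumes "S_coords p g"
  obtains N where "\<And>M. N \<le> M \<Longrightarrow> (\<forall>k\<ge>M. g k = 0) \<and> (\<forall>\<omega>\<in>Dual. p \<omega> = (\<Sum>k<M. S k \<omega> (g k)))"
proof -
  obtain N where "\<forall>k\<ge>N. g k = 0" "\<forall>\<omega>\<in>Dual. p \<omega> = (\<Sum>k<N. S k \<omega> (g k))"
    using assms unfolding S_coords_def by blast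
  then show thesis
    by (intro that[of N]) (auto simp: sum_S_extend)
qed

lemma S_coords_add:
  assumes "S_coords p g" "S_coords q h"
  shows "S_coords (p + q) (\<lambda>k. g k + h k)"
proof -
  obtain M where M: "\<And>K. M \<le> K \<Longrightarrow> (\<forall>k\<ge>K. g k = 0) \<and> (\<forall>\<omega>\<in>Dual. p \<omega> = (\<Sum>k<K. S k \<omega> (g k)))"
    by (rule S_coordsE[OF assms(1)]) blast
  obtain N where N: "\<And>K. N \<le> K \<Longrightarrow> (\<forall>k\<ge>K. h k = 0) \<and> (\<forall>\<omega>\<in>Dual. q \<omega> = (\<Sum>k<K. S k \<omega> (h k)))"
    by (rule S_coordsE[OF assms(2)]) blast
  have mem: "\<forall>k. g k \<in> Sym k" "\<forall>k. h k \<in> Sym k"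
    using assms by (auto simp: S_coords_def)
  show ?thesis
    unfolding S_coords_def plus_fun_apply[of p q]
    using M[of "max M N"] N[of "max M N"] mem
    by (intro conjI exI[of _ "max M N"] allI impI ballI)
      (simp_all add: sym_add lin_maps_add[OF S_lin_maps] sum.distrib del: fun_apply)
qed

lemma S_coords_scale:
  assumes "S_coords p g"
  shows "S_coords (tscale c p) (\<lambda>k. tscale c (g k))"
proof -
  obtain N where N: "\<And>K. N \<le> K \<Longrightarrow> (\<forall>k\<ge>K. g k = 0) \<and> (\<forall>\<omega>\<in>Dual. p \<omega> = (\<Sum>k<K. S k \<omega> (g k)))"
    by (rule S_coordsE[OF assms]) blast
  have mem: "\<forall>k. g k \<in> Sym k"
    using assms by (auto simp: S_coords_def)
  show ?thesis
    unfolding S_coords_def using N[of N] mem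
    by (intro conjI exI[of _ N])
      (simp_all add: sym_scale lin_maps_scale[OF S_lin_maps] sum_distrib_left tscale_apply[of c p]
        tensor.scale_zero_right del: fun_apply)
qed

lemma coord_eq:
  assumes "S_coords p g"
  shows "coord p = g"
  unfolding coord_def
proof (rule the_equality)
  show "S_coords p g"
    by fact
next
  fix h assume "S_coords p h"
  define d where "d = (\<lambda>k. h k + tscale (- 1) (g k))"
  have d: "S_coords (p + tscale (- 1) p) d"
    unfolding d_def by (intro S_coords_add S_coords_scale assms \<open>S_coords p h\<close>)
  then have mem: "\<And>k. d k \<in> Sym k"
    by (simp add: S_coords_def)
  obtain N where N: "\<And>K. N \<le> K \<Longrightarrow> (\<forall>k\<ge>K. d k = 0)
      \<and> (\<forall>\<omega>\<in>Dual. (p + tscale (- 1) p) \<omega> = (\<Sum>k<K. S k \<omega> (d k)))"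
    by (rule S_coordsE[OF d]) blast
  have "d k = 0" for k
    by (rule S_independent[OF mem, of "max N (Suc k)"]) (use N[of "max N (Suc k)"] in auto)
  then show "h = g"
    by (simp add: d_def fun_eq_iff)
qed

lemma S_coords_coord: "p \<in> polys sV \<Longrightarrow> S_coords p (coord p)"
proof -
  assume "p \<in> polys sV"
  then obtain N where "poly_below N p"
    unfolding polys_iff by blast
  from S_expansion[OF this] obtain g where "S_coords p g"
    unfolding S_coords_def by blast
  then show ?thesis
    by (simp add: coord_eq)
qed

lemma coord_mem: "p \<in> polys sV \<Longrightarrow> coord p k \<in> Sym k"
  using S_coords_coord unfolding S_coords_def by blast

lemma coord_add: "p \<in> polys sV \<Longrightarrow> q \<in> polys sV \<Longrightarrow> coord (p + q) k = coord p k + coord q k"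
  using coord_eq[OF S_coords_add[OF S_coords_coord S_coords_coord], of p q] by metis

lemma coord_scale: "p \<in> polys sV \<Longrightarrow> coord (tscale c p) k = tscale c (coord p k)"
  using coord_eq[OF S_coords_scale[OF S_coords_coord], of p c] by metis

lemma coord_finite: "p \<in> polys sV \<Longrightarrow> \<exists>N. \<forall>k\<ge>N. coord p k = 0"
  using S_coords_coord unfolding S_coords_def by blast

lemma coord_Spoly:
  assumes "t \<in> Sym n"
  shows "coord (Spoly n t) = (\<lambda>k. if k = n then t else 0)"
proof (rule coord_eq, unfold S_coords_def, intro conjI exI[of _ "Suc n"] allI impI ballI)
  fix \<omega> assume \<omega>: "\<omega> \<in> Dual"
  show "Spoly n t \<omega> = (\<Sum>k<Suc n. S k \<omega> (if k = n then t else 0))"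
    by (simp add: Spoly_apply \<omega> lin_maps_0[OF S_lin_maps[OF \<omega>]])
qed (use assms sym_zero in auto)

text \<open>An operator can be prescribed on \<open>\<langle>S\<^sub>n(\<cdot>), f\<rangle>\<close> by any formula that is linear in \<open>f\<close>, because the
  coordinates \<open>f\<^sub>n\<close> of a polynomial with respect to the Sheffer sequence are unique. This gives the
  existence of the lowering and raising operators.\<close>

lemma polys_extension:
  assumes "vector_space sW" "module.subspace sW U"
    and H: "\<And>n t. t \<in> Sym n \<Longrightarrow> H n t \<in> U"
      "\<And>n s t. s \<in> Sym n \<Longrightarrow> t \<in> Sym n \<Longrightarrow> H n (s + t) = H n s + H n t"
      "\<And>n c t. t \<in> Sym n \<Longrightarrow> H n (tscale c t) = sW c (H n t)"
  shows "\<exists>R\<in>lin_maps tscale (polys sV) sW U. \<forall>n. \<forall>t\<in>Sym n. R (Spoly n t) = H n t"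
proof -
  interpret W: vector_space sW by fact
  have H0: "H n 0 = 0" for n
    using H(3)[of 0 n 0] by (simp add: sym_zero)
  define R where "R p = (\<Sum>n | coord p n \<noteq> 0. H n (coord p n))" for p
  have R: "R p = (\<Sum>n<N. H n (coord p n))" if "\<forall>k\<ge>N. coord p k = 0" for p N
    unfolding R_def using that by (intro sum.mono_neutral_left) (auto simp: H0 not_le[symmetric])
  have "R (p + q) = R p + R q" if p: "p \<in> polys sV" and q: "q \<in> polys sV" for p q
  proof -
    obtain M where "\<forall>k\<ge>M. coord p k = 0"
      using coord_finite[OF p] by blast
    moreover obtain N where "\<forall>k\<ge>N. coord q k = 0"
      using coord_finite[OF q] by blast
    ultimately have p0: "\<forall>k\<ge>max M N. coord p k = 0" and q0: "\<forall>k\<ge>max M N. coord q k = 0"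
      by simp_all
    then have "\<forall>k\<ge>max M N. coord (p + q) k = 0"
      by (simp add: coord_add p q del: fun_apply)
    from R[OF this] R[OF p0] R[OF q0] show ?thesis
      by (simp add: coord_add p q H(2) coord_mem sum.distrib del: fun_apply)
  qed
  moreover have "R (tscale c p) = sW c (R p)" if p: "p \<in> polys sV" for p c
  proof -
    obtain N where p0: "\<forall>k\<ge>N. coord p k = 0"
      using coord_finite[OF p] by blast
    then have "\<forall>k\<ge>N. coord (tscale c p) k = 0"
      by (simp add: coord_scale p tensor.scale_zero_right del: fun_apply)
    from R[OF this] R[OF p0] show ?thesis
      by (simp add: coord_scale p H(3) coord_mem W.scale_sum_right del: fun_apply)
  qed
  moreover have "R p \<in> U" if "p \<in> polys sV" for p
    unfolding R_def using that by (intro W.subspace_sum[OF assms(2)] H coord_mem)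
  ultimately have "(\<lambda>p. if p \<in> polys sV then R p else 0) \<in> lin_maps tscale (polys sV) sW U"
    by (auto simp: lin_maps_def tensor.subspace_add[OF subspace_polys] tensor.subspace_scale[OF subspace_polys]
        simp del: fun_apply)
  moreover have "R (Spoly n t) = H n t" if "t \<in> Sym n" for n t
  proof -
    have "R (Spoly n t) = (\<Sum>k<Suc n. H k (if k = n then t else 0))"
      using coord_Spoly[OF that] by (subst R[of "Suc n"]) auto
    then show ?thesis
      by (simp add: H0)
  qed
  ultimately show ?thesis
    by (intro bexI[of _ "\<lambda>p. if p \<in> polys sV then R p else 0"]) (simp_all add: Spoly_mem)
qed

lemma polys_lin_maps_eqI:
  assumes "A \<in> lin_maps tscale (polys sV) sW U" "A' \<in> lin_maps tscale (polys sV) sW U'"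
    and "\<And>n v. A (Spoly n (Tpow n v)) = A' (Spoly n (Tpow n v))"
  shows "A = A'"
  using assms by (intro lin_maps_eq_on_span[OF tensor.vector_space_axioms])
    (auto simp: polys_eq_span)

end

section \<open>The lowering operators\<close>

lemma falling_eq_0: "n < k \<Longrightarrow> falling n k = 0"
  unfolding falling_def by (rule prod_zero) auto

context tensor_space
begin

lemma subspace_vpolys: "vector_space sW \<Longrightarrow> module.subspace (pointwise sW) (vpolys sV sW W)"
  unfolding vpolys_def
  by (intro module.subspace_span) (simp add: module_iff_vector_space vector_space_pointwise)

lemma vpolys_base: "vector_space sW \<Longrightarrow> p \<in> polys sV \<Longrightarrow> w \<in> W \<Longrightarrow> (\<lambda>\<omega>. sW (p \<omega>) w) \<in> vpolys sV sW W"
  unfolding vpolys_def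
  by (intro module.span_base) (auto simp: module_iff_vector_space vector_space_pointwise)

lemma vpolys_minimal:
  assumes "vector_space sW" "module.subspace (pointwise sW) X"
    and "\<And>p w. p \<in> polys sV \<Longrightarrow> w \<in> W \<Longrightarrow> (\<lambda>\<omega>. sW (p \<omega>) w) \<in> X" and "q \<in> vpolys sV sW W"
  shows "q \<in> X"
proof -
  interpret P: vector_space "pointwise sW :: _ \<Rightarrow> (('v \<Rightarrow> 'f) \<Rightarrow> 'a) \<Rightarrow> _"
    by (rule vector_space_pointwise) fact
  have "vpolys sV sW W \<subseteq> X"
    unfolding vpolys_def using assms(3) by (intro P.span_minimal assms(2)) auto
  with assms(4) show ?thesis
    by blast
qed

lemma vpolys_values:
  assumes "vector_space sW" "module.subspace sW W" "q \<in> vpolys sV sW W"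
  shows "q \<omega> \<in> W" "\<omega> \<notin> Dual \<Longrightarrow> q \<omega> = 0"
proof -
  interpret W: vector_space sW by fact
  interpret P: vector_space "pointwise sW :: _ \<Rightarrow> (('v \<Rightarrow> 'f) \<Rightarrow> 'a) \<Rightarrow> _"
    by (rule vector_space_pointwise) fact
  have "q \<in> {q. \<forall>\<omega>. q \<omega> \<in> W \<and> (\<omega> \<notin> Dual \<longrightarrow> q \<omega> = 0)}"
  proof (rule vpolys_minimal[OF assms(1) _ _ assms(3)])
    show "P.subspace {q. \<forall>\<omega>. q \<omega> \<in> W \<and> (\<omega> \<notin> Dual \<longrightarrow> q \<omega> = 0)}"
      by (rule P.subspaceI)
        (auto simp: pointwise_def W.subspace_0[OF assms(2)] W.subspace_add[OF assms(2)] W.subspace_scale[OF assms(2)])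
  qed (auto simp: polys_iff W.subspace_scale[OF assms(2)])
  then show "q \<omega> \<in> W" "\<omega> \<notin> Dual \<Longrightarrow> q \<omega> = 0"
    by auto
qed

end

context sheffer
begin

text \<open>The value that \<open>Q\<^sup>k\<close> has to take at \<open>\<langle>S\<^sub>n(\<cdot>), v\<^sup>\<otimes>\<^sup>n\<rangle>\<close>.\<close>

definition lowered :: "nat \<Rightarrow> nat \<Rightarrow> 'v \<Rightarrow> ('v \<Rightarrow> 'f) \<Rightarrow> ('f, 'v) tensor" where
  "lowered k n v = on_dual sV (\<lambda>\<omega>. tscale (of_nat (falling n k) * S (n - k) \<omega> (Tpow (n - k) v)) (Tpow k v))"

lemma lowered_apply: "\<omega> \<in> Dual \<Longrightarrow>
    lowered k n v \<omega> = tscale (of_nat (falling n k) * S (n - k) \<omega> (Tpow (n - k) v)) (Tpow k v)"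
    "\<omega> \<notin> Dual \<Longrightarrow> lowered k n v \<omega> = 0"
  by (simp_all add: lowered_def on_dual_def)

lemma lowered_mem: "lowered k n v \<in> vpolys sV tscale (Sym k)"
proof -
  let ?p = "tscale (of_nat (falling n k)) (Spoly (n - k) (Tpow (n - k) v))"
  have "?p \<in> polys sV"
    by (intro tensor.subspace_scale[OF subspace_polys] Spoly_mem tpow_mem)
  then have "(\<lambda>\<omega>. tscale (?p \<omega>) (Tpow k v)) \<in> vpolys sV tscale (Sym k)"
    by (intro vpolys_base tensor.vector_space_axioms tpow_mem)
  moreover have "(\<lambda>\<omega>. tscale (?p \<omega>) (Tpow k v)) = lowered k n v"
    by (rule ext) (simp add: lowered_def on_dual_def Spoly_def tensor.scale_zero_left del: fun_apply,
        simp add: fun_eq_iff)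
  ultimately show ?thesis
    by simp
qed

text \<open>For general \<open>f\<close>, the operator sends \<open>\<langle>S\<^sub>n(\<omega>), f\<rangle>\<close> to \<open>(n)\<^sub>k\<close> times the contraction of the last
  \<open>n - k\<close> factors of \<open>f\<close> with \<open>S\<^sub>n\<^sub>-\<^sub>k(\<omega>)\<close>. This formula is linear in \<open>f\<close>.\<close>

lemma lowering_exists:
  "\<exists>Q\<in>lin_maps tscale (polys sV) (pointwise tscale) (vpolys sV tscale (Sym k)).
     \<forall>n v. Q (Spoly n (Tpow n v)) = lowered k n v"
proof -
  interpret P: vector_space "pointwise tscale :: 'f \<Rightarrow> (('v \<Rightarrow> 'f) \<Rightarrow> ('f, 'v) tensor) \<Rightarrow> _"
    by (rule vector_space_pointwise) (rule tensor.vector_space_axioms)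
  note sub = subspace_vpolys[OF tensor.vector_space_axioms, of "Sym k"]
  define H where "H n t = (\<lambda>\<omega>. if \<omega> \<in> Dual \<and> k \<le> n
    then tscale (of_nat (falling n k)) (contract k (S (n - k) \<omega>) t) else 0)" for n t
  have add: "H n (s + t) = H n s + H n t" if "s \<in> Sym n" "t \<in> Sym n" for n s t
  proof
    fix \<omega>
    have "H n (s + t) \<omega> = H n s \<omega> + H n t \<omega>"
      using that
      by (simp add: H_def contract_add[OF S_lin_maps[of _ "n - k"]] tensor.scale_right_distrib del: fun_apply)
    then show "H n (s + t) \<omega> = (H n s + H n t) \<omega>"
      by (simp only: plus_fun_apply)
  qed
  have scale: "H n (tscale c t) = pointwise tscale c (H n t)" if "t \<in> Sym n" for n c t
    using that
    by (intro ext[of "H n (tscale c t)"])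
      (simp add: H_def contract_scale[OF S_lin_maps[of _ "n - k"]] pointwise_def[of tscale] tensor.scale_left_commute tensor.scale_zero_right del: fun_apply)
  have tpow: "H n (Tpow n v) = lowered k n v" for n v
  proof
    fix \<omega>
    show "H n (Tpow n v) \<omega> = lowered k n v \<omega>"
      using contract_tpow[OF S_lin_maps[of \<omega> "n - k"], of k v]
      by (cases "\<omega> \<in> Dual"; cases "k \<le> n")
        (simp_all add: H_def lowered_apply falling_eq_0 tensor.scale_zero_left del: fun_apply)
  qed
  have mem: "H n t \<in> vpolys sV tscale (Sym k)" if "t \<in> Sym n" for n t
    using that
  proof (induction rule: sym_power_induct)
    case zero
    have "H n 0 = 0"
      using scale[OF sym_zero, of n 0] by (simp only: tensor.scale_zero_left P.scale_zero_left)
    then show ?case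
      using P.subspace_0[OF sub] by (simp only:)
  next
    case (step c v s)
    then have "H n (tscale c (Tpow n v) + s) = pointwise tscale c (lowered k n v) + H n s"
      by (simp only: add scale tpow sym_scale tpow_mem)
    then show ?case
      using P.subspace_add[OF sub P.subspace_scale[OF sub lowered_mem] step.IH] by (simp only:)
  qed
  have "\<exists>Q\<in>lin_maps tscale (polys sV) (pointwise tscale) (vpolys sV tscale (Sym k)).
      \<forall>n. \<forall>t\<in>Sym n. Q (Spoly n t) = H n t"
    by (rule polys_extension[OF P.vector_space_axioms sub]) (fact mem add scale)+
  then show ?thesis
    using tpow tpow_mem by metis
qed

lemma lowering:
  shows "lowering sV S k \<in> lin_maps tscale (polys sV) (pointwise tscale) (vpolys sV tscale (Sym k))"
    and "lowering sV S k (Spoly n (Tpow n v)) = lowered k n v"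
proof -
  obtain Q where Q: "Q \<in> lin_maps tscale (polys sV) (pointwise tscale) (vpolys sV tscale (Sym k))"
    "\<And>n v. Q (Spoly n (Tpow n v)) = lowered k n v"
    using lowering_exists[of k] by blast
  have "lowering sV S k = Q"
    unfolding lowering_def
  proof (rule the_equality, intro conjI Q(1) allI ballI)
    fix n v \<omega> assume "\<omega> \<in> Dual"
    then show "Q (on_dual sV (\<lambda>\<omega>. S n \<omega> (Tpow n v))) \<omega>
        = tscale (of_nat (falling n k) * S (n - k) \<omega> (Tpow (n - k) v)) (Tpow k v)"
      using Q(2)[of n v] by (simp add: Spoly_def lowered_apply)
  next
    fix Q' assume Q': "Q' \<in> lin_maps tscale (polys sV) (pointwise tscale) (vpolys sV tscale (Sym k)) \<and>
      (\<forall>n v. \<forall>\<omega>\<in>Dual. Q' (on_dual sV (\<lambda>\<omega>. S n \<omega> (Tpow n v))) \<omega>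
        = tscale (of_nat (falling n k) * S (n - k) \<omega> (Tpow (n - k) v)) (Tpow k v))"
    show "Q' = Q"
    proof (rule polys_lin_maps_eqI[OF conjunct1[OF Q'] Q(1)])
      fix n v
      have "Q' (Spoly n (Tpow n v)) \<omega> = lowered k n v \<omega>" for \<omega>
      proof (cases "\<omega> \<in> Dual")
        case True
        then show ?thesis
          using Q' by (simp add: Spoly_def lowered_apply)
      next
        case False
        have "Q' (Spoly n (Tpow n v)) \<in> vpolys sV tscale (Sym k)"
          by (rule lin_maps_in[OF conjunct1[OF Q'] Spoly_mem[OF tpow_mem]])
        from vpolys_values(2)[OF tensor.vector_space_axioms subspace_sym_power this False] show ?thesis
          by (simp add: lowered_apply False)
      qed
      then show "Q' (Spoly n (Tpow n v)) = Q (Spoly n (Tpow n v))"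
        by (simp add: Q(2) fun_eq_iff)
    qed
  qed
  with Q show "lowering sV S k \<in> lin_maps tscale (polys sV) (pointwise tscale) (vpolys sV tscale (Sym k))"
    "lowering sV S k (Spoly n (Tpow n v)) = lowered k n v"
    by simp_all
qed

lemma lowering_values: "p \<in> polys sV \<Longrightarrow> lowering sV S k p \<omega> \<in> Sym k"
  by (rule vpolys_values(1)[OF tensor.vector_space_axioms subspace_sym_power lin_maps_in[OF lowering(1)]])

lemma lowering_eventually_0:
  assumes "p \<in> polys sV"
  shows "\<exists>N. \<forall>k>N. lowering sV S k p = 0"
  using assms
proof (induction rule: polys_induct)
  case zero
  show ?case
    by (simp add: lin_maps_0[OF lowering(1)] del: fun_apply)
next
  case (step c n v q)
  then obtain N where N: "\<forall>k>N. lowering sV S k q = 0"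
    by blast
  have gen: "tscale c (Spoly n (Tpow n v)) \<in> polys sV"
    by (intro tensor.subspace_scale[OF subspace_polys] Spoly_mem tpow_mem)
  have "lowering sV S k (tscale c (Spoly n (Tpow n v)) + q) = 0" if "k > max n N" for k
  proof -
    have "lowered k n v = 0"
      using that by (auto simp: fun_eq_iff lowered_def on_dual_def falling_eq_0)
    moreover have "lowering sV S k (tscale c (Spoly n (Tpow n v)) + q)
        = pointwise tscale c (lowered k n v) + lowering sV S k q"
      by (simp only: lin_maps_add[OF lowering(1) gen step.hyps] lin_maps_scale[OF lowering(1)]
          Spoly_mem tpow_mem lowering(2))
    ultimately show ?thesis
      using N that by (simp add: fun_eq_iff pointwise_def)
  qed
  then show ?case
    by (intro exI[of _ "max n N"] allI impI) (simp del: fun_apply)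
qed

lemma ser_of_lowering_eq:
  assumes G: "G \<in> fseries sV sW" and "\<forall>k>N. lowering sV S k p = 0"
  shows "ser_of_lowering sV sW S G p \<omega> = sW (p \<omega>) (G 0 (Pure [])) + (\<Sum>k = 1..N. G k (lowering sV S k p \<omega>))"
proof -
  have "(\<Sum>k | 1 \<le> k \<and> lowering sV S k p \<noteq> 0. G k (lowering sV S k p \<omega>)) = (\<Sum>k = 1..N. G k (lowering sV S k p \<omega>))"
    using assms(2) by (intro sum.mono_neutral_left) (auto simp: lin_maps_0[OF fseries_coeff[OF G]] not_le[symmetric])
  then show ?thesis
    by (simp add: ser_of_lowering_def)
qed

lemma ser_of_lowering_add:
  assumes "vector_space sW" and G: "G \<in> fseries sV sW" and p: "p \<in> polys sV" and q: "q \<in> polys sV"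
  shows "ser_of_lowering sV sW S G (p + q) = ser_of_lowering sV sW S G p + ser_of_lowering sV sW S G q"
proof -
  interpret W: vector_space sW by fact
  obtain M where M: "\<forall>k>M. lowering sV S k p = 0"
    using lowering_eventually_0[OF p] by blast
  obtain N where N: "\<forall>k>N. lowering sV S k q = 0"
    using lowering_eventually_0[OF q] by blast
  have 1: "\<forall>k>max M N. lowering sV S k p = 0" and 2: "\<forall>k>max M N. lowering sV S k q = 0"
    using M N by simp_all
  then have 3: "\<forall>k>max M N. lowering sV S k (p + q) = 0"
    by (simp add: lin_maps_add[OF lowering(1) p q] del: fun_apply)
  have "G k (lowering sV S k (p + q) \<omega>) = G k (lowering sV S k p \<omega>) + G k (lowering sV S k q \<omega>)" for k \<omega>
    unfolding lin_maps_add[OF lowering(1) p q] plus_fun_apply[of "lowering sV S k p"]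
    by (intro lin_maps_add[OF fseries_coeff[OF G]] lowering_values p q)
  then show ?thesis
    by (intro ext[of "ser_of_lowering sV sW S G (p + q)"])
      (simp add: ser_of_lowering_eq[OF G 1] ser_of_lowering_eq[OF G 2] ser_of_lowering_eq[OF G 3]
        W.scale_left_distrib sum.distrib)
qed

lemma ser_of_lowering_scale:
  assumes "vector_space sW" and G: "G \<in> fseries sV sW" and p: "p \<in> polys sV"
  shows "ser_of_lowering sV sW S G (tscale c p) = pointwise sW c (ser_of_lowering sV sW S G p)"
proof -
  interpret W: vector_space sW by fact
  obtain N where 1: "\<forall>k>N. lowering sV S k p = 0"
    using lowering_eventually_0[OF p] by blast
  then have 2: "\<forall>k>N. lowering sV S k (tscale c p) = 0"
    by (simp add: lin_maps_scale[OF lowering(1) p] pointwise_def[of tscale] tensor.scale_zero_right zero_fun_def[symmetric]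
        del: tscale_apply)
  have "G k (lowering sV S k (tscale c p) \<omega>) = sW c (G k (lowering sV S k p \<omega>))" for k \<omega>
    unfolding lin_maps_scale[OF lowering(1) p] pointwise_def[of tscale]
    by (intro lin_maps_scale[OF fseries_coeff[OF G]] lowering_values p)
  then show ?thesis
    by (intro ext[of "ser_of_lowering sV sW S G (tscale c p)"])
      (simp add: ser_of_lowering_eq[OF G 1] ser_of_lowering_eq[OF G 2] pointwise_def[of sW]
        W.scale_right_distrib W.scale_sum_right)
qed

lemma ser_of_lowering_Spoly:
  assumes "vector_space sW" and G: "G \<in> fseries sV sW"
  shows "ser_of_lowering sV sW S G (Spoly n (Tpow n v)) =
    (\<Sum>k\<le>n. (\<lambda>\<omega>. sW (of_nat (falling n k) * Spoly (n - k) (Tpow (n - k) v) \<omega>) (G k (Tpow k v))))"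
proof
  interpret W: vector_space sW by fact
  fix \<omega>
  have N: "\<forall>k>n. lowering sV S k (Spoly n (Tpow n v)) = 0"
    by (auto simp: lowering(2) lowered_def fun_eq_iff on_dual_def falling_eq_0)
  have "{..n} = insert 0 {1..n}"
    by auto
  then show "ser_of_lowering sV sW S G (Spoly n (Tpow n v)) \<omega> =
    (\<Sum>k\<le>n. (\<lambda>\<omega>. sW (of_nat (falling n k) * Spoly (n - k) (Tpow (n - k) v) \<omega>) (G k (Tpow k v)))) \<omega>"
    unfolding sum_fun_apply
    by (cases "\<omega> \<in> Dual")
      (simp_all add: ser_of_lowering_eq[OF G N] lowering(2) sum_fun_apply lowered_apply Spoly_apply
        lin_maps_scale[OF fseries_coeff[OF G] tpow_mem] lin_maps_0[OF fseries_coeff[OF G]] falling_def[of n 0] tpow_def[of sV 0] del: fun_apply)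
qed

lemma ser_of_lowering_mem:
  assumes "vector_space sW" and G: "G \<in> fseries sV sW" and "p \<in> polys sV"
  shows "ser_of_lowering sV sW S G p \<in> vpolys sV sW UNIV"
proof -
  interpret P: vector_space "pointwise sW :: _ \<Rightarrow> (('v \<Rightarrow> 'f) \<Rightarrow> 'a) \<Rightarrow> _"
    by (rule vector_space_pointwise) fact
  note sub = subspace_vpolys[OF assms(1), of UNIV]
  have gen: "ser_of_lowering sV sW S G (Spoly n (Tpow n v)) \<in> vpolys sV sW UNIV" for n v
    unfolding ser_of_lowering_Spoly[OF assms(1) G]
  proof (rule P.subspace_sum[OF sub])
    fix k
    have "tscale (of_nat (falling n k)) (Spoly (n - k) (Tpow (n - k) v)) \<in> polys sV"
      by (intro tensor.subspace_scale[OF subspace_polys] Spoly_mem tpow_mem)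
    from vpolys_base[OF assms(1) this, of "G k (Tpow k v)" UNIV]
    show "(\<lambda>\<omega>. sW (of_nat (falling n k) * Spoly (n - k) (Tpow (n - k) v) \<omega>) (G k (Tpow k v))) \<in> vpolys sV sW UNIV"
      by simp
  qed
  show ?thesis
    using assms(3)
  proof (induction rule: polys_induct)
    case zero
    have "ser_of_lowering sV sW S G 0 = 0"
      using ser_of_lowering_scale[OF assms(1) G tensor.subspace_0[OF subspace_polys], of 0]
      by (simp only: tensor.scale_zero_left P.scale_zero_left)
    then show ?case
      using P.subspace_0[OF sub] by (simp only:)
  next
    case (step c n v q)
    have "ser_of_lowering sV sW S G (tscale c (Spoly n (Tpow n v)) + q)
        = pointwise sW c (ser_of_lowering sV sW S G (Spoly n (Tpow n v))) + ser_of_lowering sV sW S G q"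
      using step.hyps
      by (simp only: ser_of_lowering_add[OF assms(1) G] ser_of_lowering_scale[OF assms(1) G]
          tensor.subspace_scale[OF subspace_polys] Spoly_mem tpow_mem)
    then show ?case
      using P.subspace_add[OF sub P.subspace_scale[OF sub gen] step.IH] by (simp only:)
  qed
qed


section \<open>The raising operators\<close>

lemma raising_dir:
  shows "raising_dir sV S \<zeta> \<in> lin_maps tscale (polys sV) tscale (polys sV)"
    and "t \<in> Sym n \<Longrightarrow> raising_dir sV S \<zeta> (Spoly n t) = Spoly (Suc n) (t \<odot> Pure [\<zeta>])"
proof -
  have "\<exists>R\<in>lin_maps tscale (polys sV) tscale (polys sV).
      \<forall>n. \<forall>t\<in>Sym n. R (Spoly n t) = Spoly (Suc n) (t \<odot> Pure [\<zeta>])"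
    by (rule polys_extension[OF tensor.vector_space_axioms subspace_polys])
      (simp_all only: Spoly_mem sym_prod_mem sym_prod_add_left sym_prod_scale_left Spoly_add Spoly_scale)
  then obtain R where R: "R \<in> lin_maps tscale (polys sV) tscale (polys sV)"
    "\<And>n t. t \<in> Sym n \<Longrightarrow> R (Spoly n t) = Spoly (Suc n) (t \<odot> Pure [\<zeta>])"
    by blast
  have "raising_dir sV S \<zeta> = R"
    unfolding raising_dir_def
  proof (rule the_equality, intro conjI R(1) allI ballI)
    fix n t \<omega> assume "t \<in> Sym n" "\<omega> \<in> Dual"
    then show "R (on_dual sV (\<lambda>\<omega>. S n \<omega> t)) \<omega> = S (n + 1) \<omega> (t \<odot> Pure [\<zeta>])"
      using R(2)[of t n] by (simp add: Spoly_def[of n] Spoly_apply)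
  next
    fix R' assume R': "R' \<in> lin_maps tscale (polys sV) tscale (polys sV) \<and>
      (\<forall>n. \<forall>t\<in>Sym n. \<forall>\<omega>\<in>Dual. R' (on_dual sV (\<lambda>\<omega>. S n \<omega> t)) \<omega> = S (n + 1) \<omega> (t \<odot> Pure [\<zeta>]))"
    show "R' = R"
    proof (rule polys_lin_maps_eqI[OF conjunct1[OF R'] R(1)])
      fix n v
      have "R' (Spoly n (Tpow n v)) \<omega> = Spoly (Suc n) (Tpow n v \<odot> Pure [\<zeta>]) \<omega>" for \<omega>
      proof (cases "\<omega> \<in> Dual")
        case True
        then show ?thesis
          using R' tpow_mem[of n v] by (simp add: Spoly_def[of n] Spoly_apply)
      next
        case False
        have "R' (Spoly n (Tpow n v)) \<in> polys sV"
          by (rule lin_maps_in[OF conjunct1[OF R'] Spoly_mem[OF tpow_mem]])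
        with False show ?thesis
          by (simp add: polys_iff Spoly_apply)
      qed
      then show "R' (Spoly n (Tpow n v)) = R (Spoly n (Tpow n v))"
        by (simp add: R(2) tpow_mem fun_eq_iff)
    qed
  qed
  with R show "raising_dir sV S \<zeta> \<in> lin_maps tscale (polys sV) tscale (polys sV)"
    "t \<in> Sym n \<Longrightarrow> raising_dir sV S \<zeta> (Spoly n t) = Spoly (Suc n) (t \<odot> Pure [\<zeta>])"
    by simp_all
qed

text \<open>For \<open>q = \<zeta> p\<close> with \<open>p = \<Sum>\<^sub>n \<langle>S\<^sub>n, p\<^sub>n\<rangle>\<close>, the operator \<open>R\<close> has to give \<open>\<Sum>\<^sub>n \<langle>S\<^sub>n\<^sub>+\<^sub>1, p\<^sub>n \<odot> \<zeta>\<rangle>\<close>.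
  Here \<open>p\<^sub>n \<odot> \<zeta>\<close> is the symmetrization of \<open>p\<^sub>n \<otimes> \<zeta>\<close>, which can be read off from \<open>q\<close> alone, without a decomposition of \<open>q\<close> into products:
  its last argument \<open>\<eta>\<close> selects the scalar polynomial \<open>\<omega> \<mapsto> \<langle>\<eta>, q(\<omega>)\<rangle>\<close>, whose coordinate is
  \<open>\<langle>\<eta>, \<zeta>\<rangle> p\<^sub>n\<close>. This shows that \<open>R\<close> is well defined.\<close>

definition raised :: "(('v \<Rightarrow> 'f) \<Rightarrow> 'v) \<Rightarrow> nat \<Rightarrow> ('f, 'v) tensor" where
  "raised q n = symmetrize (\<lambda>\<omega>s. if \<omega>s \<noteq> [] \<and> last \<omega>s \<in> Dual
     then coord (\<lambda>\<omega>. last \<omega>s (q \<omega>)) n (butlast \<omega>s) else 0)"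

lemma vpolys_dual:
  assumes "q \<in> vpolys sV sV UNIV" "\<eta> \<in> Dual"
  shows "(\<lambda>\<omega>. \<eta> (q \<omega>)) \<in> polys sV"
proof -
  interpret P: vector_space "pointwise sV :: _ \<Rightarrow> (('v \<Rightarrow> 'f) \<Rightarrow> 'v) \<Rightarrow> _"
    by (rule vector_space_pointwise) (rule vector_space_axioms)
  have "q \<in> {q. (\<lambda>\<omega>. \<eta> (q \<omega>)) \<in> polys sV}"
  proof (rule vpolys_minimal[OF vector_space_axioms _ _ assms(1)])
    show "P.subspace {q. (\<lambda>\<omega>. \<eta> (q \<omega>)) \<in> polys sV}"
      using tensor.subspace_0[OF subspace_polys] tensor.subspace_add[OF subspace_polys]
        tensor.subspace_scale[OF subspace_polys] assms(2)
      by (intro P.subspaceI)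
        (auto simp: pointwise_def dual_0 dual_add dual_scale plus_fun_def zero_fun_def)
    fix p w assume "p \<in> polys sV"
    from tensor.subspace_scale[OF subspace_polys this, of "\<eta> w"]
    show "(\<lambda>\<omega>. sV (p \<omega>) w) \<in> {q. (\<lambda>\<omega>. \<eta> (q \<omega>)) \<in> polys sV}"
      by (simp add: dual_scale[OF assms(2)] pointwise_def mult.commute)
  qed
  then show ?thesis
    by simp
qed

lemma raised_add:
  assumes "q \<in> vpolys sV sV UNIV" "r \<in> vpolys sV sV UNIV"
  shows "raised (q + r) n = raised q n + raised r n"
proof -
  have "coord (\<lambda>\<omega>. \<eta> ((q + r) \<omega>)) n = coord (\<lambda>\<omega>. \<eta> (q \<omega>)) n + coord (\<lambda>\<omega>. \<eta> (r \<omega>)) n" if "\<eta> \<in> Dual" for \<eta>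
    using coord_add[OF vpolys_dual[OF assms(1) that] vpolys_dual[OF assms(2) that], of n]
    by (simp add: dual_add[OF that] plus_fun_def[of "\<lambda>\<omega>. \<eta> (q \<omega>)"] del: fun_apply) (simp add: dual_add[OF that])
  then show ?thesis
    unfolding raised_def symmetrize_add[symmetric] by (intro arg_cong[of _ _ symmetrize]) (auto simp: fun_eq_iff)
qed

lemma raised_scale:
  assumes "q \<in> vpolys sV sV UNIV"
  shows "raised (pointwise sV c q) n = tscale c (raised q n)"
proof -
  have "coord (\<lambda>\<omega>. \<eta> (pointwise sV c q \<omega>)) n = tscale c (coord (\<lambda>\<omega>. \<eta> (q \<omega>)) n)" if "\<eta> \<in> Dual" for \<eta>
  proof -
    have "(\<lambda>\<omega>. \<eta> (pointwise sV c q \<omega>)) = tscale c (\<lambda>\<omega>. \<eta> (q \<omega>))"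
      by (simp add: fun_eq_iff pointwise_def[of sV] dual_scale[OF that])
    then show ?thesis
      using coord_scale[OF vpolys_dual[OF assms(1) that]] by (simp only:)
  qed
  then show ?thesis
    unfolding raised_def symmetrize_scale[symmetric] by (intro arg_cong[of _ _ symmetrize]) (auto simp: fun_eq_iff)
qed

lemma tensor_prod_pure1:
  "tensor_prod t (Pure [x]) = (\<lambda>\<omega>s. if \<omega>s \<noteq> [] \<and> last \<omega>s \<in> Dual then t (butlast \<omega>s) * last \<omega>s x else 0)"
proof
  fix \<omega>s
  show "tensor_prod t (Pure [x]) \<omega>s = (if \<omega>s \<noteq> [] \<and> last \<omega>s \<in> Dual then t (butlast \<omega>s) * last \<omega>s x else 0)"
  proof (cases \<omega>s rule: rev_cases)
    case Nil
    then show ?thesis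
      by (simp add: tensor_prod_def pure_Cons)
  next
    case (snoc \<eta>s \<eta>)
    have "tensor_prod t (Pure [x]) \<omega>s
        = (\<Sum>i\<le>length \<omega>s. if i = length \<eta>s then t \<eta>s * Pure [x] [\<eta>] else 0)"
      unfolding tensor_prod_def by (intro sum.cong refl) (auto simp: snoc pure_eq_0)
    also have "\<dots> = t \<eta>s * Pure [x] [\<eta>]"
      by (simp add: snoc)
    finally show ?thesis
      by (simp add: snoc pure_Cons pure_Nil)
  qed
qed

lemma raised_product:
  assumes p: "p \<in> polys sV"
  shows "raised (\<lambda>\<omega>. sV (p \<omega>) \<zeta>) n = coord p n \<odot> Pure [\<zeta>]"
proof -
  have "coord (\<lambda>\<omega>. \<eta> (sV (p \<omega>) \<zeta>)) n = tscale (\<eta> \<zeta>) (coord p n)" if "\<eta> \<in> Dual" for \<eta>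
  proof -
    have "(\<lambda>\<omega>. \<eta> (sV (p \<omega>) \<zeta>)) = tscale (\<eta> \<zeta>) p"
      by (simp add: fun_eq_iff dual_scale[OF that] mult.commute)
    then show ?thesis
      using coord_scale[OF p] by (simp only:)
  qed
  then show ?thesis
    unfolding raised_def sym_prod_def tensor_prod_pure1
    by (intro arg_cong[of _ _ symmetrize]) (auto simp: fun_eq_iff)
qed

lemma raised_mem:
  assumes "q \<in> vpolys sV sV UNIV"
  shows "raised q n \<in> Sym (Suc n)" and "\<exists>N. \<forall>n\<ge>N. raised q n = 0"
proof -
  interpret P: vector_space "pointwise sV :: _ \<Rightarrow> (('v \<Rightarrow> 'f) \<Rightarrow> 'v) \<Rightarrow> _"
    by (rule vector_space_pointwise) (rule vector_space_axioms)
  note sub = subspace_vpolys[OF vector_space_axioms, of UNIV]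
  let ?X = "{q \<in> vpolys sV sV UNIV. (\<forall>n. raised q n \<in> Sym (Suc n)) \<and> (\<exists>N. \<forall>n\<ge>N. raised q n = 0)}"
  have "q \<in> ?X"
  proof (rule vpolys_minimal[OF vector_space_axioms _ _ assms])
    show "P.subspace ?X"
    proof (rule P.subspaceI)
      have "raised 0 n = 0" for n
        using raised_scale[OF P.subspace_0[OF sub], of 0 n] by (simp only: P.scale_zero_left tensor.scale_zero_left)
      then show "0 \<in> ?X"
        using P.subspace_0[OF sub] by (simp add: sym_zero del: fun_apply)
    next
      fix q r assume q: "q \<in> ?X" and r: "r \<in> ?X"
      obtain M where "\<forall>n\<ge>M. raised q n = 0"
        using q by blast
      moreover obtain N where "\<forall>n\<ge>N. raised r n = 0"
        using r by blast
      ultimately have "\<forall>n\<ge>max M N. raised (q + r) n = 0"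
        using q r by (simp add: raised_add del: fun_apply)
      then have "\<exists>N. \<forall>n\<ge>N. raised (q + r) n = 0"
        by blast
      then show "q + r \<in> ?X"
        using q r P.subspace_add[OF sub, of q r] by (simp add: raised_add sym_add del: fun_apply)
    next
      fix c q assume q: "q \<in> ?X"
      then show "pointwise sV c q \<in> ?X"
        using P.subspace_scale[OF sub, of q c]
        by (auto simp: raised_scale sym_scale tensor.scale_zero_right simp del: fun_apply)
    qed
  next
    fix p \<zeta> assume p: "p \<in> polys sV"
    then obtain N where "\<forall>n\<ge>N. coord p n = 0"
      using coord_finite by blast
    then have "\<forall>n\<ge>N. raised (\<lambda>\<omega>. sV (p \<omega>) \<zeta>) n = 0"
      by (simp add: raised_product[OF p] sym_prod_zero_left del: fun_apply)
    then show "(\<lambda>\<omega>. sV (p \<omega>) \<zeta>) \<in> ?X"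
      using vpolys_base[OF vector_space_axioms p, of \<zeta> UNIV] p
      by (auto simp: raised_product sym_prod_mem coord_mem)
  qed
  then show "raised q n \<in> Sym (Suc n)" and "\<exists>N. \<forall>n\<ge>N. raised q n = 0"
    by auto
qed

lemma raising_dir_expand:
  assumes p: "p \<in> polys sV" and N: "\<forall>n\<ge>N. coord p n = 0"
  shows "raising_dir sV S \<zeta> p = (\<Sum>n<N. Spoly (Suc n) (coord p n \<odot> Pure [\<zeta>]))"
proof -
  obtain K where K: "\<And>M. K \<le> M \<Longrightarrow> (\<forall>k\<ge>M. coord p k = 0) \<and> (\<forall>\<omega>\<in>Dual. p \<omega> = (\<Sum>k<M. S k \<omega> (coord p k)))"
    by (rule S_coordsE[OF S_coords_coord[OF p]]) blast
  have "p = (\<Sum>n<N. Spoly n (coord p n))"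
  proof
    fix \<omega>
    show "p \<omega> = (\<Sum>n<N. Spoly n (coord p n)) \<omega>"
    proof (cases "\<omega> \<in> Dual")
      case True
      have "p \<omega> = (\<Sum>k<max K N. S k \<omega> (coord p k))"
        using K[of "max K N"] True by simp
      also have "\<dots> = (\<Sum>k<N. S k \<omega> (coord p k))"
        by (rule sum_S_extend[OF True N, symmetric]) simp
      finally show ?thesis
        by (simp add: sum_fun_apply Spoly_apply True)
    qed (use p in \<open>simp add: polys_iff sum_fun_apply Spoly_apply\<close>)
  qed
  then have "raising_dir sV S \<zeta> p = raising_dir sV S \<zeta> (\<Sum>n<N. Spoly n (coord p n))"
    by (rule arg_cong)
  also have "\<dots> = (\<Sum>n<N. raising_dir sV S \<zeta> (Spoly n (coord p n)))"
    by (intro lin_maps_sum[OF tensor.vector_space_axioms subspace_polys raising_dir(1)] Spoly_mem coord_mem p)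
  finally show ?thesis
    by (simp add: raising_dir(2) coord_mem p)
qed

lemma raising_exists:
  "\<exists>R\<in>lin_maps (pointwise sV) (vpolys sV sV UNIV) tscale (polys sV).
    \<forall>\<zeta>. \<forall>p\<in>polys sV. R (\<lambda>\<omega>. sV (p \<omega>) \<zeta>) = raising_dir sV S \<zeta> p"
proof -
  interpret P: vector_space "pointwise sV :: _ \<Rightarrow> (('v \<Rightarrow> 'f) \<Rightarrow> 'v) \<Rightarrow> _"
    by (rule vector_space_pointwise) (rule vector_space_axioms)
  note sub = subspace_vpolys[OF vector_space_axioms, of UNIV]
  let ?V = "vpolys sV sV UNIV"
  define R where "R q = (\<Sum>n | raised q n \<noteq> 0. Spoly (Suc n) (raised q n))" for q
  have R: "R q = (\<Sum>n<N. Spoly (Suc n) (raised q n))" if "\<forall>n\<ge>N. raised q n = 0" for q N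
    unfolding R_def using that by (intro sum.mono_neutral_left) (auto simp: Spoly_0 not_le[symmetric])
  have "R (q + r) = R q + R r" if q: "q \<in> ?V" and r: "r \<in> ?V" for q r
  proof -
    obtain M where "\<forall>n\<ge>M. raised q n = 0"
      using raised_mem(2)[OF q] by blast
    moreover obtain N where "\<forall>n\<ge>N. raised r n = 0"
      using raised_mem(2)[OF r] by blast
    ultimately have q0: "\<forall>n\<ge>max M N. raised q n = 0" and r0: "\<forall>n\<ge>max M N. raised r n = 0"
      by simp_all
    then have "\<forall>n\<ge>max M N. raised (q + r) n = 0"
      by (simp add: raised_add q r del: fun_apply)
    from R[OF this] R[OF q0] R[OF r0] show ?thesis
      by (simp add: raised_add q r Spoly_add raised_mem(1) sum.distrib del: fun_apply)
  qed
  moreover have "R (pointwise sV c q) = tscale c (R q)" if q: "q \<in> ?V" for c q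
  proof -
    obtain N where q0: "\<forall>n\<ge>N. raised q n = 0"
      using raised_mem(2)[OF q] by blast
    then have "\<forall>n\<ge>N. raised (pointwise sV c q) n = 0"
      by (simp add: raised_scale q tensor.scale_zero_right del: fun_apply)
    from R[OF this] R[OF q0] show ?thesis
      by (simp add: raised_scale q Spoly_scale raised_mem(1) tensor.scale_sum_right del: fun_apply)
  qed
  moreover have "R q \<in> polys sV" if "q \<in> ?V" for q
    unfolding R_def by (intro tensor.subspace_sum[OF subspace_polys] Spoly_mem raised_mem that)
  ultimately have "(\<lambda>q. if q \<in> ?V then R q else 0) \<in> lin_maps (pointwise sV) ?V tscale (polys sV)"
    by (auto simp: lin_maps_def P.subspace_add[OF sub] P.subspace_scale[OF sub] simp del: fun_apply)
  moreover have "R (\<lambda>\<omega>. sV (p \<omega>) \<zeta>) = raising_dir sV S \<zeta> p" if p: "p \<in> polys sV" for p \<zeta>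
  proof -
    obtain N where N: "\<forall>n\<ge>N. coord p n = 0"
      using coord_finite[OF p] by blast
    then have "\<forall>n\<ge>N. raised (\<lambda>\<omega>. sV (p \<omega>) \<zeta>) n = 0"
      by (simp add: raised_product[OF p] sym_prod_zero_left del: fun_apply)
    from R[OF this] show ?thesis
      by (simp add: raising_dir_expand[OF p N] raised_product[OF p])
  qed
  ultimately show ?thesis
    by (intro bexI[of _ "\<lambda>q. if q \<in> ?V then R q else 0"])
      (simp_all add: vpolys_base[OF vector_space_axioms])
qed

lemma raising:
  shows "raising sV S \<in> lin_maps (pointwise sV) (vpolys sV sV UNIV) tscale (polys sV)"
    and "p \<in> polys sV \<Longrightarrow> raising sV S (\<lambda>\<omega>. sV (p \<omega>) \<zeta>) = raising_dir sV S \<zeta> p"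
proof -
  obtain R where R: "R \<in> lin_maps (pointwise sV) (vpolys sV sV UNIV) tscale (polys sV)"
    "\<forall>\<zeta>. \<forall>p\<in>polys sV. R (\<lambda>\<omega>. sV (p \<omega>) \<zeta>) = raising_dir sV S \<zeta> p"
    using raising_exists by blast
  have "raising sV S = R"
    unfolding raising_def
  proof (rule the_equality, intro conjI R)
    fix R' assume R': "R' \<in> lin_maps (pointwise sV) (vpolys sV sV UNIV) tscale (polys sV) \<and>
      (\<forall>\<zeta>. \<forall>p\<in>polys sV. R' (\<lambda>\<omega>. sV (p \<omega>) \<zeta>) = raising_dir sV S \<zeta> p)"
    have "vector_space (pointwise sV :: _ \<Rightarrow> (('v \<Rightarrow> 'f) \<Rightarrow> 'v) \<Rightarrow> _)"
      by (rule vector_space_pointwise) (rule vector_space_axioms)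
    then show "R' = R"
      using conjunct1[OF R'] R(1) unfolding vpolys_def
      by (rule lin_maps_eq_on_span) (use R' R(2) in auto)
  qed
  with R show "raising sV S \<in> lin_maps (pointwise sV) (vpolys sV sV UNIV) tscale (polys sV)"
    "p \<in> polys sV \<Longrightarrow> raising sV S (\<lambda>\<omega>. sV (p \<omega>) \<zeta>) = raising_dir sV S \<zeta> p"
    by simp_all
qed


section \<open>Multiplication in terms of the lowering and raising operators\<close>

text \<open>On \<open>\<langle>S\<^sub>n(\<cdot>), v\<^sup>\<otimes>\<^sup>n\<rangle>\<close> the term of \<open>G(Q)\<close> with \<open>Q\<^sup>k\<close> is the term \<open>m = n - k\<close> of \<open>mult_generating\<close>.\<close>

lemma mult_op_Spoly:
  "mult_op \<zeta> (Spoly n (Tpow n v)) = raising sV S (ser_of_lowering sV sV S (\<Psi> \<zeta>) (Spoly n (Tpow n v)))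
    + ser_of_lowering sV (*) S (\<Delta> \<zeta>) (Spoly n (Tpow n v))"
proof
  fix \<omega>
  let ?p = "\<lambda>k. tscale (of_nat (falling n k)) (Spoly (n - k) (Tpow (n - k) v))"
  let ?\<psi> = "\<lambda>k. \<Psi> \<zeta> k (Tpow k v)"
  have p: "?p k \<in> polys sV" for k
    by (intro tensor.subspace_scale[OF subspace_polys] Spoly_mem tpow_mem)
  have "raising sV S (ser_of_lowering sV sV S (\<Psi> \<zeta>) (Spoly n (Tpow n v)))
      = raising sV S (\<Sum>k\<le>n. (\<lambda>\<omega>. sV (?p k \<omega>) (?\<psi> k)))"
    by (simp add: ser_of_lowering_Spoly[OF vector_space_axioms \<Psi>_fseries])
  also have "\<dots> = (\<Sum>k\<le>n. raising sV S (\<lambda>\<omega>. sV (?p k \<omega>) (?\<psi> k)))"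
    by (intro lin_maps_sum[OF vector_space_pointwise subspace_vpolys raising(1)] vpolys_base
        vector_space_axioms p UNIV_I)
  also have "\<dots> = (\<Sum>k\<le>n. tscale (of_nat (falling n k)) (Spoly (Suc (n - k)) (Symt (?\<psi> k # replicate (n - k) v))))"
    by (intro sum.cong refl)
      (simp only: raising(2)[OF p] lin_maps_scale[OF raising_dir(1)] raising_dir(2) Spoly_mem tpow_mem tpow_sym_prod)
  finally have R: "raising sV S (ser_of_lowering sV sV S (\<Psi> \<zeta>) (Spoly n (Tpow n v))) =
      (\<Sum>k\<le>n. tscale (of_nat (falling n k)) (Spoly (Suc (n - k)) (Symt (?\<psi> k # replicate (n - k) v))))" .
  have rev: "(\<Sum>k\<le>n. f k (n - k)) = (\<Sum>m\<le>n. f (n - m) m)" for f :: "nat \<Rightarrow> nat \<Rightarrow> 'f"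
    by (rule sum.reindex_bij_witness[of _ "\<lambda>m. n - m" "\<lambda>k. n - k"]) auto
  show "mult_op \<zeta> (Spoly n (Tpow n v)) \<omega> = (raising sV S (ser_of_lowering sV sV S (\<Psi> \<zeta>) (Spoly n (Tpow n v)))
    + ser_of_lowering sV (*) S (\<Delta> \<zeta>) (Spoly n (Tpow n v))) \<omega>"
  proof (cases "\<omega> \<in> Dual")
    case True
    have "(\<Sum>k\<le>n. of_nat (falling n k) * S (Suc (n - k)) \<omega> (Symt (?\<psi> k # replicate (n - k) v)))
        = (\<Sum>m\<le>n. of_nat (falling n (n - m)) * S (Suc m) \<omega> (Symt (?\<psi> (n - m) # replicate m v)))"
      by (rule rev)
    moreover have "(\<Sum>k\<le>n. of_nat (falling n k) * S (n - k) \<omega> (Tpow (n - k) v) * \<Delta> \<zeta> k (Tpow k v))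
        = (\<Sum>m\<le>n. of_nat (falling n (n - m)) * S m \<omega> (Tpow m v) * \<Delta> \<zeta> (n - m) (Tpow (n - m) v))"
      by (rule rev)
    ultimately show ?thesis
      by (simp add: mult_op_def R ser_of_lowering_Spoly[OF vector_space_field \<Delta>_fseries] sum_fun_apply
          Spoly_apply True mult_generating[OF True] mult.assoc)
  qed (simp add: mult_op_def R ser_of_lowering_Spoly[OF vector_space_field \<Delta>_fseries] sum_fun_apply Spoly_apply)
qed

lemma mult_op_eq:
  assumes "p \<in> polys sV"
  shows "mult_op \<zeta> p = raising sV S (ser_of_lowering sV sV S (\<Psi> \<zeta>) p) + ser_of_lowering sV (*) S (\<Delta> \<zeta>) p"
proof -
  note V = vector_space_axioms \<Psi>_fseries[of \<zeta>] and F = vector_space_field \<Delta>_fseries[of \<zeta>]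
  let ?G = "\<lambda>p. ser_of_lowering sV sV S (\<Psi> \<zeta>) p" and ?D = "\<lambda>p. ser_of_lowering sV (*) S (\<Delta> \<zeta>) p"
  have add: "raising sV S (?G (p + q)) + ?D (p + q) = (raising sV S (?G p) + ?D p) + (raising sV S (?G q) + ?D q)"
    if "p \<in> polys sV" "q \<in> polys sV" for p q
    using that
    by (simp only: ser_of_lowering_add[OF V] ser_of_lowering_add[OF F] lin_maps_add[OF raising(1)]
        ser_of_lowering_mem[OF V] ac_simps)
  have scale: "raising sV S (?G (tscale c p)) + ?D (tscale c p) = tscale c (raising sV S (?G p) + ?D p)"
    if "p \<in> polys sV" for p c
    using that
    by (simp only: ser_of_lowering_scale[OF V] ser_of_lowering_scale[OF F] lin_maps_scale[OF raising(1)]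
        ser_of_lowering_mem[OF V] tensor.scale_right_distrib)
  show ?thesis
    using assms
  proof (induction rule: polys_induct)
    case zero
    have "raising sV S (?G 0) + ?D 0 = 0"
      using scale[OF tensor.subspace_0[OF subspace_polys], of 0] by (simp only: tensor.scale_zero_left)
    then show ?case
      by (simp only:) (simp add: mult_op_def fun_eq_iff)
  next
    case (step c n v q)
    have gen: "tscale c (Spoly n (Tpow n v)) \<in> polys sV"
      by (intro tensor.subspace_scale[OF subspace_polys] Spoly_mem tpow_mem)
    have "mult_op \<zeta> (tscale c (Spoly n (Tpow n v)) + q) = tscale c (mult_op \<zeta> (Spoly n (Tpow n v))) + mult_op \<zeta> q"
      by (simp add: mult_op_def fun_eq_iff algebra_simps)
    then show ?case
      using step by (simp only: mult_op_Spoly step.IH add[OF gen step.hyps] scale Spoly_mem tpow_mem)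
  qed
qed

end

theorem theorem6p5:
  fixes sV :: "'f::{real_normed_field, euclidean_space} \<Rightarrow> 'v::ab_group_add \<Rightarrow> 'v"
    and S :: "nat \<Rightarrow> ('v \<Rightarrow> 'f) \<Rightarrow> ('f, 'v) tensor \<Rightarrow> 'f"
    and B L :: "nat \<Rightarrow> ('f, 'v) tensor \<Rightarrow> 'v"
    and \<alpha> :: "nat \<Rightarrow> ('f, 'v) tensor \<Rightarrow> 'f"
    and \<Psi> :: "'v \<Rightarrow> nat \<Rightarrow> ('f, 'v) tensor \<Rightarrow> 'v"
    and \<Delta> :: "'v \<Rightarrow> nat \<Rightarrow> ('f, 'v) tensor \<Rightarrow> 'f"
  assumes V: "vector_space sV"
    and S: "monic_sheffer_seq sV S B \<alpha>"
    and L: "L = ser_inverse sV B"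
    and \<Psi>: "\<And>\<zeta>. \<Psi> \<zeta> = ser_comp sV sV (ser_deriv sV sV L \<zeta>) B"
    and \<Delta>: "\<And>\<zeta>. \<Delta> \<zeta> = - ser_deriv_dir sV (*) \<alpha> (\<Psi> \<zeta>)"
  shows "\<forall>\<zeta>.
    (\<forall>p\<in>polys sV.
       mult_op \<zeta> p = raising sV S (ser_of_lowering sV sV S (\<Psi> \<zeta>) p)
                      + ser_of_lowering sV (*) S (\<Delta> \<zeta>) p) \<and>
    (\<forall>n. \<forall>\<omega>\<in>dual_space sV. \<forall>v.
       \<omega> \<zeta> * S n \<omega> (tpow sV n v) =
         S (n + 1) \<omega> (tpow sV n v \<odot> pure_tensor sV [\<zeta>])
         + (\<Sum>m = 1..n. S m \<omega>
              (tscale (of_nat (falling n (n - m + 1)))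
                 (tpow sV (m - 1) v
                  \<odot> pure_tensor sV [\<Psi> \<zeta> (n - m + 1) (tpow sV (n - m + 1) v)])
               + tscale (of_nat (falling n (n - m)) * \<Delta> \<zeta> (n - m) (tpow sV (n - m) v))
                   (tpow sV m v)))
         + fact n * \<Delta> \<zeta> n (tpow sV n v))"
proof -
  interpret X: sheffer sV S B \<alpha>
    using V S by (simp add: sheffer_def tensor_space_def sheffer_axioms_def)
  have "X.\<Psi> = \<Psi>" and "X.\<Delta> = \<Delta>"
    by (simp_all add: fun_eq_iff X.\<Psi>_def X.L_def X.\<Delta>_def \<Psi> \<Delta> L)
  with X.mult_op_eq X.mult_formula show ?thesis
    by simp
qed

end
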